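(* Let $n,n'\ge1$ be coprime integers, $N\ge1$, $q,v,u_0,\dots,u_{n-1}\in\mathbb{C}^*$. In $\mathbf{C}^{(n,n')}_{u_0,\dots,u_{n-1}}=(\mathbb{C}^n[Y^{\pm1}])^{\otimes N}$ put $A_\lambda=\mathbf{A}_1^{\lambda_1}\cdots\mathbf{A}_N^{\lambda_N}(e_0\otimes\dots\otimes e_0)$ for $\lambda\in\mathbb{Z}^N$. The vectors $A_\lambda$ form a basis of $(\mathbb{C}^n[Y^{\pm1}])^{\otimes N}$. The transition matrix from the basis $e_\lambda$ to the basis $A_\lambda$ is triangular; moreover $$A_\lambda=\alpha_{\lambda,\lambda}e_\lambda+\sum_{\mu\prec\lambda}\alpha_{\lambda,\mu}e_\mu,$$ where the coefficients $\alpha_{\lambda,\mu}\in\mathbb{Z}[q^{\pm1},v^{\pm1}]$ and $\alpha_{\lambda,\lambda}$ is invertible in $\mathbb{Z}[q^{\pm1},v^{\pm1}]$.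
   Context: **Representation.** $V=\mathbb{C}^n[Y^{\pm1}]$, $\mathbb{C}^n$ with basis $e_0,\dots,e_{n-1}$; $e_{nj+a}=Y^je_a$ ($j\in\mathbb{Z}$, $0\le a<n$); $e_\lambda=e_{\lambda_1}\otimes\dots\otimes e_{\lambda_N}$ for $\lambda\in\mathbb{Z}^N$. On $V^{\otimes N}=(\mathbb{C}^n)^{\otimes N}[Y_1^{\pm1},\dots,Y_N^{\pm1}]$ there are operators: multiplication by $Y_i$; $T_i=s_i^YR_{i,i+1}+(v-v^{-1})\frac{s_i^Y-1}{Y_i/Y_{i+1}-1}$, where $s_i^Y$ swaps only the variables $Y_i,Y_{i+1}$ and $R=v\sum_aE_{aa}\otimes E_{aa}+\sum_{a<b}(E_{ab}\otimes E_{ba}+E_{ba}\otimes E_{ab}+(v-v^{-1})E_{aa}\otimes E_{bb})$ acts on tensor factors $i,i+1$; $\pi=\kappa_1^{n'}D_1s_1\cdots s_{N-1}$, where $s_i$ swaps tensor factors $i,i+1$ of $V^{\otimes N}$, $\kappa e_i=e_{i-1}$, $D(Y^je_a)=u_aq^jY^je_a$ ($0\le a<n$), subscript $1$ = acting on the first factor. These give an action of the double affine Hecke algebra, denoted $\mathbf{C}^{(n,n')}_{u_0,\dots,u_{n-1}}$. Put $X_1=T_1\cdots T_{N-1}\pi^{-1}$. **Operators.** Let $m,m'$ be the integers with $nm'-n'm=1$, $0\le m<n$. $\mathbf{A}_1=W_1\cdots W_{m+m'}$ with $W_j=Y_1$ if $\lfloor\frac{jm}{m+m'}\rfloor=\lfloor\frac{(j-1)m}{m+m'}\rfloor$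 and $W_j=X_1^{-1}$ otherwise; $\mathbf{A}_{i+1}=T_i\cdots T_1\mathbf{A}_1T_1\cdots T_i$. The $\mathbf{A}_i$ are invertible and commute. **Order.** For $\lambda,\mu\in\mathbb{Z}^N$, $\lambda\le\mu$ means $\mu-\lambda$ is a nonnegative integer combination of the simple roots $\epsilon_i-\epsilon_{i+1}$; $\lambda^+$ is the weakly decreasing rearrangement of $\lambda$. $\lambda\prec\mu$ iff $\lambda^+<\mu^+$, or $\lambda^+=\mu^+$ and $\lambda<\mu$.
   Formalization: The coefficients are allowed an extra Laurent monomial factor in u_0,…,u_{n-1} times an element of Z[q^±1,v^±1] (invertible on the diagonal), since e.g. for n=2, n'=N=1 one has A_1 e_0 = u_0 e_1, so the claim fails for general u_a. *)

theory Defs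
  imports Complex_Main "HOL-Library.Poly_Mapping"
begin

text \<open>
  The space \<open>(C^n[Y, Y^{-1}])^{\<otimes>N}\<close> is modelled as the free complex vector space on the symbols
  \<open>e_\<lambda>\<close>, \<open>\<lambda> \<in> Z^N\<close>, where \<open>e_\<lambda> = e_{\<lambda>_1} \<otimes> \<dots> \<otimes> e_{\<lambda>_N}\<close> and \<open>e_{nj+a} = Y^j e_a\<close> (\<open>0 \<le> a < n\<close>): the exponent of
  \<open>Y_i\<close> in \<open>e_\<lambda>\<close> is \<open>\<lambda> i div n\<close> and the index of the basis vector of the \<open>i\<close>-th \<open>C^n\<close> is \<open>\<lambda> i mod n\<close>.
  Positions are numbered \<open>1, \<dots>, N\<close>.  A weight is a function \<open>nat \<Rightarrow> int\<close>; those vanishing outside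
  \<open>{1..N}\<close> form \<open>Z^N\<close>.  The ambient type contains the vectors \<open>e_\<lambda>\<close> for all \<open>\<lambda> :: nat \<Rightarrow> int\<close>, so
  the \<open>N\<close>-fold tensor power is its subspace \<open>tpow N\<close>.
\<close>

type_synonym weight = "nat \<Rightarrow> int"
type_synonym tens = "weight \<Rightarrow>\<^sub>0 complex"

definition wts :: "nat \<Rightarrow> weight set" where
  "wts N = {lam. \<forall>i. i \<notin> {1..N} \<longrightarrow> lam i = 0}"

definition scale :: "complex \<Rightarrow> tens \<Rightarrow> tens" where
  "scale c x = Poly_Mapping.map ((*) c) x"

definition bas :: "weight \<Rightarrow> tens" where
  "bas lam = Poly_Mapping.single lam 1"

definition tpow :: "nat \<Rightarrow> tens set" where
  "tpow N = {x. Poly_Mapping.keys x \<subseteq> wts N}"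

definition lin :: "(weight \<Rightarrow> tens) \<Rightarrow> tens \<Rightarrow> tens" where
  "lin f x = (\<Sum>lam\<in>Poly_Mapping.keys x. scale (Poly_Mapping.lookup x lam) (f lam))"

lemma lookup_scale [simp]: "Poly_Mapping.lookup (scale c x) k = c * Poly_Mapping.lookup x k"
  by (simp add: scale_def Poly_Mapping.map.rep_eq when_def)

lemma vector_space_scale: "vector_space scale"
  by unfold_locales (auto intro!: poly_mapping_eqI simp: lookup_add algebra_simps)

lemma lin_superset:
  assumes "finite S" "Poly_Mapping.keys x \<subseteq> S"
  shows "lin f x = (\<Sum>l\<in>S. scale (Poly_Mapping.lookup x l) (f l))"
proof -
  interpret vector_space scale by (rule vector_space_scale)
  show ?thesis unfolding lin_def
    by (rule sum.mono_neutral_left) (use assms in \<open>auto simp: in_keys_iff\<close>)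
qed

lemma lin_add: "lin f (x + y) = lin f x + lin f y"
proof -
  interpret vector_space scale by (rule vector_space_scale)
  let ?S = "Poly_Mapping.keys x \<union> Poly_Mapping.keys y"
  have "Poly_Mapping.keys (x + y) \<subseteq> ?S" by (rule Poly_Mapping.keys_add)
  then show ?thesis
    by (simp add: lin_superset[of ?S] lookup_add scale_left_distrib sum.distrib)
qed

lemma lin_scale: "lin f (scale c x) = scale c (lin f x)"
proof -
  interpret vector_space scale by (rule vector_space_scale)
  have "Poly_Mapping.keys (scale c x) \<subseteq> Poly_Mapping.keys x" by (auto simp: in_keys_iff)
  then show ?thesis
    by (simp add: lin_superset[of "Poly_Mapping.keys x"] scale_sum_right)
qed

lemma lin_diff: "lin f (x - y) = lin f x - lin f y"
proof -
  have "lin f (x - y) + lin f y = lin f x" by (simp flip: lin_add)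
  then show ?thesis by (simp add: algebra_simps)
qed

lemma lin_bas [simp]: "lin f (bas l) = f l"
proof -
  interpret vector_space scale by (rule vector_space_scale)
  show ?thesis by (simp add: lin_def bas_def)
qed

lemma lin_bas_id: "lin bas x = x"
proof (rule poly_mapping_eqI)
  fix k
  show "Poly_Mapping.lookup (lin bas x) k = Poly_Mapping.lookup x k"
    by (simp add: lin_def lookup_sum bas_def lookup_single when_def in_keys_iff
        if_distrib[of "(*) _"] sum.delta cong: if_cong)
qed

lemma tens_induct [case_names zero add]:
  assumes "P 0" "\<And>c l x. P x \<Longrightarrow> P (scale c (bas l) + x)"
  shows "P x"
proof -
  have "P (\<Sum>l\<in>S. scale (c l) (bas l))" if "finite S" for S c
    using that by induction (use assms in auto)
  then have "P (lin bas x)" unfolding lin_def by simp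
  then show ?thesis by (simp add: lin_bas_id)
qed

lemma lookup_lin_inj:
  assumes "inj \<sigma>"
  shows "Poly_Mapping.lookup (lin (\<lambda>l. bas (\<sigma> l)) x) (\<sigma> l) = Poly_Mapping.lookup x l"
  using assms
  by (simp add: lin_def lookup_sum bas_def lookup_single when_def in_keys_iff inj_eq
      if_distrib[of "(*) _"] cong: if_cong)


subsection \<open>Operators\<close>

definition comps :: "('a \<Rightarrow> 'a) list \<Rightarrow> 'a \<Rightarrow> 'a" where
  "comps fs = foldr (\<circ>) fs id"

text \<open>Multiplication by \<open>Y_i^k\<close>.\<close>

definition Ymul :: "nat \<Rightarrow> nat \<Rightarrow> int \<Rightarrow> tens \<Rightarrow> tens" where
  "Ymul n i k = lin (\<lambda>l. bas (l(i := l i + int n * k)))"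

definition swap :: "nat \<Rightarrow> tens \<Rightarrow> tens" where
  "swap i = lin (\<lambda>l. bas (l(i := l (Suc i), Suc i := l i)))"

text \<open>\<open>s_i^Y\<close>: exchange of the variables \<open>Y_i\<close>, \<open>Y_{i+1}\<close> only.\<close>

definition swapY :: "nat \<Rightarrow> nat \<Rightarrow> tens \<Rightarrow> tens" where
  "swapY n i = lin (\<lambda>l. bas (l(i := int n * (l (Suc i) div int n) + l i mod int n,
                              Suc i := int n * (l i div int n) + l (Suc i) mod int n)))"

text \<open>The matrix unit \<open>E_{ab}\<close> (\<open>a, b < n\<close>) in the \<open>i\<close>-th tensor factor, linear over Laurent polynomials.\<close>

definition Emat :: "nat \<Rightarrow> nat \<Rightarrow> nat \<Rightarrow> nat \<Rightarrow> tens \<Rightarrow> tens" where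
  "Emat n i a b = lin (\<lambda>l. if l i mod int n = int b
                            then bas (l(i := int n * (l i div int n) + int a)) else 0)"

definition Rmat :: "nat \<Rightarrow> complex \<Rightarrow> nat \<Rightarrow> tens \<Rightarrow> tens" where
  "Rmat n v i x =
     scale v (\<Sum>a<n. Emat n i a a (Emat n (Suc i) a a x)) +
     (\<Sum>b<n. \<Sum>a<b. Emat n i a b (Emat n (Suc i) b a x) + Emat n i b a (Emat n (Suc i) a b x)
         + scale (v - inverse v) (Emat n i a a (Emat n (Suc i) b b x)))"

text \<open>The operator \<open>(s_i^Y - 1) / (Y_i / Y_{i+1} - 1)\<close>: division is by an injective operator whose
  range contains that of \<open>s_i^Y - 1\<close>.\<close>

definition ddiff :: "nat \<Rightarrow> nat \<Rightarrow> tens \<Rightarrow> tens" where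
  "ddiff n i x = (THE g. Ymul n i 1 (Ymul n (Suc i) (-1) g) - g = swapY n i x - x)"

abbreviation (input) Yratio :: "nat \<Rightarrow> nat \<Rightarrow> tens \<Rightarrow> tens" where
  "Yratio n i x \<equiv> Ymul n i 1 (Ymul n (Suc i) (-1) x)"

lemma Yratio_bas: "Yratio n i (bas l) = bas (l(i := l i + int n, Suc i := l (Suc i) - int n))"
  by (simp add: Ymul_def fun_upd_twist)

lemma Yratio_lin: "Yratio n i x = lin (\<lambda>l. bas (l(i := l i + int n, Suc i := l (Suc i) - int n))) x"
proof (induction x rule: tens_induct)
  case zero then show ?case by (simp add: Ymul_def lin_def)
next
  case (add c l x)
  have "Yratio n i (scale c (bas l) + x) = scale c (Yratio n i (bas l)) + Yratio n i x"
    by (simp add: Ymul_def lin_add lin_scale)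
  then show ?case unfolding add Yratio_bas by (simp add: lin_add lin_scale del: fun_upd_apply)
qed

lemma Yratio_fixed_zero:
  assumes "n > 0" "Yratio n i h = h" shows "h = 0"
proof (rule ccontr)
  assume "h \<noteq> 0"
  then obtain l where l: "Poly_Mapping.lookup h l \<noteq> 0" by (metis poly_mapping_eqI lookup_zero)
  let ?s = "\<lambda>l::weight. l(i := l i + int n, Suc i := l (Suc i) - int n)"
  have inj: "inj ?s"
  proof (rule injI)
    fix x y assume e: "?s x = ?s y"
    show "x = y"
    proof
      fix k show "x k = y k" using fun_cong[OF e, of k] by (auto split: if_splits)
    qed
  qed
  have st: "Poly_Mapping.lookup h (?s l) = Poly_Mapping.lookup h l" for l
    using lookup_lin_inj[OF inj, of h l] assms(2) by (simp add: Yratio_lin)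
  let ?f = "\<lambda>k::nat. (?s ^^ k) l"
  have "Poly_Mapping.lookup h (?f k) = Poly_Mapping.lookup h l" for k
    by (induction k) (simp_all add: st del: fun_upd_apply)
  then have sub: "range ?f \<subseteq> Poly_Mapping.keys h" using l by (auto simp: in_keys_iff)
  have pos: "?f k i = l i + int k * int n" for k by (induction k) (auto simp: algebra_simps)
  have "inj ?f"
  proof (rule injI)
    fix k k' assume "?f k = ?f k'"
    then have "?f k i = ?f k' i" by (rule fun_cong)
    then show "k = k'" unfolding pos using \<open>n > 0\<close> by simp
  qed
  with sub show False using finite_imageD[of ?f UNIV] finite_subset[OF sub finite_keys] infinite_UNIV_nat by blast
qed

lemma ddiff_ex_bas:
  assumes "n > 0"
  shows "\<exists>g. Yratio n i g - g = swapY n i (bas l) - bas l"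
proof -
  define j a k b where "j = l i div int n" and "a = l i mod int n"
    and "k = l (Suc i) div int n" and "b = l (Suc i) mod int n"
  define B where "B = (\<lambda>s t. bas (l(i := int n * s + a, Suc i := int n * t + b)))"
  have Ystep: "Yratio n i (B s t) = B (s + 1) (t - 1)" for s t
    by (simp add: B_def Yratio_bas algebra_simps fun_upd_twist)
  have l: "bas l = B j k" by (simp add: B_def j_def a_def k_def b_def)
  have sl: "swapY n i (bas l) = B k j"
    by (simp add: B_def j_def a_def k_def b_def swapY_def)
  have main: "\<exists>g. Yratio n i g - g = B (s + int d) (t - int d) - B s t" for d s t
  proof (induction d)
    case 0
    have "Yratio n i 0 - 0 = 0" by (simp add: Ymul_def lin_def)
    then show ?case by (intro exI[of _ 0]) simp
  next
    case (Suc d)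
    then obtain g where "Yratio n i g - g = B (s + int d) (t - int d) - B s t" by blast
    then have "Yratio n i (g + B (s + int d) (t - int d)) - (g + B (s + int d) (t - int d))
       = B (s + int (Suc d)) (t - int (Suc d)) - B s t"
      using Ystep[of "s + int d" "t - int d"] by (simp add: Ymul_def lin_add algebra_simps)
    then show ?case by blast
  qed
  show ?thesis
  proof (cases "j \<le> k")
    case True
    with main[of j "nat (k - j)" k] show ?thesis by (simp add: l[symmetric] sl)
  next
    case False
    with main[of k "nat (j - k)" j] obtain g where "Yratio n i g - g = B j k - B k j" by auto
    moreover have "Yratio n i (0 - g) - (0 - g) = 0 - (Yratio n i g - g)"
      unfolding Ymul_def lin_diff by (simp add: lin_def[of _ 0])
    ultimately show ?thesis using l sl by (intro exI[of _ "0 - g"]) simp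
  qed
qed

lemma ddiff_well_defined:
  assumes "n > 0"
  shows "\<exists>!g. Ymul n i 1 (Ymul n (Suc i) (-1) g) - g = swapY n i x - x"
proof -
  interpret vector_space scale by (rule vector_space_scale)
  have "\<exists>g. Yratio n i g - g = swapY n i x - x"
  proof (induction x rule: tens_induct)
    case zero
    show ?case by (intro exI[of _ 0]) (simp add: Ymul_def swapY_def lin_def)
  next
    case (add c l x)
    then obtain g where g: "Yratio n i g - g = swapY n i x - x" by blast
    obtain h where h: "Yratio n i h - h = swapY n i (bas l) - bas l" using ddiff_ex_bas[OF assms] by blast
    have "Yratio n i (scale c h + g) - (scale c h + g) = scale c (Yratio n i h - h) + (Yratio n i g - g)"
      by (simp add: Ymul_def lin_add lin_scale algebra_simps)
    also have "\<dots> = swapY n i (scale c (bas l) + x) - (scale c (bas l) + x)"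
      unfolding g h by (simp add: swapY_def lin_add lin_scale algebra_simps)
    finally show ?case by blast
  qed
  moreover have "g = g'" if "Yratio n i g - g = swapY n i x - x" "Yratio n i g' - g' = swapY n i x - x" for g g'
  proof -
    have "Yratio n i (g - g') - (g - g') = (Yratio n i g - g) - (Yratio n i g' - g')"
      by (simp add: Ymul_def lin_diff)
    then have "Yratio n i (g - g') = g - g'" using that by simp
    then show ?thesis using Yratio_fixed_zero[OF assms] by (metis eq_iff_diff_eq_0)
  qed
  ultimately show ?thesis by blast
qed

definition Top :: "nat \<Rightarrow> complex \<Rightarrow> nat \<Rightarrow> tens \<Rightarrow> tens" where
  "Top n v i x = swapY n i (Rmat n v i x) + scale (v - inverse v) (ddiff n i x)"

definition kappa :: "nat \<Rightarrow> tens \<Rightarrow> tens" where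
  "kappa i = lin (\<lambda>l. bas (l(i := l i - 1)))"

definition Dop :: "nat \<Rightarrow> complex \<Rightarrow> (nat \<Rightarrow> complex) \<Rightarrow> nat \<Rightarrow> tens \<Rightarrow> tens" where
  "Dop n q u i =
     lin (\<lambda>l. scale (u (nat (l i mod int n)) * q powi (l i div int n)) (bas l))"

definition piop :: "nat \<Rightarrow> nat \<Rightarrow> nat \<Rightarrow> complex \<Rightarrow> (nat \<Rightarrow> complex) \<Rightarrow> tens \<Rightarrow> tens" where
  "piop n n' N q u = (kappa 1 ^^ n') \<circ> Dop n q u 1 \<circ> comps (map swap [1..<N])"

text \<open>Inverse and integer powers of an operator on \<open>tpow N\<close>.\<close>

definition opinv :: "nat \<Rightarrow> (tens \<Rightarrow> tens) \<Rightarrow> tens \<Rightarrow> tens" where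
  "opinv N f = inv_into (tpow N) f"

definition oppow :: "nat \<Rightarrow> (tens \<Rightarrow> tens) \<Rightarrow> int \<Rightarrow> tens \<Rightarrow> tens" where
  "oppow N f k = (if k \<ge> 0 then f ^^ nat k else opinv N f ^^ nat (- k))"

definition X1 :: "nat \<Rightarrow> nat \<Rightarrow> nat \<Rightarrow> complex \<Rightarrow> complex \<Rightarrow> (nat \<Rightarrow> complex) \<Rightarrow> tens \<Rightarrow> tens" where
  "X1 n n' N q v u = comps (map (Top n v) [1..<N]) \<circ> opinv N (piop n n' N q u)"

definition Wop :: "nat \<Rightarrow> nat \<Rightarrow> nat \<Rightarrow> complex \<Rightarrow> complex \<Rightarrow> (nat \<Rightarrow> complex) \<Rightarrow> int \<Rightarrow> int
    \<Rightarrow> int \<Rightarrow> tens \<Rightarrow> tens" where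
  "Wop n n' N q v u m m' j =
     (if \<lfloor>real_of_int (j * m) / real_of_int (m + m')\<rfloor>
         = \<lfloor>real_of_int ((j - 1) * m) / real_of_int (m + m')\<rfloor>
      then Ymul n 1 1 else opinv N (X1 n n' N q v u))"

definition A1 :: "nat \<Rightarrow> nat \<Rightarrow> nat \<Rightarrow> complex \<Rightarrow> complex \<Rightarrow> (nat \<Rightarrow> complex) \<Rightarrow> int \<Rightarrow> int
    \<Rightarrow> tens \<Rightarrow> tens" where
  "A1 n n' N q v u m m' = comps (map (Wop n n' N q v u m m') [1..m + m'])"

text \<open>\<open>A_i = T_{i-1} \<dots> T_1 A_1 T_1 \<dots> T_{i-1}\<close>\<close>

definition Aop :: "nat \<Rightarrow> nat \<Rightarrow> nat \<Rightarrow> complex \<Rightarrow> complex \<Rightarrow> (nat \<Rightarrow> complex) \<Rightarrow> int \<Rightarrow> int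
    \<Rightarrow> nat \<Rightarrow> tens \<Rightarrow> tens" where
  "Aop n n' N q v u m m' i =
     comps (map (Top n v) (rev [1..<i])) \<circ> A1 n n' N q v u m m' \<circ> comps (map (Top n v) [1..<i])"

definition Avec :: "nat \<Rightarrow> nat \<Rightarrow> nat \<Rightarrow> complex \<Rightarrow> complex \<Rightarrow> (nat \<Rightarrow> complex) \<Rightarrow> int \<Rightarrow> int
    \<Rightarrow> weight \<Rightarrow> tens" where
  "Avec n n' N q v u m m' lam =
     comps (map (\<lambda>i. oppow N (Aop n n' N q v u m m' i) (lam i)) [1..<Suc N]) (bas (\<lambda>_. 0))"


subsection \<open>The order on weights\<close>

definition sroot :: "nat \<Rightarrow> weight" where
  "sroot i k = of_bool (k = i) - of_bool (k = Suc i)"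

definition dom_le :: "nat \<Rightarrow> weight \<Rightarrow> weight \<Rightarrow> bool" where
  "dom_le N lam mu \<longleftrightarrow> (\<exists>c::nat \<Rightarrow> nat. \<forall>k. mu k - lam k = (\<Sum>i\<in>{1..<N}. int (c i) * sroot i k))"

definition dom_less :: "nat \<Rightarrow> weight \<Rightarrow> weight \<Rightarrow> bool" where
  "dom_less N lam mu \<longleftrightarrow> dom_le N lam mu \<and> lam \<noteq> mu"

definition decr :: "nat \<Rightarrow> weight \<Rightarrow> weight" where
  "decr N lam k = (if k \<in> {1..N} then rev (sort (map lam [1..<Suc N])) ! (k - 1) else 0)"

definition prec :: "nat \<Rightarrow> weight \<Rightarrow> weight \<Rightarrow> bool" where
  "prec N lam mu \<longleftrightarrow> dom_less N (decr N lam) (decr N mu) \<or> (decr N lam = decr N mu \<and> dom_less N lam mu)"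


subsection \<open>Coefficients\<close>

text \<open>\<open>laurent_ring q v\<close> is \<open>Z[q, q^{-1}, v, v^{-1}]\<close>, the subring of the complex numbers generated by
  \<open>q\<close>, \<open>v\<close> and their inverses.\<close>

inductive_set laurent_ring :: "complex \<Rightarrow> complex \<Rightarrow> complex set" for q v where
  one: "1 \<in> laurent_ring q v"
| gen: "x \<in> {q, inverse q, v, inverse v} \<Longrightarrow> x \<in> laurent_ring q v"
| diff: "x \<in> laurent_ring q v \<Longrightarrow> y \<in> laurent_ring q v \<Longrightarrow> x - y \<in> laurent_ring q v"
| mult: "x \<in> laurent_ring q v \<Longrightarrow> y \<in> laurent_ring q v \<Longrightarrow> x * y \<in> laurent_ring q v"

text \<open>The parameters \<open>u_a\<close> enter the expansion of \<open>A_\<lambda>\<close> through Laurent monomials, which cannot be dropped: for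
  \<open>n = 2\<close>, \<open>n' = N = 1\<close> one has \<open>A_1 = Y_1 \<pi>\<close> and \<open>A_1 e_0 = u_0 e_1\<close>.\<close>

definition umono :: "nat \<Rightarrow> (nat \<Rightarrow> complex) \<Rightarrow> (nat \<Rightarrow> int) \<Rightarrow> complex" where
  "umono n u k = (\<Prod>a<n. u a powi k a)"

end

theory Submission
  imports Defs "HOL-Library.Multiset" "HOL-Combinatorics.Transposition"
begin

text \<open>
  Write \<open>x = X_1^{-1}\<close>, \<open>y = Y_1\<close>, \<open>t = T_1\<close>. The relations \<open>xtxt = txtx\<close>, \<open>ytyt = tyty\<close> and \<open>tytxt = xty\<close>
  survive the replacement of \<open>(x, y)\<close> by \<open>(x, yx)\<close> or \<open>(yx, y)\<close>, so Euclid's algorithm gives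
  \<open>A_1 t A_1 t = t A_1 t A_1\<close> for the Christoffel word \<open>A_1\<close>, and the \<open>A_i\<close> commute.

  In the action of \<open>A_1\<close> on \<open>e_\<lambda>\<close> the entry \<open>\<lambda>_1\<close> travels past the others at each letter \<open>x\<close>. Its offset
  stays in \<open>(-n, 0]\<close> at these letters, which forces all side terms to be lower than the main term;
  the same holds for the operators \<open>T_{N-1} \<dots> T_1\<close> applied afterwards. Hence \<open>\<rho> = T_{N-1} \<dots> T_1 A_1\<close> is
  triangular over the affine rotation \<open>\<lambda> \<mapsto> (\<lambda>_2, \<dots>, \<lambda>_N, \<lambda>_1 + 1)\<close>, an automorphism of the order.
  Writing \<open>A_i = T_i^{-1} \<dots> T_{N-1}^{-1} \<rho> T_1 \<dots> T_{i-1}\<close>, where each \<open>T_j\<close> moves up in the order, one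
  raises the first maximal entry of a weight by \<open>A_i\<close>, or lowers the last minimal one by \<open>A_i^{-1}\<close>,
  without losing triangularity; since the \<open>A_i\<close> commute, this reaches every \<open>A_\<lambda>\<close> from \<open>e_0\<close>.
\<close>

text \<open>Two readings of triangularity have to be kept apart. In \<open>A_1\<close> the traveller
  passes the other entries whatever their size, so a single \<open>T_j^{-1}\<close> may lower the
  leading weight, and the lower terms of its input need not stay below. Hence \<open>tri\<close>
  compares families of vectors labelled by weights: the label remains the initial weight, only the
  vector attached to it changes, and lower means a lower label. At the end of \<open>rho\<close> the
  family is the basis composed with \<open>rot\<close>; since \<open>rot\<close> preserves the
  order, labels become weights again. From then on a factor \<open>T_j\<close> or
  \<open>T_j^{-1}\<close> is applied only where it exchanges a weakly ascending pair, which is why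
  \<open>A_i\<close> may be used only when the \<open>i\<close>-th entry is in extremal position.
  The relation \<open>n m' - n' m = 1\<close> enters repeatedly: it makes \<open>m\<close>,
  \<open>m'\<close> coprime, so that Euclid's algorithm ends in a single letter; it confines the
  offset at the letters \<open>x\<close>; it makes the total offset 1, so that \<open>rho\<close>
  rotates by exactly one step; and it makes the rescaling by the \<open>u_a\<close> compatible with
  \<open>\<pi>\<close>.\<close>

interpretation tens: vector_space scale by (rule vector_space_scale)

section \<open>Linear operators\<close>

definition linop :: "(tens \<Rightarrow> tens) \<Rightarrow> bool" where
  "linop F \<longleftrightarrow> (\<forall>x y. F (x + y) = F x + F y) \<and> (\<forall>c x. F (scale c x) = scale c (F x))"

lemma linop_add: "linop F \<Longrightarrow> F (x + y) = F x + F y"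
  and linop_scale: "linop F \<Longrightarrow> F (scale c x) = scale c (F x)"
  by (auto simp: linop_def)

lemma linop_zero: "linop F \<Longrightarrow> F 0 = 0"
  using linop_scale[of F 0 0] by simp

lemma linop_minus: "linop F \<Longrightarrow> F (- x) = - F x"
  using linop_scale[of F "-1" x] by simp

lemma linop_diff: "linop F \<Longrightarrow> F (x - y) = F x - F y"
  using linop_add[of F x "- y"] by (simp add: linop_minus)

lemma linop_sum: "linop F \<Longrightarrow> F (sum f S) = (\<Sum>s\<in>S. F (f s))"
  by (induction S rule: infinite_finite_induct) (auto simp: linop_zero linop_add)

lemma linop_lin: "linop (lin f)"
  by (simp add: linop_def lin_add lin_scale)

lemma linop_comp: "linop F \<Longrightarrow> linop G \<Longrightarrow> linop (F \<circ> G)"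
  by (simp add: linop_def)

lemma linop_id: "linop id"
  by (simp add: linop_def)

lemma linop_ext:
  assumes "linop F" "linop G" "\<And>l. F (bas l) = G (bas l)"
  shows "F = G"
proof
  fix x show "F x = G x"
    by (induction x rule: tens_induct)
      (use assms in \<open>auto simp: linop_zero linop_add linop_scale\<close>)
qed

lemma linop_Ymul: "linop (Ymul n i k)" and linop_swapY: "linop (swapY n i)"
  and linop_Emat: "linop (Emat n i a b)" and linop_swap: "linop (swap i)"
  and linop_kappa: "linop (kappa i)" and linop_Dop: "linop (Dop n q u i)"
  by (simp_all add: Ymul_def swapY_def Emat_def swap_def kappa_def Dop_def linop_lin)

lemma linop_plusI: "linop F \<Longrightarrow> linop G \<Longrightarrow> linop (\<lambda>x. F x + G x)"
  by (simp add: linop_def tens.scale_right_distrib algebra_simps)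

lemma linop_scaleI: "linop F \<Longrightarrow> linop (\<lambda>x. scale c (F x))"
  by (simp add: linop_def tens.scale_right_distrib mult.commute)

lemma linop_diffI: "linop F \<Longrightarrow> linop G \<Longrightarrow> linop (\<lambda>x. F x - G x)"
  by (simp add: linop_def tens.scale_right_diff_distrib)

lemma linop_sumI: "(\<And>s. s \<in> S \<Longrightarrow> linop (F s)) \<Longrightarrow> linop (\<lambda>x. \<Sum>s\<in>S. F s x)"
  by (simp add: linop_def sum.distrib tens.scale_sum_right)

lemma linop_compI: "linop F \<Longrightarrow> linop G \<Longrightarrow> linop (\<lambda>x. F (G x))"
  by (simp add: linop_def)

lemma linop_Rmat: "linop (Rmat n v i)"
  unfolding Rmat_def
  by (intro linop_plusI linop_scaleI linop_sumI linop_compI[OF linop_Emat linop_Emat])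

lemma Ymul_bas [simp]: "Ymul n i k (bas l) = bas (l(i := l i + int n * k))"
  by (simp add: Ymul_def)

lemma Ymul_add [simp]: "Ymul n i k (x + y) = Ymul n i k x + Ymul n i k y"
  and Ymul_diff [simp]: "Ymul n i k (x - y) = Ymul n i k x - Ymul n i k y"
  and Ymul_scale [simp]: "Ymul n i k (scale c x) = scale c (Ymul n i k x)"
  by (simp_all add: linop_add[OF linop_Ymul] linop_diff[OF linop_Ymul] linop_scale[OF linop_Ymul])

lemma Ymul_Ymul: "Ymul n i j (Ymul n i k x) = Ymul n i (j + k) x"
proof -
  have "Ymul n i j \<circ> Ymul n i k = Ymul n i (j + k)"
    by (rule linop_ext) (auto intro: linop_comp linop_Ymul simp: algebra_simps)
  then show ?thesis by (simp add: fun_eq_iff)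
qed

lemma Ymul_0 [simp]: "Ymul n i 0 x = x"
proof -
  have "Ymul n i 0 = id"
    by (rule linop_ext) (auto intro: linop_id linop_Ymul)
  then show ?thesis by simp
qed

lemma Ymul_commute: "Ymul n i j (Ymul n i' k x) = Ymul n i' k (Ymul n i j x)"
proof -
  have "Ymul n i j \<circ> Ymul n i' k = Ymul n i' k \<circ> Ymul n i j"
    by (rule linop_ext) (auto intro: linop_comp linop_Ymul simp: algebra_simps fun_upd_twist)
  then show ?thesis by (simp add: fun_eq_iff)
qed

lemma Emat_bas: "Emat n i a b (bas l) =
    (if l i mod int n = int b then bas (l(i := int n * (l i div int n) + int a)) else 0)"
  by (simp add: Emat_def)

lemma swapY_bas: "swapY n i (bas l) = bas (l(i := int n * (l (Suc i) div int n) + l i mod int n,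
    Suc i := int n * (l i div int n) + l (Suc i) mod int n))"
  by (simp add: swapY_def)

text \<open>The description by \<open>THE\<close> is accessed only here and in
  \<open>ddiff_eq\<close>: every property of the quotient is proved by checking the equation that
  determines it.\<close>

lemma ddiff_eqI:
  assumes "n > 0" "Yratio n i g - g = swapY n i x - x"
  shows "ddiff n i x = g"
  unfolding ddiff_def using ddiff_well_defined[OF assms(1), of i x] assms(2) by (rule the1_equality)

lemma ddiff_eq:
  assumes "n > 0"
  shows "Yratio n i (ddiff n i x) - ddiff n i x = swapY n i x - x"
  unfolding ddiff_def using theI'[OF ddiff_well_defined[OF assms]] .

lemma linop_ddiff:
  assumes "n > 0"
  shows "linop (ddiff n i)"
  unfolding linop_def
proof (intro conjI allI)
  fix x y show "ddiff n i (x + y) = ddiff n i x + ddiff n i y"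
    by (rule ddiff_eqI[OF assms])
      (use arg_cong2[OF ddiff_eq[OF assms, of i x] ddiff_eq[OF assms, of i y], of "(+)"] in
        \<open>simp add: linop_add[OF linop_swapY] add_diff_add\<close>)
next
  fix c x show "ddiff n i (scale c x) = scale c (ddiff n i x)"
  proof (rule ddiff_eqI[OF assms])
    show "Yratio n i (scale c (ddiff n i x)) - scale c (ddiff n i x) = swapY n i (scale c x) - scale c x"
      using arg_cong[OF ddiff_eq[OF assms, of i x], of "scale c"]
      by (simp add: linop_scale[OF linop_swapY] tens.scale_right_diff_distrib)
  qed
qed

lemma linop_Top: "n > 0 \<Longrightarrow> linop (Top n v i)"
  unfolding Top_def
  by (intro linop_plusI linop_scaleI linop_compI[OF linop_swapY linop_Rmat] linop_ddiff)

lemma swapY_Ymul: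
  assumes "n > 0"
  shows "swapY n i (Ymul n i k x) = Ymul n (Suc i) k (swapY n i x)"
    and "swapY n i (Ymul n (Suc i) k x) = Ymul n i k (swapY n i x)"
    and "j \<noteq> i \<Longrightarrow> j \<noteq> Suc i \<Longrightarrow> swapY n i (Ymul n j k x) = Ymul n j k (swapY n i x)"
proof -
  have 1: "swapY n i \<circ> Ymul n i k = Ymul n (Suc i) k \<circ> swapY n i"
    by (rule linop_ext) (use assms in \<open>auto intro: linop_comp linop_Ymul linop_swapY
      simp: swapY_bas algebra_simps fun_upd_twist\<close>)
  have 2: "swapY n i \<circ> Ymul n (Suc i) k = Ymul n i k \<circ> swapY n i"
    by (rule linop_ext) (use assms in \<open>auto intro: linop_comp linop_Ymul linop_swapY
      simp: swapY_bas algebra_simps fun_upd_twist\<close>)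
  have 3: "swapY n i \<circ> Ymul n j k = Ymul n j k \<circ> swapY n i" if "j \<noteq> i" "j \<noteq> Suc i"
    by (rule linop_ext) (use assms that in \<open>auto intro: linop_comp linop_Ymul linop_swapY
      simp: swapY_bas algebra_simps fun_upd_twist\<close>)
  show "swapY n i (Ymul n i k x) = Ymul n (Suc i) k (swapY n i x)"
    "swapY n i (Ymul n (Suc i) k x) = Ymul n i k (swapY n i x)"
    using 1 2 by (simp_all add: fun_eq_iff)
  show "j \<noteq> i \<Longrightarrow> j \<noteq> Suc i \<Longrightarrow> swapY n i (Ymul n j k x) = Ymul n j k (swapY n i x)"
    using 3 by (simp add: fun_eq_iff)
qed

lemma Emat_Ymul:
  assumes "n > 0" "a < n"
  shows "Emat n i a b (Ymul n j k x) = Ymul n j k (Emat n i a b x)"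
proof -
  have "Emat n i a b \<circ> Ymul n j k = Ymul n j k \<circ> Emat n i a b"
  proof (rule linop_ext)
    fix l show "(Emat n i a b \<circ> Ymul n j k) (bas l) = (Ymul n j k \<circ> Emat n i a b) (bas l)"
      using assms by (cases "j = i")
        (auto simp: Emat_bas linop_zero[OF linop_Ymul] algebra_simps fun_upd_twist)
  qed (auto intro: linop_comp linop_Ymul linop_Emat)
  then show ?thesis by (simp add: fun_eq_iff)
qed

lemma Rmat_Ymul:
  assumes "n > 0"
  shows "Rmat n v i (Ymul n j k x) = Ymul n j k (Rmat n v i x)"
  unfolding Rmat_def using assms by (simp add: Emat_Ymul linop_sum[OF linop_Ymul])

text \<open>Twisted Leibniz rule for the divided difference: the corrections come from
  \<open>(Y_{i+1} - Y_i) / (Y_i / Y_{i+1} - 1) = - Y_{i+1}\<close>.\<close>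

lemma ddiff_Ymul:
  assumes "n > 0"
  shows "ddiff n i (Ymul n i 1 x) = Ymul n (Suc i) 1 (ddiff n i x) - Ymul n (Suc i) 1 x"
    and "ddiff n i (Ymul n (Suc i) 1 x) = Ymul n i 1 (ddiff n i x) + Ymul n (Suc i) 1 x"
    and "j \<noteq> i \<Longrightarrow> j \<noteq> Suc i \<Longrightarrow> ddiff n i (Ymul n j k x) = Ymul n j k (ddiff n i x)"
proof -
  note eq = ddiff_eq[OF assms, of i x]
  show "ddiff n i (Ymul n i 1 x) = Ymul n (Suc i) 1 (ddiff n i x) - Ymul n (Suc i) 1 x"
  proof (rule ddiff_eqI[OF assms])
    have "Yratio n i (Ymul n (Suc i) 1 (ddiff n i x)) - Ymul n (Suc i) 1 (ddiff n i x)
        = Ymul n (Suc i) 1 (swapY n i x - x)"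
      unfolding eq[symmetric] by (simp add: Ymul_commute[of n] Ymul_Ymul)
    then show "Yratio n i (Ymul n (Suc i) 1 (ddiff n i x) - Ymul n (Suc i) 1 x)
        - (Ymul n (Suc i) 1 (ddiff n i x) - Ymul n (Suc i) 1 x)
      = swapY n i (Ymul n i 1 x) - Ymul n i 1 x"
      using assms by (simp add: swapY_Ymul Ymul_Ymul algebra_simps)
  qed
  show "ddiff n i (Ymul n (Suc i) 1 x) = Ymul n i 1 (ddiff n i x) + Ymul n (Suc i) 1 x"
  proof (rule ddiff_eqI[OF assms])
    have "Yratio n i (Ymul n i 1 (ddiff n i x)) - Ymul n i 1 (ddiff n i x)
        = Ymul n i 1 (swapY n i x - x)"
      unfolding eq[symmetric] by (simp add: Ymul_commute[of n] Ymul_Ymul)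
    then show "Yratio n i (Ymul n i 1 (ddiff n i x) + Ymul n (Suc i) 1 x)
        - (Ymul n i 1 (ddiff n i x) + Ymul n (Suc i) 1 x)
      = swapY n i (Ymul n (Suc i) 1 x) - Ymul n (Suc i) 1 x"
      using assms by (simp add: swapY_Ymul Ymul_Ymul algebra_simps)
  qed
  show "ddiff n i (Ymul n j k x) = Ymul n j k (ddiff n i x)" if "j \<noteq> i" "j \<noteq> Suc i"
  proof (rule ddiff_eqI[OF assms])
    have "Yratio n i (Ymul n j k (ddiff n i x)) - Ymul n j k (ddiff n i x)
        = Ymul n j k (swapY n i x - x)"
      unfolding eq[symmetric] by (simp add: Ymul_commute[of n])
    then show "Yratio n i (Ymul n j k (ddiff n i x)) - Ymul n j k (ddiff n i x)
      = swapY n i (Ymul n j k x) - Ymul n j k x"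
      using assms that by (simp add: swapY_Ymul)
  qed
qed

text \<open>Bernstein relations of the affine Hecke algebra; the first reads
  \<open>T_i Y_i = Y_{i+1} T_i^{-1}\<close>. As \<open>R\<close> is linear over Laurent polynomials,
  the only correction is that of the divided difference.\<close>

lemma Top_Ymul:
  assumes "n > 0"
  shows "Top n v i (Ymul n i 1 x) = Ymul n (Suc i) 1 (Top n v i x - scale (v - inverse v) x)"
    and "Top n v i (Ymul n (Suc i) 1 x) = Ymul n i 1 (Top n v i x) + scale (v - inverse v) (Ymul n (Suc i) 1 x)"
    and "j \<noteq> i \<Longrightarrow> j \<noteq> Suc i \<Longrightarrow> Top n v i (Ymul n j k x) = Ymul n j k (Top n v i x)"
  using assms
  by (simp_all add: Top_def Rmat_Ymul swapY_Ymul ddiff_Ymul tens.scale_right_distrib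
      tens.scale_right_diff_distrib algebra_simps)

section \<open>The operators \<open>T_i\<close>\<close>

lemma sum_pair_delta:
  fixes t :: "'a::comm_monoid_add"
  shows "(\<Sum>b<n::nat. \<Sum>a<b. if a = B \<and> b = A then t else 0) = (if B < A \<and> A < n then t else 0)"
proof -
  have "(\<Sum>a<b. if a = B \<and> b = A then t else 0) = (if b = A then if B < A then t else 0 else 0)" for b
    by (cases "b = A") simp_all
  then show ?thesis by simp
qed

definition sw :: "nat \<Rightarrow> weight \<Rightarrow> weight" where
  "sw i l = l(i := l (Suc i), Suc i := l i)"

text \<open>In terms of the variables this is multiplication by
  \<open>(Y_{i+1} / Y_i)^s\<close>.\<close>

definition mv :: "nat \<Rightarrow> nat \<Rightarrow> int \<Rightarrow> weight \<Rightarrow> weight" where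
  "mv n i s l = l(i := l i - int n * s, Suc i := l (Suc i) + int n * s)"

text \<open>The permutation part of \<open>R\<close>: the vectors of the two factors are exchanged
  while the exponents of the variables stay.\<close>

definition swres :: "nat \<Rightarrow> nat \<Rightarrow> weight \<Rightarrow> weight" where
  "swres n i l = l(i := int n * (l i div int n) + l (Suc i) mod int n,
     Suc i := int n * (l (Suc i) div int n) + l i mod int n)"

lemma Rmat_bas:
  assumes "n > 0"
  shows "Rmat n v i (bas l) =
    (if l i mod int n = l (Suc i) mod int n then scale v (bas l)
     else if l i mod int n < l (Suc i) mod int n then bas (swres n i l) + scale (v - inverse v) (bas l)
     else bas (swres n i l))"
proof -
  define A B where "A = nat (l i mod int n)" and "B = nat (l (Suc i) mod int n)"
  have A: "l i mod int n = int A" "A < n" and B: "l (Suc i) mod int n = int B" "B < n"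
    using assms by (auto simp: A_def B_def nat_less_iff)
  have li: "int n * (l i div int n) + int A = l i" "int n * (l (Suc i) div int n) + int B = l (Suc i)"
    using A B by (metis mult_div_mod_eq)+
  have 0: "Emat n i a a (Emat n (Suc i) b b (bas l)) = (if a = A \<and> b = B then bas l else 0)" for a b
    by (auto simp: Emat_bas A B li linop_zero[OF linop_Emat])
  have 1: "Emat n i a b (Emat n (Suc i) b a (bas l)) = (if a = B \<and> b = A then bas (swres n i l) else 0)" for a b
    by (auto simp: Emat_bas A B li linop_zero[OF linop_Emat] swres_def fun_upd_twist)
  have 00: "(\<Sum>a<n. Emat n i a a (Emat n (Suc i) a a (bas l))) = (if A = B then bas l else 0)"
    unfolding 0 using A(2) by (auto intro: sum.neutral)
  have 3: "(\<Sum>b<n. \<Sum>a<b. if b = B \<and> a = A then t else 0) = (if A < B \<and> B < n then t else 0)" for t :: tens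
    using sum_pair_delta[of A B t n] by (simp add: conj_commute)
  have 4: "(\<Sum>b<n. \<Sum>a<b. scale c (if a = A \<and> b = B then t else 0)) = (if A < B \<and> B < n then scale c t else 0)" for t :: tens and c
    using sum_pair_delta[of A B "scale c t" n] by (simp add: if_distrib[of "scale c"] cong: if_cong)
  show ?thesis
    unfolding Rmat_def 00 unfolding 0 1 sum.distrib 3 4 sum_pair_delta
    using A B by auto
qed

lemma swapY_swres: "n > 0 \<Longrightarrow> swapY n i (bas (swres n i l)) = bas (sw i l)"
  by (simp add: swapY_bas swres_def sw_def)

lemma swapY_mv: "swapY n i (bas l) = bas (mv n i (l i div int n - l (Suc i) div int n) l)"
proof -
  have "int n * (l (Suc i) div int n) + l i mod int n = l i - int n * (l i div int n - l (Suc i) div int n)"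
    "int n * (l i div int n) + l (Suc i) mod int n = l (Suc i) + int n * (l i div int n - l (Suc i) div int n)"
    by (simp_all add: algebra_simps flip: minus_mult_div_eq_mod)
  then show ?thesis by (simp add: swapY_bas mv_def)
qed

lemma Yratio_mv: "Yratio n i (bas (mv n i s l)) = bas (mv n i (s - 1) l)"
  unfolding Yratio_bas by (simp add: mv_def algebra_simps fun_upd_twist)

lemma mv_0 [simp]: "mv n i 0 l = l"
  by (simp add: mv_def)

lemma sum_telescope_int:
  fixes f :: "int \<Rightarrow> 'a::ab_group_add"
  shows "(\<Sum>s\<in>{a..a + int d - 1}. f (s - 1) - f s) = f (a - 1) - f (a + int d - 1)"
proof (induction d)
  case (Suc d)
  have "{a..a + int (Suc d) - 1} = insert (a + int d) {a..a + int d - 1}" by auto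
  then show ?case by (simp add: Suc)
qed simp

text \<open>With \<open>z = Y_i / Y_{i+1}\<close> and \<open>d\<close> the difference of the
  exponents this is the geometric series
  \<open>(z^{-d} - 1) / (z - 1) = - (z^{-1} + ... + z^{-d})\<close>; the companion for
  \<open>d \<le> 0\<close> is \<open>1 + z + ... + z^{-d-1}\<close>.\<close>

lemma ddiff_bas_ge:
  assumes "n > 0" "l (Suc i) div int n \<le> l i div int n"
  shows "ddiff n i (bas l) = - (\<Sum>s\<in>{1..l i div int n - l (Suc i) div int n}. bas (mv n i s l))"
proof (rule ddiff_eqI[OF assms(1)])
  define d where "d = nat (l i div int n - l (Suc i) div int n)"
  have d: "l i div int n - l (Suc i) div int n = int d" using assms by (simp add: d_def)
  show "Yratio n i (- (\<Sum>s\<in>{1..l i div int n - l (Suc i) div int n}. bas (mv n i s l)))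
      - - (\<Sum>s\<in>{1..l i div int n - l (Suc i) div int n}. bas (mv n i s l)) = swapY n i (bas l) - bas l"
    using sum_telescope_int[of "\<lambda>s. bas (mv n i s l)" 1 d]
    unfolding swapY_mv d
    by (simp add: linop_minus[OF linop_Ymul] linop_sum[OF linop_Ymul] Yratio_mv sum_subtractf algebra_simps
        del: Ymul_bas)
qed

lemma ddiff_bas_le:
  assumes "n > 0" "l i div int n \<le> l (Suc i) div int n"
  shows "ddiff n i (bas l) = (\<Sum>s\<in>{l i div int n - l (Suc i) div int n + 1..0}. bas (mv n i s l))"
proof (rule ddiff_eqI[OF assms(1)])
  define d where "d = nat (l (Suc i) div int n - l i div int n)"
  have d: "l i div int n - l (Suc i) div int n = - int d" using assms by (simp add: d_def)
  show "Yratio n i (\<Sum>s\<in>{l i div int n - l (Suc i) div int n + 1..0}. bas (mv n i s l))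
      - (\<Sum>s\<in>{l i div int n - l (Suc i) div int n + 1..0}. bas (mv n i s l)) = swapY n i (bas l) - bas l"
    using sum_telescope_int[of "\<lambda>s. bas (mv n i s l)" "1 - int d" d]
    unfolding swapY_mv d
    by (simp add: linop_sum[OF linop_Ymul] Yratio_mv sum_subtractf algebra_simps
        del: Ymul_bas)
qed

lemma mv_swap_dvd:
  assumes "l i mod int n = l (Suc i) mod int n"
  shows "mv n i (l i div int n - l (Suc i) div int n) l = sw i l"
proof -
  have "int n * (l i div int n) = l i - l i mod int n"
    "int n * (l (Suc i) div int n) = l (Suc i) - l (Suc i) mod int n"
    by (simp_all add: minus_mod_eq_mult_div)
  then show ?thesis using assms by (simp add: mv_def sw_def right_diff_distrib)
qed

lemma swapY_Rmat_bas:
  assumes "n > 0"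
  shows "swapY n i (Rmat n v i (bas l)) =
    (let d = l i div int n - l (Suc i) div int n in
     if l i mod int n = l (Suc i) mod int n then scale v (bas (sw i l))
     else if l i mod int n < l (Suc i) mod int n
       then bas (sw i l) + scale (v - inverse v) (bas (mv n i d l))
     else bas (sw i l))"
  using assms unfolding Rmat_bas[OF assms] Let_def
  by (auto simp: linop_add[OF linop_swapY] linop_scale[OF linop_swapY] swapY_swres swapY_mv[of n i l] mv_swap_dvd)

lemma mod_eq_iff_dvd: "(a::int) mod n = b mod n \<longleftrightarrow> n dvd a - b"
  by (rule mod_eq_dvd_iff)

text \<open>Subtracting 1 lets the quotient of the difference detect how the residues compare; this
  merges the three cases of \<open>R\<close> into one formula.\<close>

lemma div_diff_cases:
  fixes a b n :: int
  assumes "n > 0"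
  shows "a mod n > b mod n \<Longrightarrow> (a - b - 1) div n = a div n - b div n"
    and "a mod n \<le> b mod n \<Longrightarrow> (a - b - 1) div n = a div n - b div n - 1"
proof -
  have eq: "a - b - 1 = (a mod n - b mod n - 1) + n * (a div n - b div n)"
    using mult_div_mod_eq[of n a] mult_div_mod_eq[of n b] unfolding right_diff_distrib by linarith
  have r: "0 \<le> a mod n" "a mod n < n" "0 \<le> b mod n" "b mod n < n" using assms by simp_all
  { assume "a mod n > b mod n"
    with r have "(a mod n - b mod n - 1) div n = 0" by (intro div_pos_pos_trivial) linarith+
    then show "(a - b - 1) div n = a div n - b div n"
      unfolding eq using assms by simp }
  { assume "a mod n \<le> b mod n"
    with r have "(a mod n - b mod n - 1 + n) div n = 0" by (intro div_pos_pos_trivial) linarith+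
    then have "(a mod n - b mod n - 1) div n = - 1"
      using assms by simp
    then show "(a - b - 1) div n = a div n - b div n - 1"
      unfolding eq using assms by simp }
qed

text \<open>The residues drop out and only the difference of the two entries remains. This
  invariance under a common shift by any integer, not just by multiples of \<open>n\<close>, is what
  allows \<open>\<pi>\<close>, which shifts by \<open>n'\<close>, to be commuted with the
  \<open>T_i\<close>.\<close>

lemma Top_bas_gt:
  assumes "n > 0" "l (Suc i) < l i"
  shows "Top n v i (bas l) =
    scale (if int n dvd l i - l (Suc i) then inverse v else 1) (bas (sw i l))
    - scale (v - inverse v) (\<Sum>s\<in>{1..(l i - l (Suc i) - 1) div int n}. bas (mv n i s l))"
proof -
  let ?d = "l i div int n - l (Suc i) div int n"
  have d: "l (Suc i) div int n \<le> l i div int n" using assms by (simp add: zdiv_mono1)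
  note T = Top_def[of n v i "bas l"] swapY_Rmat_bas[OF assms(1)] ddiff_bas_ge[OF assms(1) d] Let_def
  consider "l i mod int n > l (Suc i) mod int n" | "l i mod int n < l (Suc i) mod int n"
    | "l i mod int n = l (Suc i) mod int n" by linarith
  then show ?thesis
  proof cases
    case 1
    then show ?thesis using assms div_diff_cases(1)[OF _ 1]
      unfolding T mod_eq_iff_dvd[symmetric] by simp
  next
    case 2
    have "l i div int n \<noteq> l (Suc i) div int n"
    proof
      assume "l i div int n = l (Suc i) div int n"
      with 2 have "l i < l (Suc i)" by (metis add_less_cancel_left mult_div_mod_eq)
      with assms show False by simp
    qed
    \<comment> \<open>The last summand of the series cancels against the diagonal term of
      \<open>R\<close>.\<close>
    with d have "{1..?d} = insert ?d {1..?d - 1}" by auto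
    then show ?thesis using 2 assms div_diff_cases(2)[of "int n" "l i" "l (Suc i)"]
      unfolding T mod_eq_iff_dvd[symmetric] by (simp add: tens.scale_right_distrib tens.scale_right_diff_distrib)
  next
    case 3
    have "l i div int n \<noteq> l (Suc i) div int n"
      using 3 assms by (metis mult_div_mod_eq less_irrefl)
    \<comment> \<open>For equal residues the last summand is the swapped vector itself and turns
      \<open>v\<close> into \<open>v - (v - v^{-1}) = v^{-1}\<close>.\<close>
    with d have *: "{1..?d} = insert ?d {1..?d - 1}" by auto
    show ?thesis using 3 assms div_diff_cases(2)[of "int n" "l i" "l (Suc i)"]
      unfolding T mod_eq_iff_dvd[symmetric] * 
      by (simp add: tens.scale_right_distrib tens.scale_right_diff_distrib mv_swap_dvd tens.scale_left_diff_distrib)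
  qed
qed

lemma Top_bas_le:
  assumes "n > 0" "l i \<le> l (Suc i)"
  shows "Top n v i (bas l) =
    scale (if int n dvd l i - l (Suc i) then v else 1) (bas (sw i l))
    + scale (v - inverse v) (\<Sum>s\<in>{- ((l (Suc i) - l i - 1) div int n)..0}. bas (mv n i s l))"
proof -
  let ?d = "l i div int n - l (Suc i) div int n"
  have d: "l i div int n \<le> l (Suc i) div int n" using assms by (simp add: zdiv_mono1)
  note T = Top_def[of n v i "bas l"] swapY_Rmat_bas[OF assms(1)] ddiff_bas_le[OF assms(1) d] Let_def
  consider "l i mod int n > l (Suc i) mod int n" | "l i mod int n < l (Suc i) mod int n"
    | "l i mod int n = l (Suc i) mod int n" by linarith
  then show ?thesis
  proof cases
    case 1
    have "- ((l (Suc i) - l i - 1) div int n) = ?d + 1"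
      using 1 assms div_diff_cases(2)[of "int n" "l (Suc i)" "l i"] by simp
    then show ?thesis using 1
      unfolding T mod_eq_iff_dvd[symmetric] by simp
  next
    case 2
    \<comment> \<open>Here the diagonal term of \<open>R\<close> prolongs the series by one
      summand.\<close>
    from d have *: "{?d..0} = insert ?d {?d + 1..0}" by auto
    have "- ((l (Suc i) - l i - 1) div int n) = ?d"
      using 2 assms div_diff_cases(1)[of "int n" "l i" "l (Suc i)"] div_diff_cases(1)[of "int n" "l (Suc i)" "l i"] by simp
    then show ?thesis using 2 
      unfolding T mod_eq_iff_dvd[symmetric] by (simp add: * tens.scale_right_distrib)
  next
    case 3
    have "- ((l (Suc i) - l i - 1) div int n) = ?d + 1"
      using 3 assms div_diff_cases(2)[of "int n" "l (Suc i)" "l i"] by simp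
    then show ?thesis using 3
      unfolding T mod_eq_iff_dvd[symmetric] by simp
  qed
qed

section \<open>Hecke relations of the \<open>T_i\<close>\<close>

lemma Y_equivariant:
  assumes "linop D" "\<And>x. D (Ymul n k 1 x) = Ymul n k' 1 (D x)"
  shows "D (Ymul n k c x) = Ymul n k' c (D x)"
proof -
  have nat: "D (Ymul n k (int d) x) = Ymul n k' (int d) (D x)" for d x
  proof (induction d)
    case (Suc d)
    have "D (Ymul n k (int (Suc d)) x) = D (Ymul n k 1 (Ymul n k (int d) x))"
      by (simp add: Ymul_Ymul)
    also have "\<dots> = Ymul n k' (int (Suc d)) (D x)"
      unfolding assms(2) Suc by (simp add: Ymul_Ymul)
    finally show ?case .
  qed simp
  show ?thesis
  proof (cases "c \<ge> 0")
    case True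
    then show ?thesis using nat[of "nat c" x] by simp
  next
    case False
    have "D x = Ymul n k' (- c) (D (Ymul n k c x))"
      using nat[of "nat (- c)" "Ymul n k c x"] False by (simp add: Ymul_Ymul)
    then show ?thesis by (simp add: Ymul_Ymul)
  qed
qed

text \<open>An operator that permutes the variables \<open>Y_k\<close> vanishes as soon as it does on the part of degree
  zero in them; relations between the \<open>T_i\<close> thereby reduce to a check on \<open>(C^n)\<close> factors.\<close>

lemma Y_reduce:
  assumes "n > 0" "linop D" "finite K"
    and "\<And>k x. k \<in> K \<Longrightarrow> D (Ymul n k 1 x) = Ymul n (\<sigma> k) 1 (D x)"
    and "\<And>l. \<forall>k\<in>K. 0 \<le> l k \<and> l k < int n \<Longrightarrow> D (bas l) = 0"
  shows "D x = 0"
proof -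
  \<comment> \<open>\<open>J\<close> is the set of positions whose exponent is unrestricted; each
    step pulls a power of one more variable out of the basis vector.\<close>
  have "\<forall>l. (\<forall>k\<in>K - J. 0 \<le> l k \<and> l k < int n) \<longrightarrow> D (bas l) = 0" if "finite J" "J \<subseteq> K" for J
    using that
  proof induction
    case empty
    then show ?case using assms(5) by simp
  next
    case (insert k J)
    show ?case
    proof (intro allI impI)
      fix l assume l: "\<forall>k\<in>K - insert k J. 0 \<le> l k \<and> l k < int n"
      have "bas l = Ymul n k (l k div int n) (bas (l(k := l k mod int n)))"
        by (simp add: mod_mult_div_eq)
      then have "D (bas l) = Ymul n (\<sigma> k) (l k div int n) (D (bas (l(k := l k mod int n))))"
        using Y_equivariant[OF assms(2), of n k "\<sigma> k"] assms(4)[of k] insert.prems by (metis insert_subset)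
      moreover have "D (bas (l(k := l k mod int n))) = 0"
        using insert l assms(1) by (intro insert.IH[THEN spec, THEN mp]) auto
      ultimately show "D (bas l) = 0" by (simp add: linop_zero[OF linop_Ymul])
    qed
  qed
  from this[OF assms(3)] have "D (bas l) = 0" for l by simp
  then have "D = (\<lambda>x. 0)"
    by (intro linop_ext assms(2)) (auto simp: linop_def)
  then show ?thesis by simp
qed

text \<open>In degree zero the divided difference vanishes and \<open>T_i\<close> is
  \<open>R\<close> itself, the action of the finite Hecke algebra.\<close>

lemma Top_block:
  assumes "0 \<le> l i" "l i < int n" "0 \<le> l (Suc i)" "l (Suc i) < int n"
  shows "Top n v i (bas l) = (if l i = l (Suc i) then scale v (bas l)
    else if l i < l (Suc i) then bas (sw i l) + scale (v - inverse v) (bas l) else bas (sw i l))"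
proof -
  have n: "n > 0" using assms by simp
  consider "l i = l (Suc i)" | "l i < l (Suc i)" | "l i > l (Suc i)" by linarith
  then show ?thesis
  proof cases
    case 1
    have "sw i l = l" using 1 by (auto simp: sw_def)
    moreover have "(- 1) div int n = - 1" using n by (simp add: div_eq_minus1)
    ultimately show ?thesis using 1 Top_bas_le[OF n, of l i v] by simp
  next
    case 2
    have "\<not> int n dvd l i - l (Suc i)"
      using 2 assms by (metis mod_eq_iff_dvd mod_pos_pos_trivial less_irrefl)
    moreover have "(l (Suc i) - l i - 1) div int n = 0"
      using 2 assms by (intro div_pos_pos_trivial) auto
    ultimately show ?thesis using 2 Top_bas_le[OF n, of l i v] by simp
  next
    case 3
    have "\<not> int n dvd l i - l (Suc i)"
      using 3 assms by (metis mod_eq_iff_dvd mod_pos_pos_trivial less_irrefl)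
    moreover have "(l i - l (Suc i) - 1) div int n = 0"
      using 3 assms by (intro div_pos_pos_trivial) auto
    ultimately show ?thesis using 3 Top_bas_gt[OF n, of l i v] by simp
  qed
qed

lemma sw_simps [simp]: "sw i l i = l (Suc i)" "sw i l (Suc i) = l i" "sw i (sw i l) = l"
  "k \<noteq> i \<Longrightarrow> k \<noteq> Suc i \<Longrightarrow> sw i l k = l k"
  by (auto simp: sw_def)

text \<open>By the Bernstein relations the defect \<open>D\<close> commutes with \<open>Y_i\<close>
  and \<open>Y_{i+1}\<close>, so only the quadratic relation of \<open>R\<close> on two vectors is
  left to check.\<close>

lemma Top_quadratic:
  assumes "n > 0" "v \<noteq> 0"
  shows "Top n v i (Top n v i x) = scale (v - inverse v) (Top n v i x) + x"
proof -
  let ?h = "v - inverse v" and ?T = "Top n v i"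
  define D where "D = (\<lambda>x. ?T (?T x) - scale ?h (?T x) - x)"
  have lT: "linop ?T" by (rule linop_Top[OF assms(1)])
  note L = linop_add[OF lT] linop_scale[OF lT] linop_diff[OF lT]
  have "D x = 0"
  proof (rule Y_reduce[where D = D and x = x and K = "{i, Suc i}" and \<sigma> = id])
    show "linop D"
      unfolding D_def using linop_id
      by (intro linop_diffI linop_scaleI linop_compI[OF lT lT] lT) (simp add: id_def)
  next
    fix k x assume "k \<in> {i, Suc i}"
    then show "D (Ymul n k 1 x) = Ymul n (id k) 1 (D x)"
      unfolding D_def using assms(1)
      by (auto simp: Top_Ymul L tens.scale_right_distrib tens.scale_right_diff_distrib
          tens.scale_left_diff_distrib algebra_simps)
  next
    fix l assume l: "\<forall>k\<in>{i, Suc i}. 0 \<le> l k \<and> l k < int n"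
    have vv: "v * v = 1 + (v - inverse v) * v" using assms(2) by (simp add: algebra_simps)
    have "sw i l = l" if "l i = l (Suc i)" using that by (auto simp: sw_def)
    then show "D (bas l) = 0"
      unfolding D_def using l vv assms(2)
      by (auto simp: Top_block L tens.scale_left_distrib tens.scale_left_diff_distrib algebra_simps)
  qed (use assms in auto)
  then show ?thesis by (simp add: D_def algebra_simps)
qed

definition Tinv :: "nat \<Rightarrow> complex \<Rightarrow> nat \<Rightarrow> tens \<Rightarrow> tens" where
  "Tinv n v i x = Top n v i x - scale (v - inverse v) x"

lemma linop_Tinv: "n > 0 \<Longrightarrow> linop (Tinv n v i)"
  using linop_id unfolding Tinv_def
  by (intro linop_diffI linop_scaleI linop_Top) (simp_all add: id_def)

lemma Top_Tinv [simp]: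
  assumes "n > 0" "v \<noteq> 0"
  shows "Top n v i (Tinv n v i x) = x" "Tinv n v i (Top n v i x) = x"
  using assms by (simp_all add: Tinv_def linop_diff[OF linop_Top] linop_scale[OF linop_Top] Top_quadratic)

text \<open>The defect carries the variables through the permutation reversing
  \<open>i, i+1, i+2\<close>, the correction terms of both sides being matched by the quadratic
  relation. What is left is the braid relation of \<open>R\<close> on three vectors, checked for
  each order type of the indices.\<close>

lemma Top_braid:
  assumes "n > 0" "v \<noteq> 0"
  shows "Top n v i (Top n v (Suc i) (Top n v i x)) = Top n v (Suc i) (Top n v i (Top n v (Suc i) x))"
proof -
  let ?h = "v - inverse v" and ?a = "Top n v i" and ?b = "Top n v (Suc i)"
  define h where "h = ?h"
  define D where "D = (\<lambda>x. ?a (?b (?a x)) - ?b (?a (?b x)))"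
  have la: "linop ?a" and lb: "linop ?b" by (rule linop_Top[OF assms(1)])+
  note L = linop_add[OF la] linop_scale[OF la] linop_diff[OF la]
    linop_add[OF lb] linop_scale[OF lb] linop_diff[OF lb]
  note Y = Top_Ymul[OF assms(1), where v = v, folded h_def] Top_quadratic[OF assms, folded h_def]
  have "D x = 0"
  proof (rule Y_reduce[where D = D and x = x and K = "{i, Suc i, Suc (Suc i)}"
        and \<sigma> = "\<lambda>k. if k = i then Suc (Suc i) else if k = Suc i then Suc i else i"])
    show "linop D"
      unfolding D_def
      by (intro linop_diffI linop_compI[OF la linop_compI[OF lb la]] linop_compI[OF lb linop_compI[OF la lb]])
  next
    fix k x assume "k \<in> {i, Suc i, Suc (Suc i)}"
    then show "D (Ymul n k 1 x) = Ymul n (if k = i then Suc (Suc i) else if k = Suc i then Suc i else i) 1 (D x)"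
      unfolding D_def
      by (auto simp: Y L tens.scale_right_distrib tens.scale_right_diff_distrib algebra_simps)
  next
    fix l assume l: "\<forall>k\<in>{i, Suc i, Suc (Suc i)}. 0 \<le> l k \<and> l k < int n"
    define P where "P = (\<lambda>a b c. bas (l(i := a, Suc i := b, Suc (Suc i) := c)))"
    define r where "r = (\<lambda>c::int. 0 \<le> c \<and> c < int n)"
    have a: "?a (P a b c) = (if a = b then scale v (P a b c) else if a < b then P b a c + scale h (P a b c) else P b a c)"
      if "r a" "r b" for a b c
      unfolding P_def using that by (subst Top_block) (auto simp: sw_def h_def r_def fun_upd_twist)
    have b: "?b (P a b c) = (if b = c then scale v (P a b c) else if b < c then P a c b + scale h (P a b c) else P a c b)"
      if "r b" "r c" for a b c
      unfolding P_def using that by (subst Top_block) (auto simp: sw_def h_def r_def fun_upd_twist)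
    \<comment> \<open>The quadratic relation satisfied by \<open>v\<close>, multiplied by
      \<open>h\<close>.\<close>
    have hv: "h * v * v = h + h * v * h" using assms(2) by (simp add: algebra_simps h_def)
    have "D (P a b c) = 0" if "r a" "r b" "r c" for a b c
    proof -
      note S = D_def a b that L tens.scale_right_distrib
      show ?thesis
        by (cases a b rule: linorder_cases; cases b c rule: linorder_cases; cases a c rule: linorder_cases)
          (simp_all add: S hv mult.commute[of v h] tens.scale_left_distrib)
    qed
    moreover have "bas l = P (l i) (l (Suc i)) (l (Suc (Suc i)))" by (simp add: P_def)
    ultimately show "D (bas l) = 0" using l by (simp add: r_def)
  qed (use assms in auto)
  then show ?thesis by (simp add: D_def)
qed

lemma Top_commute:
  assumes "n > 0" "Suc i < j"
  shows "Top n v i (Top n v j x) = Top n v j (Top n v i x)"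
proof -
  let ?a = "Top n v i" and ?b = "Top n v j"
  define D where "D = (\<lambda>x. ?a (?b x) - ?b (?a x))"
  have la: "linop ?a" and lb: "linop ?b" by (rule linop_Top[OF assms(1)])+
  note L = linop_add[OF la] linop_scale[OF la] linop_diff[OF la]
    linop_add[OF lb] linop_scale[OF lb] linop_diff[OF lb]
  have ne: "i \<noteq> j" "i \<noteq> Suc j" "Suc i \<noteq> j" "Suc i \<noteq> Suc j" "j \<noteq> i" "j \<noteq> Suc i" using assms(2) by auto
  have "D x = 0"
  proof (rule Y_reduce[where D = D and x = x and K = "{i, Suc i, j, Suc j}"
        and \<sigma> = "\<lambda>k. if k = i then Suc i else if k = Suc i then i else if k = j then Suc j else j"])
    show "linop D"
      unfolding D_def by (intro linop_diffI linop_compI[OF la lb] linop_compI[OF lb la])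
  next
    fix k x assume "k \<in> {i, Suc i, j, Suc j}"
    then show "D (Ymul n k 1 x) = Ymul n (if k = i then Suc i else if k = Suc i then i else if k = j then Suc j else j) 1 (D x)"
      unfolding D_def using ne assms(1)
      by (auto simp: Top_Ymul L algebra_simps)
  next
    fix l assume l: "\<forall>k\<in>{i, Suc i, j, Suc j}. 0 \<le> l k \<and> l k < int n"
    have "sw i (sw j l) = sw j (sw i l)" using ne by (simp add: sw_def fun_upd_twist)
    then show "D (bas l) = 0"
      unfolding D_def using l ne
      by (auto simp: Top_block L tens.scale_right_distrib mult.commute algebra_simps)
  qed (use assms in auto)
  then show ?thesis by (simp add: D_def)
qed

text \<open>Both formulas for \<open>T_j\<close> on the basis see only the difference of the two
  entries, so a monomial operator that shifts both by the same \<open>k\<close> commutes with them,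
  provided its scalars are constant on all weights occurring in the formula. Applied to
  \<open>\<pi>\<close> and to its square.\<close>

lemma Top_intertwine:
  assumes n: "n > 0" and S: "linop S" and Sb: "\<And>l. S (bas l) = scale (c l) (bas (\<sigma> l))"
    and \<sigma>: "\<And>l. \<sigma> l i = l j + k" "\<And>l. \<sigma> l (Suc i) = l (Suc j) + k"
      "\<And>l. \<sigma> (sw j l) = sw i (\<sigma> l)" "\<And>l s. \<sigma> (mv n j s l) = mv n i s (\<sigma> l)"
    and c: "\<And>l. c (sw j l) = c l" "\<And>l s. c (mv n j s l) = c l"
  shows "S (Top n v j x) = Top n v i (S x)"
proof -
  have "S \<circ> Top n v j = Top n v i \<circ> S"
  proof (rule linop_ext)
    fix l
    note L = linop_add[OF S] linop_scale[OF S] linop_diff[OF S] linop_sum[OF S]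
      linop_scale[OF linop_Top[OF n]]
    show "(S \<circ> Top n v j) (bas l) = (Top n v i \<circ> S) (bas l)"
    proof (cases "l (Suc j) < l j")
      case True
      then show ?thesis using n
        by (simp add: L Sb Top_bas_gt \<sigma> c tens.scale_right_diff_distrib tens.scale_sum_right mult.commute)
    next
      case False
      then show ?thesis using n
        by (simp add: L Sb Top_bas_le \<sigma> c tens.scale_right_distrib tens.scale_sum_right mult.commute)
    qed
  qed (use n S linop_Top in \<open>auto intro: linop_comp\<close>)
  then show ?thesis by (simp add: fun_eq_iff)
qed

section \<open>A Bruhat-type order on weights\<close>

text \<open>The dominance order on an orbit lacks the lifting property (a lower weight may become higher after
  both are swapped by \<open>s_i\<close>), so the triangularity is proved for this finer, Bruhat-type order. On a
  line in the direction \<open>\<epsilon>_i - \<epsilon>_j\<close>, \<open>i < j\<close>, weights are compared by \<open>\<bar>\<lambda>_i - \<lambda>_j + 1/2\<bar>\<close>; the shift by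
  \<open>1/2\<close> makes the order invariant under the affine rotation \<open>rot\<close> below.\<close>

definition low :: "nat \<Rightarrow> weight \<Rightarrow> weight \<Rightarrow> bool" where
  "low N mu lam \<longleftrightarrow> (\<exists>i j. 1 \<le> i \<and> i < j \<and> j \<le> N \<and> (\<forall>k. k \<noteq> i \<longrightarrow> k \<noteq> j \<longrightarrow> mu k = lam k)
     \<and> mu i + mu j = lam i + lam j \<and> \<bar>2 * (mu i - mu j) + 1\<bar> < \<bar>2 * (lam i - lam j) + 1\<bar>)"

abbreviation "blt N \<equiv> (low N)\<^sup>+\<^sup>+"
abbreviation "ble N \<equiv> (low N)\<^sup>*\<^sup>*"

lemma lowI:
  assumes "1 \<le> i" "i < j" "j \<le> N" "\<And>k. k \<noteq> i \<Longrightarrow> k \<noteq> j \<Longrightarrow> mu k = lam k"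
    "mu i + mu j = lam i + lam j" "\<bar>2 * (mu i - mu j) + 1\<bar> < \<bar>2 * (lam i - lam j) + 1\<bar>"
  shows "low N mu lam"
  using assms unfolding low_def by blast

lemma lowE:
  assumes "low N mu lam"
  obtains i j where "1 \<le> i" "i < j" "j \<le> N" "\<And>k. k \<noteq> i \<Longrightarrow> k \<noteq> j \<Longrightarrow> mu k = lam k"
    "mu i + mu j = lam i + lam j" "\<bar>2 * (mu i - mu j) + 1\<bar> < \<bar>2 * (lam i - lam j) + 1\<bar>"
  using assms unfolding low_def by blast

text \<open>For \<open>c_k = k / (N + 1)\<close> all differences \<open>c_j - c_i\<close>, \<open>i < j\<close>, lie strictly between 0 and 1, which on
  weights of equal parity is as good as \<open>1/2\<close>.\<close>

definition qnorm :: "nat \<Rightarrow> weight \<Rightarrow> nat" where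
  "qnorm N lam = nat (\<Sum>k\<in>{1..N}. (int (Suc N) * lam k - int k)\<^sup>2)"

lemma square_less:
  fixes p q :: int
  assumes "\<bar>p\<bar> < \<bar>q\<bar>" shows "p\<^sup>2 < q\<^sup>2"
  using power_strict_mono[OF assms, of 2] by simp

text \<open>Along the line the sum of the two entries is fixed, so only the square of their shifted
  difference changes. The strict drop makes \<open>blt\<close> irreflexive and gives the induction
  measure for inverting triangular operators and for spanning.\<close>

lemma low_qnorm:
  assumes "low N mu lam"
  shows "qnorm N mu < qnorm N lam"
proof -
  from assms obtain i j where ij: "1 \<le> i" "i < j" "j \<le> N" "\<And>k. k \<noteq> i \<Longrightarrow> k \<noteq> j \<Longrightarrow> mu k = lam k"
    "mu i + mu j = lam i + lam j" "\<bar>2 * (mu i - mu j) + 1\<bar> < \<bar>2 * (lam i - lam j) + 1\<bar>"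
    by (rule lowE) blast
  define M where "M = int (Suc N)"
  define t where "t = int j - int i"
  have t: "0 < t" "t < M" "M > 0" using ij by (auto simp: t_def M_def)
  define d d' where "d = lam i - lam j" and "d' = mu i - mu j"
  have dd: "\<bar>2 * d' + 1\<bar> < \<bar>2 * d + 1\<bar>" using ij by (simp add: d_def d'_def)
  have "\<bar>M * d' + t\<bar> < \<bar>M * d + t\<bar>"
  proof (cases "d \<ge> 0")
    case True
    have "M * d' \<le> M * (d - 1)" "M * (- d) \<le> M * d'"
      using dd True t by (intro mult_left_mono; linarith)+
    moreover have "0 \<le> M * d" using True t by simp
    ultimately show ?thesis using t unfolding right_diff_distrib mult_minus_right mult_1_right by linarith
  next
    case False
    have "M * d' \<le> M * (- d - 2)" "M * (d + 1) \<le> M * d'" "M * d \<le> M * (- 1)"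
      using dd False t by (intro mult_left_mono; linarith)+
    then show ?thesis using t unfolding right_diff_distrib distrib_left mult_minus_right mult_1_right by linarith
  qed
  then have sq: "(M * d' + t)\<^sup>2 < (M * d + t)\<^sup>2" by (rule square_less)
  have half: "2 * (x\<^sup>2 + y\<^sup>2) = (x + y)\<^sup>2 + (x - y)\<^sup>2" for x y :: int
    by (simp add: power2_eq_square algebra_simps)
  let ?f = "\<lambda>l k. (M * l k - int k)\<^sup>2"
  have "2 * (?f mu i + ?f mu j) = (M * (mu i + mu j) - int i - int j)\<^sup>2 + (M * d' + t)\<^sup>2"
    unfolding half by (simp add: algebra_simps d'_def t_def)
  also have "\<dots> < (M * (lam i + lam j) - int i - int j)\<^sup>2 + (M * d + t)\<^sup>2"
    using sq ij(5) by simp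
  also have "\<dots> = 2 * (?f lam i + ?f lam j)"
    unfolding half by (simp add: algebra_simps d_def t_def)
  finally have 2: "?f mu i + ?f mu j < ?f lam i + ?f lam j" by simp
  have split: "(\<Sum>k\<in>{1..N}. f k) = f i + f j + (\<Sum>k\<in>{1..N} - {i, j}. f k)" for f :: "nat \<Rightarrow> int"
  proof -
    have "{1..N} - {i} - {j} = {1..N} - {i, j}" by auto
    then show ?thesis
      using ij sum.remove[of "{1..N}" i f] sum.remove[of "{1..N} - {i}" j f] by simp
  qed
  have "(\<Sum>k\<in>{1..N} - {i, j}. ?f mu k) = (\<Sum>k\<in>{1..N} - {i, j}. ?f lam k)"
    using ij(4) by (intro sum.cong) auto
  with 2 have "(\<Sum>k\<in>{1..N}. ?f mu k) < (\<Sum>k\<in>{1..N}. ?f lam k)"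
    unfolding split by simp
  moreover have "0 \<le> (\<Sum>k\<in>{1..N}. ?f mu k)" by (simp add: sum_nonneg)
  ultimately show ?thesis unfolding qnorm_def M_def by simp
qed

lemma blt_qnorm: "blt N mu lam \<Longrightarrow> qnorm N mu < qnorm N lam"
  by (induction rule: tranclp_induct) (auto dest: low_qnorm)

lemma ble_qnorm: "ble N mu lam \<Longrightarrow> qnorm N mu \<le> qnorm N lam"
  by (auto dest!: rtranclpD blt_qnorm)

lemma blt_irrefl: "\<not> blt N lam lam"
  using blt_qnorm by blast

lemma ble_blt_iff: "ble N mu lam \<longleftrightarrow> mu = lam \<or> blt N mu lam"
  by (auto dest: rtranclpD tranclp_into_rtranclp)

lemma low_sw_self:
  assumes "1 \<le> i" "Suc i \<le> N" "l i < l (Suc i)"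
  shows "low N l (sw i l)"
  by (rule lowI[of i "Suc i"]) (use assms in auto)

text \<open>\<open>s_i\<close> permutes the positive roots other than its own simple root, so the
  pair \<open>p < q\<close> stays in order and the comparison is merely relocated.\<close>

lemma low_sw:
  assumes "1 \<le> i" "Suc i \<le> N" "1 \<le> p" "p < q" "q \<le> N" "\<And>k. k \<noteq> p \<Longrightarrow> k \<noteq> q \<Longrightarrow> mu k = lam k"
    "mu p + mu q = lam p + lam q" "\<bar>2 * (mu p - mu q) + 1\<bar> < \<bar>2 * (lam p - lam q) + 1\<bar>"
    and "\<not> (p = i \<and> q = Suc i)"
  shows "low N (sw i mu) (sw i lam)"
proof -
  let ?t = "\<lambda>k. if k = i then Suc i else if k = Suc i then i else k"
  have sw: "sw i l k = l (?t k)" for l k by (simp add: sw_def)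
  have tt: "?t (?t k) = k" for k by simp
  show ?thesis
  proof (rule lowI[of "?t p" "?t q"])
    show "1 \<le> ?t p" "?t q \<le> N" "?t p < ?t q" using assms(1-5,9) by auto
    fix k assume "k \<noteq> ?t p" "k \<noteq> ?t q"
    then have "?t k \<noteq> p" "?t k \<noteq> q" by (auto split: if_splits)
    then show "sw i mu k = sw i lam k" unfolding sw by (rule assms(6))
  qed (use assms(7,8) in \<open>simp_all only: sw tt\<close>)
qed

text \<open>The upper of the two weights \<open>l\<close> and \<open>sw i l\<close>, that is, the
  Demazure action of \<open>s_i\<close>.\<close>

definition mx :: "nat \<Rightarrow> weight \<Rightarrow> weight" where
  "mx i l = (if l i < l (Suc i) then sw i l else l)"

text \<open>The lifting property. On the line of the simple root \<open>mx\<close> sees only the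
  unordered pair, so the two results may coincide; on all other lines \<open>s_i\<close> preserves
  \<open>low\<close>, and both \<open>lam\<close> and \<open>sw i lam\<close> lie below
  \<open>mx i lam\<close>.\<close>

lemma low_mx:
  assumes "low N mu lam" "1 \<le> i" "Suc i \<le> N"
  shows "ble N (mx i mu) (mx i lam)"
proof -
  from assms(1) obtain p q where pq: "1 \<le> p" "p < q" "q \<le> N" "\<And>k. k \<noteq> p \<Longrightarrow> k \<noteq> q \<Longrightarrow> mu k = lam k"
    "mu p + mu q = lam p + lam q" "\<bar>2 * (mu p - mu q) + 1\<bar> < \<bar>2 * (lam p - lam q) + 1\<bar>"
    by (rule lowE) blast
  show ?thesis
  proof (cases "p = i \<and> q = Suc i")
    case True
    then have e: "\<And>k. k \<noteq> i \<Longrightarrow> k \<noteq> Suc i \<Longrightarrow> mu k = lam k" "mu i + mu (Suc i) = lam i + lam (Suc i)"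
      "\<bar>2 * (mu i - mu (Suc i)) + 1\<bar> < \<bar>2 * (lam i - lam (Suc i)) + 1\<bar>"
      using pq by auto
    have le: "\<bar>mu i - mu (Suc i)\<bar> \<le> \<bar>lam i - lam (Suc i)\<bar>"
      using e(2,3) by presburger
    show ?thesis
    proof (cases "\<bar>mu i - mu (Suc i)\<bar> = \<bar>lam i - lam (Suc i)\<bar>")
      case True
      then have "{mu i, mu (Suc i)} = {lam i, lam (Suc i)}" using e(2) by (auto simp: abs_if split: if_splits)
      then have "mx i mu k = mx i lam k" for k
        unfolding mx_def sw_def using e(1)[of k] by (cases "k = i"; cases "k = Suc i") (auto simp: doubleton_eq_iff)
      then have "mx i mu = mx i lam" by blast
      then show ?thesis by simp
    next
      case False
      with le have lt: "\<bar>mu i - mu (Suc i)\<bar> < \<bar>lam i - lam (Suc i)\<bar>" by simp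
      have "low N (mx i mu) (mx i lam)"
        by (rule lowI[of i "Suc i"]) (use assms e(1,2) lt in \<open>auto simp: mx_def sw_def\<close>)
      then show ?thesis by blast
    qed
  next
    case False
    have sw: "low N (sw i mu) (sw i lam)"
      by (rule low_sw[OF assms(2,3) pq(1-3) _ pq(5,6) False]) (use pq(4) in auto)
    have up: "ble N lam (mx i lam)"
      using low_sw_self[OF assms(2,3), of lam] by (auto simp: mx_def)
    have up': "ble N (sw i lam) (mx i lam)"
    proof (cases "lam i > lam (Suc i)")
      case True
      then have "low N (sw i lam) (sw i (sw i lam))"
        using low_sw_self[OF assms(2,3), of "sw i lam"] by simp
      then show ?thesis using True by (auto simp: mx_def)
    next
      case False
      show ?thesis
      proof (cases "lam i = lam (Suc i)")
        case True
        then have "sw i lam = lam" by (auto simp: sw_def)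
        then show ?thesis using True by (simp add: mx_def)
      qed (use False in \<open>simp add: mx_def\<close>)
    qed
    show ?thesis
      using sw up up' assms(1) unfolding mx_def[of i mu]
      by (auto intro: converse_rtranclp_into_rtranclp)
  qed
qed

lemma ble_mx:
  assumes "ble N mu lam" "1 \<le> i" "Suc i \<le> N"
  shows "ble N (mx i mu) (mx i lam)"
  using assms(1)
proof induction
  case (step y z)
  show ?case using step.IH low_mx[OF step.hyps(2) assms(2,3)] by (rule rtranclp_trans)
qed simp

text \<open>Strictness could be lost only if \<open>mu\<close> lay in the \<open>s_i\<close>-orbit
  of \<open>lam\<close>; but with a weakly ascending pair \<open>lam\<close> is the bottom of this
  orbit.\<close>

lemma blt_mx:
  assumes "blt N mu lam" "1 \<le> i" "Suc i \<le> N" "lam i \<le> lam (Suc i)"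
  shows "blt N (mx i mu) (sw i lam)"
proof -
  have sw: "mx i lam = sw i lam" using assms(4) by (auto simp: mx_def sw_def)
  have "ble N (mx i mu) (sw i lam)"
    using ble_mx[OF tranclp_into_rtranclp[OF assms(1)] assms(2,3)] sw by simp
  moreover have "mx i mu \<noteq> sw i lam"
  proof
    assume *: "mx i mu = sw i lam"
    have le: "ble N lam (sw i lam)"
    proof (cases "lam i = lam (Suc i)")
      case True
      then have "sw i lam = lam" by (auto simp: sw_def)
      then show ?thesis by simp
    qed (use low_sw_self[OF assms(2,3)] assms(4) in auto)
    have "mu = sw i lam \<or> mu = lam" using * unfolding mx_def by (metis sw_simps(3))
    with le assms(1) show False by (auto dest!: ble_qnorm blt_qnorm)
  qed
  ultimately show ?thesis by (simp add: ble_blt_iff)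
qed

definition rot :: "nat \<Rightarrow> weight \<Rightarrow> weight" where
  "rot N l = (\<lambda>k. if 1 \<le> k \<and> k < N then l (Suc k) else if k = N then l 1 + 1 else l k)"

text \<open>If the pair contains position 1, its difference \<open>d\<close> becomes
  \<open>- d - 1\<close>, and \<open>2 d + 1\<close> just changes sign: the shift by one half is the
  one that makes this work. Other pairs are only renumbered.\<close>

lemma low_rot:
  assumes "low N mu lam"
  shows "low N (rot N mu) (rot N lam)"
proof -
  from assms obtain p q where pq: "1 \<le> p" "p < q" "q \<le> N" "\<And>k. k \<noteq> p \<Longrightarrow> k \<noteq> q \<Longrightarrow> mu k = lam k"
    "mu p + mu q = lam p + lam q" "\<bar>2 * (mu p - mu q) + 1\<bar> < \<bar>2 * (lam p - lam q) + 1\<bar>"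
    by (rule lowE) blast
  show ?thesis
  proof (cases "p = 1")
    case True
    obtain b where b: "q = Suc b" "1 \<le> b" "b < N" using pq(1-3) by (cases q) auto
    have r: "rot N l b = l q" "rot N l N = l 1 + 1" for l using b by (auto simp: rot_def)
    show ?thesis
    proof (rule lowI[of b N])
      fix k assume k: "k \<noteq> b" "k \<noteq> N"
      then have "Suc k \<noteq> q" "1 \<le> k \<Longrightarrow> Suc k \<noteq> p" "k = 0 \<or> k > N \<Longrightarrow> k \<noteq> p \<and> k \<noteq> q"
        using b pq(1-3) True by auto
      then show "rot N mu k = rot N lam k"
        using k pq(4)[of "Suc k"] pq(4)[of k] unfolding rot_def by (cases "1 \<le> k \<and> k < N") auto
    next
      show "rot N mu b + rot N mu N = rot N lam b + rot N lam N"
        using pq(5) True unfolding r by simp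
      show "\<bar>2 * (rot N mu b - rot N mu N) + 1\<bar> < \<bar>2 * (rot N lam b - rot N lam N) + 1\<bar>"
        using pq(6) unfolding True r abs_if by (auto split: if_splits)
    qed (use b in auto)
  next
    case False
    obtain a where a: "p = Suc a" "1 \<le> a" using pq(1) False by (cases p) auto
    obtain b where b: "q = Suc b" "a < b" "b < N" using pq(2,3) a by (cases q) auto
    have r: "rot N l a = l p" "rot N l b = l q" for l using a b by (auto simp: rot_def)
    show ?thesis
    proof (rule lowI[of a b])
      fix k assume k: "k \<noteq> a" "k \<noteq> b"
      then have "Suc k \<noteq> q" "Suc k \<noteq> p" "1 \<noteq> p" "1 \<noteq> q" "k = 0 \<or> k > N \<Longrightarrow> k \<noteq> p \<and> k \<noteq> q"
        using a b pq(1-3) False by auto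
      then show "rot N mu k = rot N lam k"
        using pq(4)[of "Suc k"] pq(4)[of k] pq(4)[of 1] unfolding rot_def by auto
    qed (use a b pq(5,6) r in auto)
  qed
qed

lemma blt_rot: "blt N mu lam \<Longrightarrow> blt N (rot N mu) (rot N lam)"
  by (induction rule: tranclp_induct) (auto intro: low_rot tranclp.trancl_into_trancl)

lemma low_wts: "low N mu lam \<Longrightarrow> mu \<in> wts N \<longleftrightarrow> lam \<in> wts N"
proof -
  assume "low N mu lam"
  then obtain i j where ij: "1 \<le> i" "i < j" "j \<le> N" "\<And>k. k \<noteq> i \<Longrightarrow> k \<noteq> j \<Longrightarrow> mu k = lam k"
    by (rule lowE) blast
  then have "mu k = lam k" if "k \<notin> {1..N}" for k using that by (metis atLeastAtMost_iff le_trans less_imp_le)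
  then show ?thesis by (simp add: wts_def)
qed

lemma ble_wts: "ble N mu lam \<Longrightarrow> mu \<in> wts N \<longleftrightarrow> lam \<in> wts N"
  by (induction rule: rtranclp_induct) (auto dest: low_wts)

section \<open>Partial sums and the comparison with \<open>prec\<close>\<close>

definition psum :: "weight \<Rightarrow> nat \<Rightarrow> int" where
  "psum l p = (\<Sum>k\<in>{1..p}. l k)"

lemma psum_Suc: "psum l (Suc p) = psum l p + l (Suc p)"
  by (simp add: psum_def)

text \<open>The coefficient of the \<open>p\<close>-th simple root in \<open>b - a\<close> is the
  difference of the \<open>p\<close>-th partial sums.\<close>

lemma dom_leI:
  assumes "a \<in> wts N" "b \<in> wts N" "\<And>p. p < N \<Longrightarrow> psum a p \<le> psum b p" "psum a N = psum b N"
  shows "dom_le N a b"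
  unfolding dom_le_def
proof (intro exI allI)
  fix k
  let ?c = "\<lambda>p. nat (psum b p - psum a p)"
  have c: "int (?c p) = psum b p - psum a p" if "p \<le> N" for p
    using that assms(3)[of p] assms(4) by (cases "p = N") auto
  have "(\<Sum>i\<in>{1..<N}. int (?c i) * sroot i k)
      = (\<Sum>i\<in>{1..<N}. if i = k then int (?c k) else 0) - (\<Sum>i\<in>{1..<N}. if i = k - 1 then (if k = 0 then 0 else int (?c (k - 1))) else 0)"
    unfolding sum_subtractf[symmetric] sroot_def by (intro sum.cong) auto
  also have "\<dots> = b k - a k"
  proof (cases "k \<in> {1..N}")
    case True
    then obtain j where j: "k = Suc j" by (cases k) auto
    have "(\<Sum>i\<in>{1..<N}. if i = k then int (?c k) else 0) = psum b k - psum a k"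
      using True c[of k] assms(4) by auto
    moreover have "(\<Sum>i\<in>{1..<N}. if i = k - 1 then (if k = 0 then 0 else int (?c (k - 1))) else 0) = psum b j - psum a j"
      using True c[of j] by (cases "j = 0") (auto simp: j psum_def[of _ 0])
    ultimately show ?thesis
      by (simp add: j psum_Suc)
  next
    case False
    then show ?thesis using assms(1,2) by (auto simp: wts_def)
  qed
  finally show "b k - a k = (\<Sum>i\<in>{1..<N}. int (?c i) * sroot i k)" by simp
qed

lemma dom_leD:
  assumes "dom_le N a b"
  shows "psum a p \<le> psum b p" "psum a N = psum b N"
proof -
  from assms obtain c :: "nat \<Rightarrow> nat" where c: "\<And>k. b k - a k = (\<Sum>i\<in>{1..<N}. int (c i) * sroot i k)"
    unfolding dom_le_def by blast
  have s: "(\<Sum>k\<in>{1..p}. sroot i k) = of_bool (i \<le> p) - of_bool (Suc i \<le> p)" if "1 \<le> i" for i p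
  proof -
    have "(\<Sum>k\<in>{1..p}. sroot i k) = (\<Sum>k\<in>{1..p}. of_bool (k = i)) - (\<Sum>k\<in>{1..p}. of_bool (k = Suc i))"
      by (simp add: sroot_def sum_subtractf)
    then show ?thesis using that by (simp add: of_bool_def)
  qed
  have "psum b p - psum a p = (\<Sum>k\<in>{1..p}. \<Sum>i\<in>{1..<N}. int (c i) * sroot i k)" for p
    unfolding psum_def sum_subtractf[symmetric] c ..
  also have "\<dots> p = (\<Sum>i\<in>{1..<N}. int (c i) * (\<Sum>k\<in>{1..p}. sroot i k))" for p
    by (subst sum.swap) (simp only: sum_distrib_left)
  also have "\<dots> p = (\<Sum>i\<in>{1..<N}. int (c i) * (of_bool (i \<le> p) - of_bool (Suc i \<le> p)))" for p
    by (intro sum.cong refl arg_cong2[of _ _ _ _ "(*)"] s) simp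
  finally have d: "psum b p - psum a p = (\<Sum>i\<in>{1..<N}. int (c i) * (of_bool (i \<le> p) - of_bool (Suc i \<le> p)))" for p .
  have "0 \<le> psum b p - psum a p" unfolding d by (intro sum_nonneg) auto
  then show "psum a p \<le> psum b p" by simp
  have "psum b N - psum a N = 0" unfolding d by (intro sum.neutral) auto
  then show "psum a N = psum b N" by simp
qed

lemma wts_eqI:
  assumes "a \<in> wts N" "b \<in> wts N" "\<And>p. p \<le> N \<Longrightarrow> psum a p = psum b p"
  shows "a = b"
proof
  fix k show "a k = b k"
  proof (cases "k \<in> {1..N}")
    case True
    then obtain j where "k = Suc j" by (cases k) auto
    then show ?thesis using True assms(3)[of j] assms(3)[of "Suc j"] by (simp add: psum_Suc)
  qed (use assms in \<open>auto simp: wts_def\<close>)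
qed

lemma dom_le_refl: "dom_le N a a"
  unfolding dom_le_def by (intro exI[of _ "\<lambda>_. 0"]) simp

lemma dom_le_antisym: "a \<in> wts N \<Longrightarrow> b \<in> wts N \<Longrightarrow> dom_le N a b \<Longrightarrow> dom_le N b a \<Longrightarrow> a = b"
  by (rule wts_eqI) (auto dest!: dom_leD(1) intro: antisym)

lemma dom_le_trans: "a \<in> wts N \<Longrightarrow> b \<in> wts N \<Longrightarrow> c \<in> wts N \<Longrightarrow> dom_le N a b \<Longrightarrow> dom_le N b c \<Longrightarrow> dom_le N a c"
  using dom_leD[of N a b] dom_leD[of N b c] by (intro dom_leI) (auto intro: order_trans)

lemma dom_less_trans:
  "a \<in> wts N \<Longrightarrow> b \<in> wts N \<Longrightarrow> c \<in> wts N \<Longrightarrow> dom_less N a b \<Longrightarrow> dom_less N b c \<Longrightarrow> dom_less N a c"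
  unfolding dom_less_def by (metis dom_le_trans dom_le_antisym)

lemma decr_wts: "decr N l \<in> wts N"
  by (simp add: wts_def decr_def)

lemma prec_trans:
  assumes "a \<in> wts N" "b \<in> wts N" "c \<in> wts N" "prec N a b" "prec N b c"
  shows "prec N a c"
  using assms(4,5) dom_less_trans[OF assms(1-3)] dom_less_trans[OF decr_wts decr_wts decr_wts, of N a b c]
  unfolding prec_def by auto

definition srt :: "nat \<Rightarrow> weight \<Rightarrow> int list" where
  "srt N l = rev (sort (map l [1..<Suc N]))"

lemma length_srt [simp]: "length (srt N l) = N"
  by (simp add: srt_def)

lemma decr_srt: "k < N \<Longrightarrow> decr N l (Suc k) = srt N l ! k"
  by (simp add: decr_def srt_def)

lemma mset_srt: "mset (srt N l) = image_mset l (mset_set {1..N})"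
  by (simp add: srt_def flip: mset_upt atLeastLessThanSuc_atLeastAtMost)

lemma sum_srt: "sum_list (map f (srt N l)) = (\<Sum>k\<in>{1..N}. f (l k))" for f :: "int \<Rightarrow> int"
proof -
  have "sum_list (map f (srt N l)) = sum_mset (image_mset f (mset (srt N l)))"
    by (metis mset_map sum_mset_sum_list)
  also have "\<dots> = (\<Sum>k\<in>{1..N}. f (l k))" unfolding mset_srt
    by (simp add: image_mset.compositionality comp_def sum_unfold_sum_mset)
  finally show ?thesis .
qed

lemma srt_antimono: "i \<le> j \<Longrightarrow> j < N \<Longrightarrow> srt N l ! j \<le> srt N l ! i"
  unfolding srt_def by (auto intro!: sorted_rev_nth_mono)

lemma psum_decr: "p \<le> N \<Longrightarrow> psum (decr N l) p = sum_list (take p (srt N l))"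
proof (induction p)
  case (Suc p)
  then show ?case by (simp add: psum_Suc decr_srt take_Suc_conv_app_nth)
qed (simp add: psum_def)

lemma psum_decr_total: "psum (decr N l) N = (\<Sum>k\<in>{1..N}. l k)"
  using sum_srt[of "\<lambda>x. x" N l] by (simp add: psum_decr)

lemma sum_list_take_drop:
  "sum_list (map f (take p xs)) + sum_list (map f (drop p xs)) = sum_list (map f xs)"
  by (simp flip: sum_list_append map_append)

text \<open>The sum of the \<open>p\<close> largest entries is the minimum over \<open>t\<close> of
  \<open>p t\<close> plus the sum of all \<open>max 0 (x - t)\<close>. This replaces sorted partial
  sums by sums of a convex function over unsorted entries; \<open>psum_decr_eq\<close> says that the
  last of the \<open>p\<close> largest entries attains the minimum.\<close>

lemma psum_decr_le:
  assumes "p \<le> N"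
  shows "psum (decr N l) p \<le> int p * t + (\<Sum>k\<in>{1..N}. max 0 (l k - t))"
proof -
  have "sum_list (take p (srt N l)) \<le> (\<Sum>x\<leftarrow>take p (srt N l). t + max 0 (x - t))"
    using sum_list_mono[of "take p (srt N l)" "\<lambda>x. x" "\<lambda>x. t + max 0 (x - t)"] by simp
  also have "\<dots> = int p * t + (\<Sum>x\<leftarrow>take p (srt N l). max 0 (x - t))"
    using assms by (simp add: sum_list_addf sum_list_triv)
  also have "(\<Sum>x\<leftarrow>take p (srt N l). max 0 (x - t)) \<le> (\<Sum>x\<leftarrow>take p (srt N l). max 0 (x - t)) + (\<Sum>x\<leftarrow>drop p (srt N l). max 0 (x - t))"
    by (auto intro!: sum_list_nonneg)
  also have "\<dots> = (\<Sum>x\<leftarrow>srt N l. max 0 (x - t))"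
    by (rule sum_list_take_drop)
  finally show ?thesis using assms by (simp add: psum_decr sum_srt)
qed

lemma psum_decr_eq:
  assumes "p < N"
  shows "psum (decr N l) (Suc p) = int (Suc p) * (srt N l ! p) + (\<Sum>k\<in>{1..N}. max 0 (l k - srt N l ! p))"
proof -
  let ?x = "srt N l" and ?t = "srt N l ! p"
  have 1: "x \<ge> ?t" if "x \<in> set (take (Suc p) ?x)" for x
    using that assms by (auto simp: in_set_conv_nth intro!: srt_antimono)
  have 2: "x \<le> ?t" if "x \<in> set (drop (Suc p) ?x)" for x
    using that assms by (auto simp: in_set_conv_nth intro!: srt_antimono)
  have "(\<Sum>k\<in>{1..N}. max 0 (l k - ?t)) = (\<Sum>x\<leftarrow>take (Suc p) ?x. max 0 (x - ?t)) + (\<Sum>x\<leftarrow>drop (Suc p) ?x. max 0 (x - ?t))"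
    unfolding sum_list_take_drop by (rule sum_srt[symmetric])
  also have "(\<Sum>x\<leftarrow>drop (Suc p) ?x. max 0 (x - ?t)) = 0"
  proof -
    have *: "map (\<lambda>x. max 0 (x - ?t)) (drop (Suc p) ?x) = map (\<lambda>_. 0) (drop (Suc p) ?x)"
      by (rule map_cong) (auto simp: max_def dest!: 2)
    show ?thesis unfolding * by simp
  qed
  also have "(\<Sum>x\<leftarrow>take (Suc p) ?x. max 0 (x - ?t)) = (\<Sum>x\<leftarrow>take (Suc p) ?x. x - ?t)"
    using 1 by (intro arg_cong[of _ _ sum_list] map_cong) auto
  also have "\<dots> = sum_list (take (Suc p) ?x) - int (Suc p) * ?t"
    using assms by (simp add: sum_list_subtractf sum_list_triv)
  finally show ?thesis using assms by (simp add: psum_decr)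
qed

text \<open>A step of \<open>low\<close> either transposes two entries, which stays in the orbit and
  lowers the weight in dominance order, or strictly contracts them, which lowers the decreasing
  rearrangement by majorization.\<close>

lemma low_prec:
  assumes "low N mu lam" "lam \<in> wts N"
  shows "prec N mu lam"
proof -
  have mu: "mu \<in> wts N" using low_wts[OF assms(1)] assms(2) by simp
  from assms(1) obtain i j where ij: "1 \<le> i" "i < j" "j \<le> N" "\<And>k. k \<noteq> i \<Longrightarrow> k \<noteq> j \<Longrightarrow> mu k = lam k"
    "mu i + mu j = lam i + lam j" "\<bar>2 * (mu i - mu j) + 1\<bar> < \<bar>2 * (lam i - lam j) + 1\<bar>"
    by (rule lowE) blast
  have split: "(\<Sum>k\<in>{1..N}. f k) = f i + f j + (\<Sum>k\<in>{1..N} - {i, j}. f k)" for f :: "nat \<Rightarrow> int"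
  proof -
    have "{1..N} - {i} - {j} = {1..N} - {i, j}" by auto
    then show ?thesis
      using ij sum.remove[of "{1..N}" i f] sum.remove[of "{1..N} - {i}" j f] by simp
  qed
  have rest: "(\<Sum>k\<in>{1..N} - {i, j}. f (mu k)) = (\<Sum>k\<in>{1..N} - {i, j}. f (lam k))" for f :: "int \<Rightarrow> int"
    using ij(4) by (intro sum.cong) auto
  show ?thesis
  proof (cases "mu i = lam j \<and> mu j = lam i")
    case True
    have "mu = lam \<circ> transpose i j"
    proof
      fix k show "mu k = (lam \<circ> transpose i j) k"
        using True ij(4)[of k] by (cases "k = i"; cases "k = j") (auto simp: transpose_def)
    qed
    then have "image_mset mu (mset_set {1..N}) = image_mset lam (image_mset (transpose i j) (mset_set {1..N}))"
      by (simp add: image_mset.compositionality)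
    also have "image_mset (transpose i j) (mset_set {1..N}) = mset_set {1..N}"
      using ij by (subst image_mset_mset_set) (auto simp: transpose_image_eq intro: inj_on_subset[OF inj_transpose])
    finally have "mset (map mu [1..<Suc N]) = mset (map lam [1..<Suc N])"
      by (simp flip: mset_upt atLeastLessThanSuc_atLeastAtMost)
    then have "decr N mu = decr N lam"
      unfolding decr_def by (metis sorted_list_of_multiset_mset)
    moreover have "dom_less N mu lam"
      unfolding dom_less_def
    proof
      have d: "lam i > lam j" using ij(6) True by (auto simp: abs_if split: if_splits)
      have *: "psum lam p - psum mu p = (lam i - mu i) * (of_bool (i \<le> p) - of_bool (j \<le> p))" for p
      proof -
        have "psum lam p - psum mu p = (\<Sum>k\<in>{1..p}. (lam i - mu i) * of_bool (k = i) - (lam i - mu i) * of_bool (k = j))"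
          unfolding psum_def sum_subtractf[symmetric] using ij(2,4,5) by (intro sum.cong) auto
        also have "\<dots> = (lam i - mu i) * of_bool (i \<le> p) - (lam i - mu i) * of_bool (j \<le> p)"
          unfolding sum_subtractf sum_distrib_left[symmetric] using ij(1,2) by (simp add: of_bool_def)
        finally show ?thesis by (simp add: algebra_simps)
      qed
      show "dom_le N mu lam"
      proof (rule dom_leI[OF mu assms(2)])
        have "0 \<le> lam i - mu i" using d conjunct1[OF True] by linarith
        moreover have "(0::int) \<le> of_bool (i \<le> p) - of_bool (j \<le> p)" for p using ij(2) by auto
        ultimately have "0 \<le> (lam i - mu i) * (of_bool (i \<le> p) - of_bool (j \<le> p))" for p
          by (rule mult_nonneg_nonneg)
        then show "psum mu p \<le> psum lam p" for p
          unfolding *[symmetric] by (simp only: diff_ge_0_iff_ge)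
        show "psum mu N = psum lam N" using *[of N] ij(2,3) by (simp add: of_bool_def)
      qed
      show "mu \<noteq> lam"
      proof
        assume "mu = lam"
        then have "mu i = lam i" by simp
        then show False using d conjunct1[OF True] by linarith
      qed
    qed
    ultimately show ?thesis by (simp add: prec_def)
  next
    case False
    have lt: "\<bar>mu i - mu j\<bar> < \<bar>lam i - lam j\<bar>"
      using ij(5,6) False by (auto simp: abs_if split: if_splits)
    have "dom_less N (decr N mu) (decr N lam)"
      unfolding dom_less_def
    proof
      show "dom_le N (decr N mu) (decr N lam)"
      proof (rule dom_leI[OF decr_wts decr_wts])
        fix p assume p: "p < N"
        show "psum (decr N mu) p \<le> psum (decr N lam) p"
        proof (cases p)
          case (Suc r)
          let ?t = "srt N lam ! r"
          have "psum (decr N mu) p \<le> int p * ?t + (\<Sum>k\<in>{1..N}. max 0 (mu k - ?t))"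
            using p by (intro psum_decr_le) simp
          \<comment> \<open>Convexity of \<open>max 0 (x - t)\<close>: the pair of \<open>mu\<close>
            has the same sum as that of \<open>lam\<close> and a smaller gap.\<close>
          also have "(\<Sum>k\<in>{1..N}. max 0 (mu k - ?t)) \<le> (\<Sum>k\<in>{1..N}. max 0 (lam k - ?t))"
            unfolding split rest[of "\<lambda>x. max 0 (x - ?t)"] using lt ij(5) by (auto simp: max_def abs_if split: if_splits)
          finally show ?thesis using psum_decr_eq[of r N lam] Suc p by simp
        qed (simp add: psum_def)
      next
        show "psum (decr N mu) N = psum (decr N lam) N"
          unfolding psum_decr_total split rest[of "\<lambda>x. x"] using ij(5) by simp
      qed
      show "decr N mu \<noteq> decr N lam"
      proof
        assume e: "decr N mu = decr N lam"
        \<comment> \<open>Equal rearrangements would have equal sums of squares, but contracting a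
          pair lowers that sum.\<close>
        have "srt N mu = srt N lam"
          by (rule nth_equalityI) (use e in \<open>auto simp flip: decr_srt\<close>)
        then have "(\<Sum>k\<in>{1..N}. (mu k)\<^sup>2) = (\<Sum>k\<in>{1..N}. (lam k)\<^sup>2)"
          unfolding sum_srt[of "\<lambda>x. x\<^sup>2", symmetric] by simp
        then have "(mu i)\<^sup>2 + (mu j)\<^sup>2 = (lam i)\<^sup>2 + (lam j)\<^sup>2"
          unfolding split rest[of "\<lambda>x. x\<^sup>2"] by simp
        moreover have "2 * (x\<^sup>2 + y\<^sup>2) = (x + y)\<^sup>2 + (x - y)\<^sup>2" for x y :: int
          by (simp add: power2_eq_square algebra_simps)
        ultimately have "(mu i - mu j)\<^sup>2 = (lam i - lam j)\<^sup>2"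
          using ij(5) by (metis add_left_cancel)
        then show False using square_less[OF lt] by simp
      qed
    qed
    then show ?thesis by (simp add: prec_def)
  qed
qed

lemma blt_prec: "blt N mu lam \<Longrightarrow> lam \<in> wts N \<Longrightarrow> prec N mu lam"
proof (induction rule: converse_tranclp_induct)
  case (step y z)
  then have "z \<in> wts N" using ble_wts[OF tranclp_into_rtranclp] by blast
  with step show ?case using prec_trans low_prec low_wts by blast
qed (rule low_prec)

lemma prec_irrefl: "\<not> prec N lam lam"
  by (simp add: prec_def dom_less_def)

text \<open>The first partial sum bounds the largest entry of \<open>mu\<close> from above; the
  total minus the last proper partial sum bounds its smallest entry from below.\<close>

lemma finite_prec:
  assumes "N \<ge> 1"
  shows "finite {mu \<in> wts N. prec N mu lam}"
proof -
  define S where "S = {decr N lam N .. decr N lam 1}"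
  have "mu k \<in> S" if mu: "prec N mu lam" and k: "k \<in> {1..N}" for mu k
  proof -
    have d: "dom_le N (decr N mu) (decr N lam)"
      using mu dom_le_refl unfolding prec_def dom_less_def by auto
    obtain M where M: "N = Suc M" using assms by (cases N) auto
    have "decr N mu 1 \<le> decr N lam 1"
      using dom_leD(1)[OF d, of 1] by (simp add: psum_def)
    moreover have "decr N lam N \<le> decr N mu N"
      using dom_leD(1)[OF d, of M] dom_leD(2)[OF d] by (simp add: M psum_Suc)
    moreover have "mu k \<in> set (srt N mu)"
      using k by (auto simp: srt_def simp del: upt_Suc)
    then obtain r where "r < N" "mu k = srt N mu ! r" by (metis in_set_conv_nth length_srt)
    then have "decr N mu N \<le> mu k" "mu k \<le> decr N mu 1"
      using srt_antimono[of r M N mu] srt_antimono[of 0 r N mu] decr_srt[of M N mu] decr_srt[of 0 N mu]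
      by (auto simp: M)
    ultimately show ?thesis by (simp add: S_def)
  qed
  then have "{mu \<in> wts N. prec N mu lam} \<subseteq> {f. \<forall>x. (x \<in> {1..N} \<longrightarrow> f x \<in> S) \<and> (x \<notin> {1..N} \<longrightarrow> f x = 0)}"
    by (auto simp: wts_def)
  then show ?thesis
    by (rule finite_subset) (intro finite_set_of_finite_funs, auto simp: S_def)
qed

section \<open>Christoffel words and commuting operators\<close>

lemma comps_Nil [simp]: "comps [] = id"
  and comps_Cons [simp]: "comps (f # fs) = f \<circ> comps fs"
  by (simp_all add: comps_def)

lemma comps_append [simp]: "comps (fs @ gs) = comps fs \<circ> comps gs"
  by (induction fs) (simp_all add: comp_assoc)

text \<open>Elliptic braid relations on two strands. They are preserved by both Farey moves
  \<open>(x, y) \<mapsto> (x, yx)\<close> and \<open>(x, y) \<mapsto> (yx, y)\<close>, hence hold along the Euclidean algorithm.\<close>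

definition good :: "('a \<Rightarrow> 'a) \<Rightarrow> ('a \<Rightarrow> 'a) \<Rightarrow> ('a \<Rightarrow> 'a) \<Rightarrow> bool" where
  "good t x y \<longleftrightarrow> (\<forall>z. x (t (x (t z))) = t (x (t (x z)))) \<and> (\<forall>z. y (t (y (t z))) = t (y (t (y z))))
     \<and> (\<forall>z. t (y (t (x (t z)))) = x (t (y z)))"

lemma good_step:
  assumes "good t x y"
  shows "good t x (y \<circ> x)" "good t (y \<circ> x) y"
proof -
  have g1: "x (t (x (t z))) = t (x (t (x z)))" and g2: "y (t (y (t z))) = t (y (t (y z)))"
    and g3: "t (y (t (x (t z)))) = x (t (y z))" for z
    using assms by (auto simp: good_def)
  have w: "y (x (t (y (x (t z))))) = t (y (x (t (y (x z)))))" for z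
  proof -
    have "y (x (t (y (x (t z))))) = y (t (y (t (x (t (x (t z)))))))" by (simp only: g3[of "x (t z)"])
    also have "\<dots> = t (y (t (y (x (t (x (t z)))))))" by (simp only: g2[of "x (t (x (t z)))"])
    also have "\<dots> = t (y (t (y (t (x (t (x z)))))))" by (simp only: g1[of z])
    also have "\<dots> = t (y (x (t (y (x z)))))" by (simp only: g3[of "x z"])
    finally show ?thesis .
  qed
  have "t (y (x (t (x (t z))))) = x (t (y (x z)))" for z
    by (simp only: g1[of z] g3[of "x z"])
  moreover have "t (y (t (y (x (t z))))) = y (x (t (y z)))" for z
    by (simp only: g2[of "x (t z)", symmetric] g3[of z])
  ultimately show "good t x (y \<circ> x)" "good t (y \<circ> x) y"
    using g1 g2 w by (auto simp: good_def)
qed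

text \<open>A word in two letters is read off the exchange of two intervals: at a state \<open>s < m'\<close> the
  letter is \<open>y\<close> and the next state \<open>s + m\<close>, otherwise it is \<open>x\<close> and the next state \<open>s - m'\<close>;
  \<open>a\<close> and \<open>b\<close> count the letters \<open>x\<close> and \<open>y\<close>.\<close>

inductive Run :: "nat \<Rightarrow> nat \<Rightarrow> ('a \<Rightarrow> 'a) \<Rightarrow> ('a \<Rightarrow> 'a) \<Rightarrow> nat \<Rightarrow> nat \<Rightarrow> nat \<Rightarrow> ('a \<Rightarrow> 'a) \<Rightarrow> nat \<Rightarrow> bool"
  for m m' x y where
  Nil: "Run m m' x y s 0 0 id s"
| Y: "s < m' \<Longrightarrow> Run m m' x y (s + m) a b f s' \<Longrightarrow> Run m m' x y s a (Suc b) (y \<circ> f) s'"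
| X: "m' \<le> s \<Longrightarrow> Run m m' x y (s - m') a b f s' \<Longrightarrow> Run m m' x y s (Suc a) b (x \<circ> f) s'"

text \<open>Replacing \<open>y\<close> by \<open>yx\<close>: after a letter \<open>y\<close> the
  state is at least \<open>m \<ge> m'\<close>, so the letter \<open>x\<close> is forced and the two
  steps together add \<open>m - m'\<close>.\<close>

lemma Run_lift_X:
  assumes "Run (m - m') m' x (y \<circ> x) s a b f s'" "m' \<le> m"
  shows "Run m m' x y s (a + b) b f s'"
  using assms
proof (induction rule: Run.induct)
  case (Y s a b f s')
  have "Run m m' x y (s + m - m') (a + b) b f s'" using Y by simp
  then have "Run m m' x y (s + m) (Suc (a + b)) b (x \<circ> f) s'"
    using Y.prems by (intro Run.X) auto
  then have "Run m m' x y s (Suc (a + b)) (Suc b) (y \<circ> (x \<circ> f)) s'"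
    using Y.hyps by (intro Run.Y) auto
  then show ?case by (simp add: comp_def)
next
  case (X s a b f s')
  then show ?case using Run.X[of m' s m x y "a + b" b f s'] by (simp add: comp_def)
qed (use Run.Nil in simp)

text \<open>Replacing \<open>x\<close> by \<open>yx\<close>: a state in \<open>[m' - m, m')\<close>
  takes a step \<open>y\<close> and then a forced step \<open>x\<close>, which together subtract
  \<open>m' - m\<close>. The bound \<open>s < m'\<close> persists along the run.\<close>

lemma Run_lift_Y:
  assumes "Run m (m' - m) (y \<circ> x) y s a b f s'" "m \<le> m'" "s < m'"
  shows "Run m m' x y s a (a + b) f s'"
  using assms
proof (induction rule: Run.induct)
  case (Y s a b f s')
  then show ?case using Run.Y[of s m' m x y a "a + b" f s'] by (simp add: comp_def)
next
  case (X s a b f s')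
  have "Run m m' x y (s + m - m') a (a + b) f s'" using X by (auto simp: diff_diff_right)
  then have "Run m m' x y (s + m) (Suc a) (a + b) (x \<circ> f) s'"
    using X by (intro Run.X) auto
  then have "Run m m' x y s (Suc a) (Suc (a + b)) (y \<circ> (x \<circ> f)) s'"
    using X.prems by (intro Run.Y) auto
  then show ?case by (simp add: comp_def)
qed (use Run.Nil in simp)

text \<open>Word and relation are produced together: the hypothesis for the smaller pair is applied
  to the replaced letters, which satisfy \<open>good\<close> again.\<close>

lemma Run_good:
  assumes "coprime m m'"
  shows "\<exists>f. Run m m' x y 0 m m' f 0 \<and> (\<forall>t. good t x y \<longrightarrow> (\<forall>z. f (t (f (t z))) = t (f (t (f z)))))"
  using assms
proof (induction "m + m'" arbitrary: m m' x y rule: less_induct)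
  case less
  consider "m = 0" | "m' = 0" | "0 < m'" "m' \<le> m" | "0 < m" "m < m'" by linarith
  then show ?case
  proof cases
    case 1
    then have m: "m' = 1" using less.prems by simp
    have "Run m m' x y 0 0 (Suc 0) (y \<circ> id) 0"
      using Run.Nil[of m m' x y 0] by (intro Run.Y) (auto simp: 1 m)
    then show ?thesis by (intro exI[of _ y]) (auto simp: good_def 1 m)
  next
    case 2
    then have m: "m = 1" using less.prems by simp
    have "Run m m' x y 0 (Suc 0) 0 (x \<circ> id) 0"
      using Run.Nil[of m m' x y 0] by (intro Run.X) (auto simp: 2 m)
    then show ?thesis by (intro exI[of _ x]) (auto simp: good_def 2 m)
  next
    case 3
    have "coprime (m - m') m'" using less.prems(1) 3
      by (metis coprime_iff_gcd_eq_1 gcd_diff1_nat)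
    from less.hyps[OF _ this, of x "y \<circ> x"] 3
    obtain f where "Run (m - m') m' x (y \<circ> x) 0 (m - m') m' f 0"
      "\<forall>t. good t x (y \<circ> x) \<longrightarrow> (\<forall>z. f (t (f (t z))) = t (f (t (f z))))"
      by auto
    with Run_lift_X[of m m' x y 0 "m - m'" m' f 0] 3 good_step(1) show ?thesis by fastforce
  next
    case 4
    have "coprime m (m' - m)" using less.prems(1) 4
      by (metis coprime_commute coprime_iff_gcd_eq_1 gcd_diff1_nat less_imp_le)
    from less.hyps[OF _ this, of "y \<circ> x" y] 4
    obtain f where "Run m (m' - m) (y \<circ> x) y 0 m (m' - m) f 0"
      "\<forall>t. good t (y \<circ> x) y \<longrightarrow> (\<forall>z. f (t (f (t z))) = t (f (t (f z))))"
      by auto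
    with Run_lift_Y[of m m' y x 0 m "m' - m" f 0] 4 good_step(2) show ?thesis by fastforce
  qed
qed

text \<open>After \<open>j\<close> letters the state is \<open>j m mod (m + m')\<close>. Adding
  \<open>m\<close> wraps around exactly when the state is at least \<open>m'\<close>, and this is
  when the floor of \<open>j m / (m + m')\<close> jumps, so the letters obey the floor rule defining
  \<open>A_1\<close>.\<close>

lemma Run_word:
  fixes m m' :: nat and x y
  defines "M \<equiv> int (m + m')"
  defines "W \<equiv> \<lambda>i. if (i * int m) div M = ((i - 1) * int m) div M then y else x"
  assumes "Run m m' x y s a b f s'" "m + m' > 0" "int s = (int j * int m) mod M"
  shows "f = comps (map W [int j + 1..int j + int a + int b])"
  using assms(3,5)
proof (induction arbitrary: j rule: Run.induct)
  case (Y s a b f s')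
  define k where "k = (int j * int m) div M"
  have M: "M > 0" using assms(4) unfolding M_def by linarith
  have e: "int j * int m = M * k + int s" using Y.prems by (simp add: k_def)
  have e': "(int (Suc j)) * int m = (int s + int m) + M * k" using e by (simp add: algebra_simps)
  have sm: "0 \<le> int s + int m" "int s + int m < M" using Y.hyps(1) by (auto simp: M_def)
  have "int (Suc j) * int m div M = k" "int (Suc j) * int m mod M = int s + int m"
    unfolding e' using sm M by (simp_all add: div_pos_pos_trivial mod_pos_pos_trivial)
  then have "W (int j + 1) = y" "int (s + m) = int (Suc j) * int m mod M"
    by (auto simp: W_def k_def algebra_simps)
  with Y.IH[of "Suc j"] show ?case by (subst upto_rec1) (auto simp: algebra_simps)
next
  case (X s a b f s')
  define k where "k = (int j * int m) div M"
  have M: "M > 0" using assms(4) unfolding M_def by linarith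
  have s: "int s < M" using X.prems M by simp
  have e: "int j * int m = M * k + int s" using X.prems by (simp add: k_def)
  have e': "(int (Suc j)) * int m = (int s - int m') + M * (k + 1)" using e by (simp add: algebra_simps M_def)
  have sm: "0 \<le> int s - int m'" "int s - int m' < M" using X.hyps(1) s by (auto simp: M_def)
  have "int (Suc j) * int m div M = k + 1" "int (Suc j) * int m mod M = int s - int m'"
    unfolding e' using sm M by (simp_all add: div_pos_pos_trivial mod_pos_pos_trivial)
  then have "W (int j + 1) = x" "int (s - m') = int (Suc j) * int m mod M"
    using X.hyps(1) by (auto simp: W_def k_def algebra_simps)
  with X.IH[of "Suc j"] show ?case by (subst upto_rec1) (auto simp: algebra_simps)
qed simp

lemma Run_preserves:
  assumes "Run m m' x y s a b f s'" "P id" "\<And>g. P g \<Longrightarrow> P (x \<circ> g)" "\<And>g. P g \<Longrightarrow> P (y \<circ> g)"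
  shows "P f"
  using assms by (induction rule: Run.induct) auto

text \<open>Braid relations of affine type, with \<open>f\<close> at the special node;
  \<open>f_f\<close> is the four-term relation. The \<open>Jm i\<close> are the Jucys-Murphy
  elements built on \<open>f\<close>, and their commutation uses nothing else about
  \<open>f\<close>.\<close>

locale braided =
  fixes N :: nat and T :: "nat \<Rightarrow> 'a \<Rightarrow> 'a" and f :: "'a \<Rightarrow> 'a"
  assumes braid: "1 \<le> i \<Longrightarrow> Suc i < N \<Longrightarrow> T i (T (Suc i) (T i z)) = T (Suc i) (T i (T (Suc i) z))"
    and far: "1 \<le> i \<Longrightarrow> Suc i < j \<Longrightarrow> T i (T j z) = T j (T i z)"
    and f_T: "2 \<le> i \<Longrightarrow> i < N \<Longrightarrow> f (T i z) = T i (f z)"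
    and f_f: "N \<ge> 2 \<Longrightarrow> f (T 1 (f (T 1 z))) = T 1 (f (T 1 (f z)))"
begin

definition Jm :: "nat \<Rightarrow> 'a \<Rightarrow> 'a" where
  "Jm i = comps (map T (rev [1..<i])) \<circ> f \<circ> comps (map T [1..<i])"

lemma Jm_1: "Jm 1 = f"
  by (simp add: Jm_def)

lemma Jm_Suc: "i \<ge> 1 \<Longrightarrow> Jm (Suc i) z = T i (Jm i (T i z))"
  by (simp add: Jm_def)

lemma f_Jm: "2 \<le> j \<Longrightarrow> j \<le> N \<Longrightarrow> f (Jm j z) = Jm j (f z)"
proof (induction j arbitrary: z rule: dec_induct)
  case base
  then show ?case using Jm_Suc[of 1] Jm_1 f_f by (simp add: numeral_2_eq_2)
next
  case (step j)
  then show ?case by (simp add: Jm_Suc f_T)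
qed

lemma T_Jm_above: "1 \<le> k \<Longrightarrow> k < l \<Longrightarrow> l < N \<Longrightarrow> Jm k (T l z) = T l (Jm k z)"
proof (induction k arbitrary: z rule: dec_induct)
  case base
  then show ?case using f_T[of l] by (simp add: Jm_1[unfolded One_nat_def])
next
  case (step k)
  then show ?case using far[of k l] by (simp add: Jm_Suc)
qed

text \<open>The only case with content is \<open>i = k + 1\<close>: two braid moves carry
  \<open>T_k\<close> through \<open>T_{k+1} T_k J_k T_k T_{k+1}\<close>, passing \<open>J_k\<close>
  in the form \<open>T_{k+1}\<close>.\<close>

lemma T_Jm_below: "1 \<le> k \<Longrightarrow> Suc k < j \<Longrightarrow> j \<le> N \<Longrightarrow> T k (Jm j z) = Jm j (T k z)"
proof (induction j arbitrary: z)
  case (Suc i)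
  show ?case
  proof (cases "Suc k < i")
    case True
    then show ?thesis using Suc far[of k i] by (simp add: Jm_Suc)
  next
    case False
    then have i: "i = Suc k" using Suc.prems by simp
    have Jm: "Jm (Suc i) z = T (Suc k) (T k (Jm k (T k (T (Suc k) z))))" for z
      using Suc.prems by (simp add: i Jm_Suc)
    have "T k (Jm (Suc i) z) = T (Suc k) (T k (T (Suc k) (Jm k (T k (T (Suc k) z)))))"
      unfolding Jm using Suc.prems i by (simp add: braid)
    also have "\<dots> = T (Suc k) (T k (Jm k (T (Suc k) (T k (T (Suc k) z)))))"
      using Suc.prems i by (simp add: T_Jm_above)
    also have "\<dots> = Jm (Suc i) (T k z)"
      unfolding Jm using Suc.prems i by (simp add: braid)
    finally show ?thesis .
  qed
qed simp

lemma Jm_commute_less: "1 \<le> i \<Longrightarrow> i < j \<Longrightarrow> j \<le> N \<Longrightarrow> Jm i (Jm j z) = Jm j (Jm i z)"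
proof (induction i arbitrary: z rule: dec_induct)
  case base
  then show ?case using f_Jm[of j z] by (simp add: Jm_1[unfolded One_nat_def])
next
  case (step i)
  then show ?case by (simp add: Jm_Suc T_Jm_below)
qed

lemma Jm_commute: "i \<in> {1..N} \<Longrightarrow> j \<in> {1..N} \<Longrightarrow> Jm i (Jm j z) = Jm j (Jm i z)"
  using Jm_commute_less[of i j z] Jm_commute_less[of j i z] by (cases i j rule: linorder_cases) auto

end

section \<open>Automorphisms of the tensor power\<close>

lemma tpow_subspace: "tens.subspace (tpow N)"
  by (rule tens.subspaceI) (auto simp: tpow_def in_keys_iff lookup_add dest!: subsetD[OF keys_add] split: if_splits)

lemma bas_tpow [simp]: "bas l \<in> tpow N \<longleftrightarrow> l \<in> wts N"
  by (simp add: tpow_def bas_def)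

lemma linop_eq_sum:
  assumes "linop f"
  shows "f x = (\<Sum>l\<in>Poly_Mapping.keys x. scale (Poly_Mapping.lookup x l) (f (bas l)))"
proof -
  have "f (lin bas x) = (\<Sum>l\<in>Poly_Mapping.keys x. scale (Poly_Mapping.lookup x l) (f (bas l)))"
    unfolding lin_def by (simp add: linop_sum[OF assms] linop_scale[OF assms])
  then show ?thesis by (simp add: lin_bas_id)
qed

lemma tpow_linop:
  assumes "linop f" "\<And>l. l \<in> wts N \<Longrightarrow> f (bas l) \<in> tpow N" "x \<in> tpow N"
  shows "f x \<in> tpow N"
  unfolding linop_eq_sum[OF assms(1), of x]
  using assms(2,3) by (intro tens.subspace_sum tens.subspace_scale tpow_subspace) (auto simp: tpow_def)

text \<open>Bijective on the whole ambient space and compatible with \<open>tpow N\<close>, so that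
  the total \<open>inv\<close> can replace \<open>opinv\<close>, which inverts on
  \<open>tpow N\<close> only.\<close>

definition Aut :: "nat \<Rightarrow> (tens \<Rightarrow> tens) \<Rightarrow> bool" where
  "Aut N f \<longleftrightarrow> linop f \<and> bij f \<and> (\<forall>x. f x \<in> tpow N \<longleftrightarrow> x \<in> tpow N)"

lemma Aut_linop: "Aut N f \<Longrightarrow> linop f" and Aut_bij: "Aut N f \<Longrightarrow> bij f"
  and Aut_tpow: "Aut N f \<Longrightarrow> f x \<in> tpow N \<longleftrightarrow> x \<in> tpow N"
  by (auto simp: Aut_def)

lemma AutI:
  assumes "linop f" "linop g" "\<And>x. f (g x) = x" "\<And>x. g (f x) = x"
    "\<And>l. l \<in> wts N \<Longrightarrow> f (bas l) \<in> tpow N" "\<And>l. l \<in> wts N \<Longrightarrow> g (bas l) \<in> tpow N"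
  shows "Aut N f" "inv f = g"
proof -
  show "inv f = g" using assms(3,4) by (intro inv_unique_comp) (auto simp: fun_eq_iff)
  have "bij f" using assms(3,4) by (intro o_bij[of g]) (auto simp: fun_eq_iff)
  then show "Aut N f"
    unfolding Aut_def using assms tpow_linop[OF assms(1,5)] tpow_linop[OF assms(2,6)] by metis
qed

lemma Aut_id: "Aut N id"
  by (simp add: Aut_def linop_id)

lemma Aut_comp: "Aut N f \<Longrightarrow> Aut N g \<Longrightarrow> Aut N (f \<circ> g)"
  by (auto simp: Aut_def intro: linop_comp bij_comp)

lemma Aut_comps: "(\<And>f. f \<in> set fs \<Longrightarrow> Aut N f) \<Longrightarrow> Aut N (comps fs)"
  by (induction fs) (auto intro: Aut_id Aut_comp)

lemma linop_inv:
  assumes "linop f" "bij f"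
  shows "linop (inv f)"
  unfolding linop_def
proof (intro conjI allI)
  note s = surj_f_inv_f[OF bij_is_surj[OF assms(2)]]
  note i = inv_f_f[OF bij_is_inj[OF assms(2)]]
  show "inv f (x + y) = inv f x + inv f y" for x y
    by (metis assms(1) i linop_add s)
  show "inv f (scale c x) = scale c (inv f x)" for c x
    by (metis assms(1) i linop_scale s)
qed

lemma Aut_inv_f: "Aut N f \<Longrightarrow> f (inv f x) = x" "Aut N f \<Longrightarrow> inv f (f x) = x"
  by (auto simp: Aut_def bij_is_inj bij_is_surj surj_f_inv_f)

lemma Aut_inv: "Aut N f \<Longrightarrow> Aut N (inv f)"
  unfolding Aut_def by (metis linop_inv bij_imp_bij_inv bij_is_surj surj_f_inv_f)

text \<open>Agreement is asked on \<open>tpow N\<close> only, because an operator built with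
  \<open>opinv\<close>, such as \<open>X1\<close>, is uncontrolled outside.\<close>

lemma opinv_eq:
  assumes "Aut N f" "\<And>x. x \<in> tpow N \<Longrightarrow> f' x = f x" "x \<in> tpow N"
  shows "opinv N f' x = inv f x"
  unfolding opinv_def
proof (rule inv_into_f_eq)
  show "inj_on f' (tpow N)"
    using assms(2) Aut_bij[OF assms(1)] by (metis bij_pointE inj_onI)
  show mem: "inv f x \<in> tpow N" using Aut_tpow[OF Aut_inv[OF assms(1)]] assms(3) by simp
  show "f' (inv f x) = x" using assms(2)[OF mem] Aut_inv_f[OF assms(1)] by simp
qed

lemma funpow_eq:
  assumes "Aut N f" "\<And>x. x \<in> tpow N \<Longrightarrow> f' x = f x" "x \<in> tpow N"
  shows "(f' ^^ k) x = (f ^^ k) x \<and> (f ^^ k) x \<in> tpow N"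
  by (induction k) (use assms in \<open>auto simp: Aut_tpow\<close>)

lemma comps_eq:
  assumes "\<And>i. i \<in> set xs \<Longrightarrow> Aut N (F i)" "\<And>i x. i \<in> set xs \<Longrightarrow> x \<in> tpow N \<Longrightarrow> F' i x = F i x" "x \<in> tpow N"
  shows "comps (map F' xs) x = comps (map F xs) x \<and> comps (map F xs) x \<in> tpow N"
  using assms by (induction xs) (auto simp: Aut_tpow)

definition powz :: "('a \<Rightarrow> 'a) \<Rightarrow> int \<Rightarrow> 'a \<Rightarrow> 'a" where
  "powz f k = (if k \<ge> 0 then f ^^ nat k else inv f ^^ nat (- k))"

lemma oppow_eq:
  assumes "Aut N f" "\<And>x. x \<in> tpow N \<Longrightarrow> f' x = f x" "x \<in> tpow N"
  shows "oppow N f' k x = powz f k x"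
  using funpow_eq[OF assms] funpow_eq[OF Aut_inv[OF assms(1)] opinv_eq[OF assms(1,2)] assms(3)]
  by (simp add: oppow_def powz_def)

lemma Aut_funpow: "Aut N f \<Longrightarrow> Aut N (f ^^ k)"
  by (induction k) (auto intro: Aut_id[unfolded id_def] Aut_id Aut_comp)

lemma Aut_powz: "Aut N f \<Longrightarrow> Aut N (powz f k)"
  by (simp add: powz_def Aut_funpow Aut_inv)

lemma powz_Suc:
  assumes "bij f"
  shows "powz f (k + 1) z = f (powz f k z)"
proof (cases "k \<ge> 0")
  case True
  then have "nat (k + 1) = Suc (nat k)" by simp
  then show ?thesis using True by (simp add: powz_def)
next
  case False
  then obtain j where j: "nat (- k) = Suc j" by (cases "nat (- k)") auto
  then have k: "k = - int (Suc j)" using False by simp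
  have "powz f (k + 1) z = (inv f ^^ j) z" by (cases j) (simp_all add: k powz_def nat_add_distrib)
  moreover have "powz f k z = inv f ((inv f ^^ j) z)" using False by (simp add: powz_def j)
  ultimately show ?thesis using assms by (simp add: bij_is_surj surj_f_inv_f)
qed

lemma inv_commute:
  assumes "bij f" "\<And>z. g (f z) = f (g z)"
  shows "g (inv f z) = inv f (g z)"
  by (metis assms bij_is_inj bij_is_surj inv_f_f surj_f_inv_f)

lemma funpow_commute: "(\<And>z. g (f z) = f (g z)) \<Longrightarrow> g ((f ^^ k) z) = (f ^^ k) (g z)"
  by (induction k) auto

lemma powz_commute:
  assumes "bij f" "\<And>z. g (f z) = f (g z)"
  shows "g (powz f k z) = powz f k (g z)"
  unfolding powz_def using funpow_commute[of g f] funpow_commute[of g "inv f"] assms inv_commute[of f g]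
  by auto

lemma comps_powz_upd:
  assumes "distinct xs" "j \<in> set xs" "\<And>i. i \<in> set xs \<Longrightarrow> bij (F i)"
    "\<And>i z. i \<in> set xs \<Longrightarrow> F j (F i z) = F i (F j z)"
  shows "comps (map (\<lambda>i. powz (F i) ((lam(j := lam j + 1)) i)) xs) z
    = F j (comps (map (\<lambda>i. powz (F i) (lam i)) xs) z)"
  using assms
proof (induction xs)
  case (Cons a xs)
  show ?case
  proof (cases "a = j")
    case True
    with Cons.prems(1) have "map (\<lambda>i. powz (F i) ((lam(j := lam j + 1)) i)) xs = map (\<lambda>i. powz (F i) (lam i)) xs"
      by (intro map_cong) auto
    then show ?thesis using True Cons.prems(3) by (simp add: powz_Suc del: map_eq_conv)
  next
    case False
    then show ?thesis using Cons powz_commute[of "F a" "F j" "lam a"] by simp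
  qed
qed simp

lemma comps_cancel:
  assumes "\<And>i z. i \<in> set xs \<Longrightarrow> F i (G i z) = z"
  shows "comps (map F xs) (comps (map G (rev xs)) z) = z"
  using assms by (induction xs arbitrary: z) auto

lemma wts_sw: "1 \<le> i \<Longrightarrow> i < N \<Longrightarrow> l \<in> wts N \<Longrightarrow> sw i l \<in> wts N"
  by (auto simp: wts_def sw_def)

lemma wts_mv: "1 \<le> i \<Longrightarrow> i < N \<Longrightarrow> l \<in> wts N \<Longrightarrow> mv n i s l \<in> wts N"
  by (auto simp: wts_def mv_def)

lemma Top_bas_tpow:
  assumes "n > 0" "1 \<le> i" "i < N" "l \<in> wts N"
  shows "Top n v i (bas l) \<in> tpow N"
proof (cases "l (Suc i) < l i")
  case True
  show ?thesis unfolding Top_bas_gt[where l = l and i = i, OF assms(1) True]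
    using assms by (intro tens.subspace_diff tens.subspace_sum tens.subspace_scale tpow_subspace) (auto intro: wts_sw wts_mv)
next
  case False
  then have le: "l i \<le> l (Suc i)" by simp
  show ?thesis unfolding Top_bas_le[where l = l and i = i, OF assms(1) le]
    using assms by (intro tens.subspace_add tens.subspace_sum tens.subspace_scale tpow_subspace) (auto intro: wts_sw wts_mv)
qed

lemma Aut_Top:
  assumes "n > 0" "v \<noteq> 0" "1 \<le> i" "i < N"
  shows "Aut N (Top n v i)" "inv (Top n v i) = Tinv n v i"
proof -
  have "Tinv n v i (bas l) \<in> tpow N" if "l \<in> wts N" for l
    unfolding Tinv_def using Top_bas_tpow[OF assms(1,3,4) that] that
    by (intro tens.subspace_diff tens.subspace_scale tpow_subspace) auto
  note * = AutI[OF linop_Top linop_Tinv Top_Tinv(1) Top_Tinv(2) Top_bas_tpow this]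
  show "Aut N (Top n v i)" by (rule *(1)) (use assms in auto)
  show "inv (Top n v i) = Tinv n v i" by (rule *(2)) (use assms in auto)
qed

lemma Aut_Tinv: "n > 0 \<Longrightarrow> v \<noteq> 0 \<Longrightarrow> 1 \<le> i \<Longrightarrow> i < N \<Longrightarrow> Aut N (Tinv n v i)"
  using Aut_Top[of n v i N] Aut_inv by metis

lemma Aut_Ymul: "1 \<le> i \<Longrightarrow> i \<le> N \<Longrightarrow> Aut N (Ymul n i k)"
  by (rule AutI(1)[of _ "Ymul n i (- k)"]) (auto simp: linop_Ymul Ymul_Ymul wts_def)

section \<open>The operator \<open>\<pi>\<close> and its relations\<close>

lemma swap_cycle:
  "N \<ge> 1 \<Longrightarrow> comps (map swap [1..<N]) (bas l)
     = bas (\<lambda>k. if k = 1 then l N else if 2 \<le> k \<and> k \<le> N then l (k - 1) else l k)"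
proof (induction N arbitrary: l rule: dec_induct)
  case base
  then show ?case by (auto intro!: arg_cong[of _ _ bas] simp: fun_eq_iff)
next
  case (step N)
  then show ?case by (auto simp: swap_def fun_eq_iff intro!: arg_cong[of _ _ bas])
qed

lemma kappa_pow: "(kappa i ^^ k) (bas l) = bas (l(i := l i - int k))"
proof (induction k)
  case (Suc k)
  have "(kappa i ^^ Suc k) (bas l) = kappa i (bas (l(i := l i - int k)))"
    by (simp only: funpow.simps comp_apply Suc.IH)
  also have "\<dots> = bas (l(i := l i - int (Suc k)))"
    by (auto simp: kappa_def fun_eq_iff intro!: arg_cong[of _ _ bas])
  finally show ?case .
qed simp

lemma linop_comps: "(\<And>f. f \<in> set fs \<Longrightarrow> linop f) \<Longrightarrow> linop (comps fs)"
  by (induction fs) (auto intro: linop_id linop_comp)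

lemma linop_funpow: "linop f \<Longrightarrow> linop (f ^^ k)"
  by (induction k) (auto intro: linop_id[unfolded id_def] linop_id linop_comp)

lemma linop_piop: "linop (piop n n' N q u)"
  unfolding piop_def by (intro linop_comp linop_funpow linop_kappa linop_Dop linop_comps) (auto simp: linop_swap)

definition rotp :: "nat \<Rightarrow> nat \<Rightarrow> weight \<Rightarrow> weight" where
  "rotp n' N l = (\<lambda>k. if k = 1 then l N - int n' else if 2 \<le> k \<and> k \<le> N then l (k - 1) else l k)"

definition pcoef :: "nat \<Rightarrow> complex \<Rightarrow> (nat \<Rightarrow> complex) \<Rightarrow> int \<Rightarrow> complex" where
  "pcoef n q u a = u (nat (a mod int n)) * q powi (a div int n)"

lemma piop_bas:
  assumes "N \<ge> 1"
  shows "piop n n' N q u (bas l) = scale (pcoef n q u (l N)) (bas (rotp n' N l))"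
proof -
  let ?c = "\<lambda>k. if k = 1 then l N else if 2 \<le> k \<and> k \<le> N then l (k - 1) else l k"
  have D: "Dop n q u 1 (bas l') = scale (pcoef n q u (l' 1)) (bas l')" for l'
    by (simp add: Dop_def pcoef_def)
  have "piop n n' N q u (bas l) = scale (pcoef n q u (?c 1)) (bas (?c(1 := ?c 1 - int n')))"
    unfolding piop_def comp_apply swap_cycle[OF assms] D linop_scale[OF linop_funpow[OF linop_kappa]] kappa_pow ..
  also have "?c(1 := ?c 1 - int n') = rotp n' N l" by (auto simp: rotp_def)
  finally show ?thesis by simp
qed

lemma pcoef_nonzero: "n > 0 \<Longrightarrow> q \<noteq> 0 \<Longrightarrow> \<forall>a<n. u a \<noteq> 0 \<Longrightarrow> pcoef n q u a \<noteq> 0"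
  by (simp add: pcoef_def nat_less_iff)

lemma pcoef_shift: "n > 0 \<Longrightarrow> q \<noteq> 0 \<Longrightarrow> pcoef n q u (a + int n * s) = pcoef n q u a * q powi s"
  by (simp add: pcoef_def power_int_add)

lemma Aut_piop:
  assumes "N \<ge> 1" "n > 0" "q \<noteq> 0" "\<forall>a<n. u a \<noteq> 0"
  shows "Aut N (piop n n' N q u)"
proof -
  define r where "r = (\<lambda>l::weight. \<lambda>k. if k = N then l 1 + int n' else if 1 \<le> k \<and> k < N then l (Suc k) else l k)"
  define g where "g = lin (\<lambda>l. scale (inverse (pcoef n q u (r l N))) (bas (r l)))"
  have g: "linop g" unfolding g_def by (rule linop_lin)
  have gb: "g (bas l) = scale (inverse (pcoef n q u (r l N))) (bas (r l))" for l by (simp add: g_def)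
  have r: "r (rotp n' N l) = l" "rotp n' N (r l) = l" for l
    using assms(1) by (auto simp: r_def rotp_def fun_eq_iff)
  have nz: "pcoef n q u a \<noteq> 0" for a using assms by (intro pcoef_nonzero) auto
  have 1: "piop n n' N q u \<circ> g = id"
    by (rule linop_ext) (use nz assms in \<open>auto intro!: linop_comp linop_piop g linop_id simp: gb piop_bas linop_scale[OF linop_piop] r\<close>)
  have 2: "g \<circ> piop n n' N q u = id"
    by (rule linop_ext) (use nz assms in \<open>auto intro!: linop_comp linop_piop g linop_id simp: gb piop_bas linop_scale[OF g] r\<close>)
  have w: "l \<in> wts N \<Longrightarrow> r l \<in> wts N" "l \<in> wts N \<Longrightarrow> rotp n' N l \<in> wts N" for l
    using assms(1) by (auto simp: wts_def r_def rotp_def)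
  show ?thesis
    by (rule AutI(1)[OF linop_piop g])
      (use 1 2 w assms in \<open>auto simp: fun_eq_iff gb piop_bas intro!: tens.subspace_scale tpow_subspace\<close>)
qed

lemma piop_Top:
  assumes "n > 0" "1 \<le> i" "Suc i < N"
  shows "piop n n' N q u (Top n v i x) = Top n v (Suc i) (piop n n' N q u x)"
proof (rule Top_intertwine[where \<sigma> = "rotp n' N" and c = "\<lambda>l. pcoef n q u (l N)" and k = 0])
  show "rotp n' N (sw i l) = sw (Suc i) (rotp n' N l)" for l
    using assms by (auto simp: fun_eq_iff rotp_def sw_def)
  show "rotp n' N (mv n i s l) = mv n (Suc i) s (rotp n' N l)" for s l
    using assms by (auto simp: fun_eq_iff rotp_def mv_def)
qed (use assms in \<open>auto simp: linop_piop piop_bas rotp_def mv_def\<close>)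

text \<open>A single \<open>\<pi>\<close> would shift only one of the last two entries by
  \<open>n'\<close>; its square shifts both, and \<open>T\<close> sees only their difference. The
  scalars agree since moving \<open>Y\<close> from one entry to the other multiplies them by
  \<open>q^{-s} q^s\<close>.\<close>

lemma piop_piop_Top:
  assumes "n > 0" "q \<noteq> 0" "N \<ge> 2"
  shows "piop n n' N q u (piop n n' N q u (Top n v (N - 1) x))
    = Top n v 1 (piop n n' N q u (piop n n' N q u x))"
proof -
  let ?p = "piop n n' N q u"
  obtain M where M: "N = Suc M" "M \<ge> 1" using assms(3) by (cases N) auto
  have "(\<lambda>x. ?p (?p x)) (Top n v M x) = Top n v 1 ((\<lambda>x. ?p (?p x)) x)"
  proof (rule Top_intertwine[where \<sigma> = "\<lambda>l. rotp n' N (rotp n' N l)"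
        and c = "\<lambda>l. pcoef n q u (l M) * pcoef n q u (l N)" and k = "- int n'"])
    show "linop (\<lambda>x. ?p (?p x))" by (intro linop_compI[OF linop_piop linop_piop])
    show "?p (?p (bas l)) = scale (pcoef n q u (l M) * pcoef n q u (l N)) (bas (rotp n' N (rotp n' N l)))" for l
      using assms M by (auto simp: piop_bas linop_scale[OF linop_piop] rotp_def mult.commute)
    show "rotp n' N (rotp n' N l) 1 = l M + - int n'" "rotp n' N (rotp n' N l) (Suc 1) = l (Suc M) + - int n'" for l
      using assms M by (auto simp: rotp_def)
    have rr: "rotp n' N (rotp n' N l) = (\<lambda>k. if k = 1 then l M - int n' else if k = 2 then l N - int n'
        else if 3 \<le> k \<and> k \<le> N then l (k - 2) else l k)" for l
    proof
      fix k :: nat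
      consider "k = 0" | "k = 1" | "k = 2" | "3 \<le> k" by linarith
      then show "rotp n' N (rotp n' N l) k = (if k = 1 then l M - int n' else if k = 2 then l N - int n'
        else if 3 \<le> k \<and> k \<le> N then l (k - 2) else l k)"
        using M by cases (auto simp: rotp_def numeral_2_eq_2 numeral_3_eq_3)
    qed
    show "rotp n' N (rotp n' N (sw M l)) = sw 1 (rotp n' N (rotp n' N l))" for l
      unfolding rr using M by (auto simp: fun_eq_iff sw_def)
    show "rotp n' N (rotp n' N (mv n M s l)) = mv n 1 s (rotp n' N (rotp n' N l))" for s l
      unfolding rr using M by (auto simp: fun_eq_iff mv_def)
    show "pcoef n q u (sw M l M) * pcoef n q u (sw M l N) = pcoef n q u (l M) * pcoef n q u (l N)" for l
      using M by simp
    show "pcoef n q u (mv n M s l M) * pcoef n q u (mv n M s l N) = pcoef n q u (l M) * pcoef n q u (l N)" for s l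
      using assms M pcoef_shift[of n q u "l M" "- s"] pcoef_shift[of n q u "l N" "s"]
      by (simp add: mv_def power_int_minus)
  qed (use assms in simp)
  then show ?thesis using M by simp
qed

lemma piop_Ymul:
  assumes "1 \<le> i" "i < N"
  shows "piop n n' N q u (Ymul n i k x) = Ymul n (Suc i) k (piop n n' N q u x)"
proof -
  have "piop n n' N q u \<circ> Ymul n i k = Ymul n (Suc i) k \<circ> piop n n' N q u"
  proof (rule linop_ext)
    fix l
    have "rotp n' N (l(i := l i + int n * k)) = (rotp n' N l)(Suc i := l i + int n * k)"
      using assms by (auto simp: rotp_def fun_eq_iff)
    moreover have "rotp n' N l (Suc i) = l i" using assms by (simp add: rotp_def)
    ultimately show "(piop n n' N q u \<circ> Ymul n i k) (bas l) = (Ymul n (Suc i) k \<circ> piop n n' N q u) (bas l)"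
      using assms by (simp add: piop_bas)
  qed (intro linop_comp linop_piop linop_Ymul)+
  then show ?thesis by (simp add: fun_eq_iff)
qed

section \<open>The operators \<open>A_i\<close>\<close>

locale daha =
  fixes n n' N m m' :: nat and q v :: complex and u :: "nat \<Rightarrow> complex"
  assumes n: "n > 0" and N: "N \<ge> 1" and q: "q \<noteq> 0" and v: "v \<noteq> 0" and u: "\<forall>a<n. u a \<noteq> 0"
    and det: "n * m' = n' * m + 1"
begin

abbreviation "T \<equiv> Top n v"
abbreviation "Ti \<equiv> Tinv n v"
abbreviation "P \<equiv> piop n n' N q u"
abbreviation "h \<equiv> v - inverse v"

lemmas linop_T = linop_Top[OF n, of v]
lemmas linop_Ti = linop_Tinv[OF n, of v]
lemmas TTi [simp] = Top_Tinv[OF n v]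
lemmas Aut_T = Aut_Top(1)[OF n v]
lemmas Aut_Ti = Aut_Tinv[OF n v]
lemmas Aut_P = Aut_piop[OF N n q u, of n']

lemma far_T: "Suc i < j \<or> Suc j < i \<Longrightarrow> T i (T j z) = T j (T i z)"
  by (elim disjE) (rule Top_commute[OF n] Top_commute[OF n, symmetric], assumption)+

lemma far_T_Ti: "Suc i < j \<or> Suc j < i \<Longrightarrow> T i (Ti j z) = Ti j (T i z)"
  unfolding Tinv_def by (simp add: linop_diff[OF linop_T] linop_scale[OF linop_T] far_T[of i j])

lemma far_Ti: "Suc i < j \<or> Suc j < i \<Longrightarrow> Ti i (Ti j z) = Ti j (Ti i z)"
  using far_T_Ti[of i j "Ti i z"] by (metis TTi)

lemma braid_Ti_Ti_T: "Ti (Suc i) (Ti i (T (Suc i) z)) = T i (Ti (Suc i) (Ti i z))"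
proof -
  define w where "w = Ti (Suc i) (Ti i z)"
  have z: "z = T i (T (Suc i) w)" by (simp add: w_def)
  show ?thesis by (simp add: z Top_braid[OF n v, symmetric])
qed

lemma braid_T_Ti_Ti: "T (Suc i) (Ti i (Ti (Suc i) z)) = Ti i (Ti (Suc i) (T i z))"
proof -
  define w where "w = Ti i (Ti (Suc i) z)"
  have z: "z = T (Suc i) (T i w)" by (simp add: w_def)
  show ?thesis by (simp add: z Top_braid[OF n v])
qed

text \<open>\<open>T_{k-1}^{-1} ... T_1^{-1}\<close>; in particular \<open>X = \<pi> S_N\<close> is
  the inverse of \<open>X_1\<close>.\<close>

definition S :: "nat \<Rightarrow> tens \<Rightarrow> tens" where
  "S k = comps (map Ti (rev [1..<k]))"

lemma S_1 [simp]: "S (Suc 0) z = z"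
  by (simp add: S_def)

lemma S_Suc: "1 \<le> k \<Longrightarrow> S (Suc k) z = Ti k (S k z)"
  by (simp add: S_def)

lemma S_T_above: "1 \<le> k \<Longrightarrow> k < i \<Longrightarrow> S k (T i z) = T i (S k z)"
proof (induction k arbitrary: z rule: dec_induct)
  case (step k)
  then show ?case using far_T_Ti[of i k] by (simp add: S_Suc)
qed simp

lemma S_Ti_above: "1 \<le> k \<Longrightarrow> k < i \<Longrightarrow> S k (Ti i z) = Ti i (S k z)"
proof (induction k arbitrary: z rule: dec_induct)
  case (step k)
  then show ?case using far_Ti[of i k] by (simp add: S_Suc)
qed simp

lemma S_T: "1 \<le> i \<Longrightarrow> Suc i < k \<Longrightarrow> S k (T (Suc i) z) = T i (S k z)"
proof (induction k)
  case (Suc k)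
  show ?case
  proof (cases "Suc i < k")
    case True
    then show ?thesis using Suc far_T_Ti[of i k] by (simp add: S_Suc)
  next
    case False
    then have k: "k = Suc i" using Suc.prems by simp
    show ?thesis using Suc.prems by (simp add: k S_Suc S_T_above braid_Ti_Ti_T)
  qed
qed simp

text \<open>Braid moves carry \<open>T_1\<close> through two sweeps and turn it into
  \<open>T_k\<close>; for \<open>k = N - 1\<close> it then meets
  \<open>\<pi>^2 T_{N-1} = T_1 \<pi>^2\<close>.\<close>

lemma S_S_T: "1 \<le> k \<Longrightarrow> T k (S k (S (Suc k) z)) = S k (S (Suc k) (T 1 z))"
proof (induction k rule: dec_induct)
  case base
  then show ?case by (simp add: S_Suc)
next
  case (step k)
  have *: "S (Suc k) (S (Suc (Suc k)) z) = Ti k (Ti (Suc k) (S k (S (Suc k) z)))" for z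
    using step.hyps by (simp add: S_Suc S_Ti_above)
  show ?case unfolding * braid_T_Ti_Ti step.IH ..
qed

definition X :: "tens \<Rightarrow> tens" where
  "X = P \<circ> S N"

abbreviation "Y \<equiv> Ymul n 1 1"

lemma X_T: "1 \<le> i \<Longrightarrow> Suc i < N \<Longrightarrow> X (T (Suc i) z) = T (Suc i) (X z)"
  by (simp add: X_def S_T piop_Top[OF n])

lemma Y_T: "2 \<le> i \<Longrightarrow> Y (T i z) = T i (Y z)"
  using Top_Ymul(3)[OF n, of 1 i v 1 z] by (simp del: One_nat_def)

lemma T_Y_T: "T 1 (Y (T 1 z)) = Ymul n 2 1 z"
  using Top_Ymul(1)[OF n, of v 1 "T 1 z"] Top_quadratic[OF n v, of 1 z] by (simp add: numeral_2_eq_2)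

lemma S_P: "1 \<le> k \<Longrightarrow> Suc k \<le> N \<Longrightarrow> P (S k z) = comps (map Ti (rev [2..<Suc k])) (P z)"
proof (induction k rule: dec_induct)
  case base
  then show ?case by (simp add: numeral_2_eq_2)
next
  case (step k)
  have "P (Ti k z) = Ti (Suc k) (P z)" for z
    unfolding Tinv_def using step by (simp add: linop_diff[OF linop_piop] linop_scale[OF linop_piop] piop_Top[OF n])
  then show ?case using step by (simp add: S_Suc)
qed

lemma S_split: "2 \<le> k \<Longrightarrow> S k z = comps (map Ti (rev [2..<k])) (Ti 1 z)"
  by (simp add: S_def upt_conv_Cons numeral_2_eq_2)

text \<open>With \<open>X T_1 = \<pi> R\<close>: the relation for \<open>X\<close> becomes
  \<open>T_1 \<pi>^2 S_{N-1} S_N = \<pi>^2 S_{N-1} S_N T_1\<close>; the one for \<open>Y\<close>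
  says that \<open>Y_1\<close> and \<open>Y_2 = T_1 Y_1 T_1\<close> commute; the mixed one is
  \<open>Y_2 \<pi> R = \<pi> R Y_1\<close>.\<close>

lemma good_XY:
  assumes "N \<ge> 2"
  shows "good (T 1) X Y"
proof -
  obtain K where K: "N = Suc K" "1 \<le> K" using assms by (cases N) auto
  define R where "R = comps (map Ti (rev [2..<N]))"
  have X: "X z = P (R (Ti 1 z))" for z
    using assms by (simp add: X_def S_split R_def)
  have XT: "X (T 1 z) = P (R z)" for z by (simp add: X)
  have RP: "R (P z) = P (S K z)" for z using S_P[of K z] K by (simp add: R_def)
  have RS: "R z = S N (T 1 z)" for z using assms by (simp add: S_split R_def)
  have 1: "X (T 1 (X (T 1 z))) = T 1 (X (T 1 (X z)))" for z
  proof -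
    have "T 1 (X (T 1 (X z))) = T 1 (P (P (S K (R (Ti 1 z)))))"
      by (simp only: XT RP X[of z])
    also have "\<dots> = P (P (T K (S K (S N z))))"
      using piop_piop_Top[OF n q assms, of n' u v] by (simp add: K(1) RS)
    also have "\<dots> = P (P (S K (S N (T 1 z))))"
      using S_S_T[OF K(2)] by (simp add: K(1))
    also have "\<dots> = X (T 1 (X (T 1 z)))"
      by (simp only: XT RP) (simp only: RS)
    finally show ?thesis ..
  qed
  have 2: "Y (T 1 (Y (T 1 z))) = T 1 (Y (T 1 (Y z)))" for z
    unfolding T_Y_T by (rule Ymul_commute)
  have TiY: "Ti i (Y z) = Y (Ti i z)" if "2 \<le> i" for i z
    unfolding Tinv_def using that by (simp add: Y_T del: One_nat_def)
  have RY: "R (Y z) = Y (R z)" for z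
  proof -
    have "comps (map Ti xs) (Y z) = Y (comps (map Ti xs) z)" if "\<forall>i\<in>set xs. 2 \<le> i" for xs z
      using that by (induction xs arbitrary: z) (auto simp: TiY simp del: One_nat_def)
    then show ?thesis by (simp add: R_def)
  qed
  have 3: "T 1 (Y (T 1 (X (T 1 z)))) = X (T 1 (Y z))" for z
    unfolding T_Y_T XT RY using piop_Ymul[of 1 N n n' q u 1] assms by (simp add: numeral_2_eq_2)
  show ?thesis using 1 2 3 by (simp add: good_def)
qed

lemma coprime_m: "coprime m m'"
proof (rule coprimeI)
  fix c assume "c dvd m" "c dvd m'"
  then have "c dvd n' * m + 1" "c dvd n' * m" unfolding det[symmetric] by (auto intro: dvd_mult)
  then show "is_unit c" using dvd_add_right_iff by blast
qed

lemma m'_pos: "m' > 0"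
  using det by (cases m') auto

definition W :: "int \<Rightarrow> tens \<Rightarrow> tens" where
  "W j = (if (j * int m) div int (m + m') = ((j - 1) * int m) div int (m + m') then Y else X)"

definition Aw :: "tens \<Rightarrow> tens" where
  "Aw = comps (map W [1..int m + int m'])"

lemma Run_Aw: "Run m m' X Y 0 m m' Aw 0"
  and Aw_Aw: "N \<ge> 2 \<Longrightarrow> Aw (T 1 (Aw (T 1 z))) = T 1 (Aw (T 1 (Aw z)))"
proof -
  obtain f where f: "Run m m' X Y 0 m m' f 0"
    "\<forall>t. good t X Y \<longrightarrow> (\<forall>z. f (t (f (t z))) = t (f (t (f z))))"
    using Run_good[OF coprime_m] by blast
  have "f = Aw"
    using Run_word[OF f(1), of 0] m'_pos unfolding Aw_def W_def by simp
  with f show "Run m m' X Y 0 m m' Aw 0"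
    "N \<ge> 2 \<Longrightarrow> Aw (T 1 (Aw (T 1 z))) = T 1 (Aw (T 1 (Aw z)))"
    using good_XY by auto
qed

lemma Aut_X: "Aut N X"
  unfolding X_def S_def by (auto intro!: Aut_comp Aut_P Aut_comps Aut_Ti)

lemma Aut_Aw: "Aut N Aw"
  using Run_Aw by (rule Run_preserves) (intro Aut_id Aut_comp Aut_X Aut_Ymul N order_refl; assumption)+

lemma Aw_T:
  assumes "2 \<le> i" "i < N"
  shows "Aw (T i z) = T i (Aw z)"
proof -
  obtain j where j: "i = Suc j" "1 \<le> j" using assms(1) by (cases i) auto
  have "\<forall>z. Aw (T i z) = T i (Aw z)"
    using Run_Aw by (rule Run_preserves) (use assms X_T[of j] in \<open>auto simp: j Y_T simp del: One_nat_def\<close>)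
  then show ?thesis by blast
qed

sublocale braided N T Aw
  by unfold_locales (auto simp: Top_braid[OF n v] far_T Aw_T Aw_Aw simp del: One_nat_def)

lemma Aut_Jm: "1 \<le> i \<Longrightarrow> i \<le> N \<Longrightarrow> Aut N (Jm i)"
  unfolding Jm_def by (auto intro!: Aut_comp Aut_comps Aut_T Aut_Aw)

lemma inv_X: "inv X = comps (map T [1..<N]) \<circ> inv P"
proof (rule inv_unique_comp)
  have 1: "comps (map T [1..<N]) (S N z) = z" "S N (comps (map T [1..<N]) z) = z" for z
    unfolding S_def using comps_cancel[of "[1..<N]" T Ti z] comps_cancel[of "rev [1..<N]" Ti T z] by simp_all
  show "X \<circ> (comps (map T [1..<N]) \<circ> inv P) = id"
    by (rule ext) (simp add: X_def 1 Aut_inv_f[OF Aut_P] del: One_nat_def)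
  show "comps (map T [1..<N]) \<circ> inv P \<circ> X = id"
    by (rule ext) (simp add: X_def 1 Aut_inv_f[OF Aut_P] del: One_nat_def)
qed

lemma X1_eq: "x \<in> tpow N \<Longrightarrow> X1 n n' N q v u x = inv X x"
  unfolding X1_def inv_X using opinv_eq[OF Aut_P] by simp

lemma opinv_X1: "x \<in> tpow N \<Longrightarrow> opinv N (X1 n n' N q v u) x = X x"
  using opinv_eq[OF Aut_inv[OF Aut_X], of "X1 n n' N q v u"] X1_eq
  by (simp add: inv_inv_eq Aut_bij[OF Aut_X])

lemma Wop_eq: "x \<in> tpow N \<Longrightarrow> Wop n n' N q v u (int m) (int m') j x = W j x"
proof -
  have "\<lfloor>real_of_int (k * int m) / real_of_int (int m + int m')\<rfloor> = (k * int m) div int (m + m')" for k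
    using floor_divide_of_int_eq[of "k * int m" "int m + int m'"] by simp
  then show "x \<in> tpow N \<Longrightarrow> ?thesis" unfolding Wop_def W_def by (simp only: opinv_X1 split: if_split) simp
qed

lemma A1_eq: "x \<in> tpow N \<Longrightarrow> A1 n n' N q v u (int m) (int m') x = Aw x"
  unfolding A1_def Aw_def
  by (rule comps_eq[THEN conjunct1]) (auto simp: Wop_eq W_def Aut_X Aut_Ymul N simp del: One_nat_def)

lemma Aop_eq:
  assumes "1 \<le> i" "i \<le> N" "x \<in> tpow N"
  shows "Aop n n' N q v u (int m) (int m') i x = Jm i x"
proof -
  have "comps (map T [1..<i]) x \<in> tpow N"
    by (subst Aut_tpow[OF Aut_comps]) (use assms in \<open>auto intro!: Aut_T\<close>)
  then show ?thesis by (simp add: Aop_def Jm_def A1_eq)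
qed

lemma Avec_eq: "Avec n n' N q v u (int m) (int m') lam
    = comps (map (\<lambda>i. powz (Jm i) (lam i)) [1..<Suc N]) (bas (\<lambda>_. 0))"
  unfolding Avec_def
  by (rule comps_eq[THEN conjunct1])
    (auto intro!: Aut_powz Aut_Jm oppow_eq[OF Aut_Jm] Aop_eq simp: wts_def simp del: upt_Suc)

abbreviation "Av \<equiv> Avec n n' N q v u (int m) (int m')"

lemma Avec_0: "Av (\<lambda>_. 0) = bas (\<lambda>_. 0)"
proof -
  have "comps (map (\<lambda>i. powz (Jm i) 0) xs) z = z" for xs z
    by (induction xs) (auto simp: powz_def)
  then show ?thesis unfolding Avec_eq .
qed

lemma Avec_Suc:
  assumes "j \<in> {1..N}"
  shows "Av (lam(j := lam j + 1)) = Jm j (Av lam)"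
  unfolding Avec_eq
  by (rule comps_powz_upd)
    (use assms in \<open>auto intro: Aut_bij[OF Aut_Jm] Jm_commute simp del: upt_Suc\<close>)

lemma Avec_tpow: "Av lam \<in> tpow N"
  unfolding Avec_eq
  by (subst Aut_tpow[OF Aut_comps]) (auto intro!: Aut_powz Aut_Jm simp: wts_def simp del: upt_Suc)

end

section \<open>Triangular operators\<close>

lemma laurent_zero: "0 \<in> laurent_ring q v"
  using laurent_ring.diff[OF laurent_ring.one laurent_ring.one] by simp

lemma laurent_uminus: "x \<in> laurent_ring q v \<Longrightarrow> - x \<in> laurent_ring q v"
  using laurent_ring.diff[OF laurent_zero] by fastforce

lemma laurent_add: "x \<in> laurent_ring q v \<Longrightarrow> y \<in> laurent_ring q v \<Longrightarrow> x + y \<in> laurent_ring q v"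
  using laurent_ring.diff[OF _ laurent_uminus] by fastforce

lemma laurent_power: "x \<in> laurent_ring q v \<Longrightarrow> x ^ k \<in> laurent_ring q v"
  by (induction k) (auto intro: laurent_ring.intros)

lemma laurent_gens: "q \<in> laurent_ring q v" "inverse q \<in> laurent_ring q v"
    "v \<in> laurent_ring q v" "inverse v \<in> laurent_ring q v"
  by (auto intro: laurent_ring.gen)

definition runit :: "complex \<Rightarrow> complex \<Rightarrow> complex \<Rightarrow> bool" where
  "runit q v c \<longleftrightarrow> c \<in> laurent_ring q v \<and> (\<exists>d\<in>laurent_ring q v. c * d = 1)"

lemma runit_1: "runit q v 1"
  by (auto simp: runit_def intro: laurent_ring.one)

lemma runit_mult: "runit q v c \<Longrightarrow> runit q v d \<Longrightarrow> runit q v (c * d)"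
  unfolding runit_def by (metis (no_types, lifting) laurent_ring.mult mult.assoc mult.left_commute mult_1_right)

lemma runit_v: "v \<noteq> 0 \<Longrightarrow> runit q v v" "v \<noteq> 0 \<Longrightarrow> runit q v (inverse v)"
  unfolding runit_def using laurent_gens(3,4)[where q = q and v = v] by (metis right_inverse left_inverse)+

lemma runit_q_powi:
  assumes "q \<noteq> 0" shows "runit q v (q powi k)"
proof -
  have "q powi k \<in> laurent_ring q v" for k
    by (cases "k \<ge> 0") (auto simp: power_int_def intro!: laurent_power laurent_gens)
  moreover have "q powi k * q powi (- k) = 1"
    using assms by (simp add: power_int_minus)
  ultimately show ?thesis by (auto simp: runit_def)
qed

text \<open>Combinations with coefficients in \<open>R\<close> only; a complex span would forget
  integrality.\<close>

inductive_set rspan :: "complex set \<Rightarrow> tens set \<Rightarrow> tens set" for R S where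
  zero: "0 \<in> rspan R S"
| step: "x \<in> rspan R S \<Longrightarrow> s \<in> S \<Longrightarrow> c \<in> R \<Longrightarrow> x + scale c s \<in> rspan R S"

lemma rspan_base: "s \<in> S \<Longrightarrow> c \<in> R \<Longrightarrow> scale c s \<in> rspan R S"
  using rspan.step[OF rspan.zero] by fastforce

lemma rspan_add: "y \<in> rspan R S \<Longrightarrow> x \<in> rspan R S \<Longrightarrow> x + y \<in> rspan R S"
  by (induction rule: rspan.induct) (auto simp: add.assoc[symmetric] intro: rspan.step)

lemma rspan_sum: "(\<And>i. i \<in> I \<Longrightarrow> f i \<in> rspan R S) \<Longrightarrow> sum f I \<in> rspan R S"
  by (induction I rule: infinite_finite_induct) (auto intro: rspan.zero rspan_add)

lemma rspan_scale:
  assumes "x \<in> rspan (laurent_ring q v) S" "c \<in> laurent_ring q v"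
  shows "scale c x \<in> rspan (laurent_ring q v) S"
  using assms by (induction rule: rspan.induct) (auto simp: tens.scale_right_distrib intro: rspan.intros laurent_ring.mult)

lemma rspan_linop:
  assumes "x \<in> rspan (laurent_ring q v) S" "linop F" "\<And>s. s \<in> S \<Longrightarrow> F s \<in> rspan (laurent_ring q v) S'"
  shows "F x \<in> rspan (laurent_ring q v) S'"
  using assms
  by (induction rule: rspan.induct)
    (auto simp: linop_zero linop_add linop_scale intro: rspan.zero rspan_add rspan_scale)

lemma rspan_mono: "S \<subseteq> S' \<Longrightarrow> x \<in> rspan R S \<Longrightarrow> x \<in> rspan R S'"
  by (rotate_tac, induction rule: rspan.induct) (auto intro: rspan.intros)

context daha
begin

abbreviation "R \<equiv> laurent_ring q v"
abbreviation "unit \<equiv> runit q v"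

lemma unit_R: "unit c \<Longrightarrow> c \<in> R"
  by (simp add: runit_def)

lemma h_R: "h \<in> R" "- h \<in> R"
  using laurent_ring.diff[OF laurent_gens(3) laurent_gens(4)] laurent_uminus by blast+

text \<open>The family \<open>b\<close> is arbitrary and the order is taken on its labels. A unit as
  leading coefficient is what survives inversion.\<close>

definition triv :: "(weight \<Rightarrow> tens) \<Rightarrow> weight \<Rightarrow> tens \<Rightarrow> bool" where
  "triv b lam x \<longleftrightarrow> (\<exists>c. unit c \<and> x - scale c (b lam) \<in> rspan R {b mu |mu. blt N mu lam})"

definition tri :: "(tens \<Rightarrow> tens) \<Rightarrow> (weight \<Rightarrow> tens) \<Rightarrow> (weight \<Rightarrow> tens) \<Rightarrow> bool" where
  "tri F b b' \<longleftrightarrow> (\<forall>lam. triv b' lam (F (b lam)))"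

lemma trivI: "unit c \<Longrightarrow> y \<in> rspan R {b mu |mu. blt N mu lam} \<Longrightarrow> x = scale c (b lam) + y \<Longrightarrow> triv b lam x"
  unfolding triv_def by (intro exI[of _ c]) simp

lemma trivE:
  assumes "triv b lam x"
  obtains c y where "unit c" "y \<in> rspan R {b mu |mu. blt N mu lam}" "x = scale c (b lam) + y"
proof -
  from assms obtain c where "unit c" "x - scale c (b lam) \<in> rspan R {b mu |mu. blt N mu lam}"
    unfolding triv_def by blast
  then show ?thesis using that[of c "x - scale c (b lam)"] by simp
qed

lemma triv_rspan: "triv b lam x \<Longrightarrow> x \<in> rspan R {b mu |mu. ble N mu lam}"
proof (elim trivE, clarify)
  fix c y assume c: "unit c" and y: "y \<in> rspan R {b mu |mu. blt N mu lam}"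
  have "y \<in> rspan R {b mu |mu. ble N mu lam}"
    by (rule rspan_mono[OF _ y]) (auto simp: ble_blt_iff)
  moreover have "scale c (b lam) \<in> rspan R {b mu |mu. ble N mu lam}"
    by (rule rspan_base) (use unit_R[OF c] in auto)
  ultimately show "scale c (b lam) + y \<in> rspan R {b mu |mu. ble N mu lam}"
    by (rule rspan_add)
qed

lemma triv_linop:
  assumes F: "linop F" and x: "triv b lam x" and top: "triv b' lam' (F (b lam))"
    and lower: "\<And>mu. blt N mu lam \<Longrightarrow> F (b mu) \<in> rspan R {b' nu |nu. blt N nu lam'}"
  shows "triv b' lam' (F x)"
proof -
  obtain c y where c: "unit c" and y: "y \<in> rspan R {b mu |mu. blt N mu lam}" and xe: "x = scale c (b lam) + y"
    using x by (rule trivE)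
  obtain d z where d: "unit d" and z: "z \<in> rspan R {b' mu |mu. blt N mu lam'}" and ze: "F (b lam) = scale d (b' lam') + z"
    using top by (rule trivE)
  show ?thesis
  proof (rule trivI)
    show "unit (c * d)" using c d by (rule runit_mult)
    have "F y \<in> rspan R {b' nu |nu. blt N nu lam'}"
      by (rule rspan_linop[OF y F]) (use lower in auto)
    with rspan_scale[OF z unit_R[OF c]]
    show "F y + scale c z \<in> rspan R {b' nu |nu. blt N nu lam'}" by (rule rspan_add)
    show "F x = scale (c * d) (b' lam') + (F y + scale c z)"
      by (simp add: xe linop_add[OF F] linop_scale[OF F] ze tens.scale_right_distrib)
  qed
qed

lemma tri_triv:
  assumes "linop F" "tri F b b'" "triv b lam x"
  shows "triv b' lam (F x)"
proof (rule triv_linop[OF assms(1,3)])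
  show "triv b' lam (F (b lam))" using assms(2) by (simp add: tri_def)
  fix mu assume mu: "blt N mu lam"
  have "F (b mu) \<in> rspan R {b' nu |nu. ble N nu mu}"
    using assms(2) by (intro triv_rspan) (simp add: tri_def)
  then show "F (b mu) \<in> rspan R {b' nu |nu. blt N nu lam}"
    by (rule rspan_mono[rotated]) (use mu in \<open>auto intro: rtranclp_tranclp_tranclp\<close>)
qed

lemma tri_comp: "linop G \<Longrightarrow> tri F b b' \<Longrightarrow> tri G b' b'' \<Longrightarrow> tri (G \<circ> F) b b''"
  using tri_triv[of G b' b''] by (simp add: tri_def)

lemma triv_self: "triv b lam (b lam)"
  by (rule trivI[OF runit_1 rspan.zero]) simp

lemma tri_id: "tri id b b"
  by (simp add: tri_def triv_self)

lemma tri_scale: "(\<And>lam. \<exists>c. unit c \<and> F (b lam) = scale c (b' lam)) \<Longrightarrow> tri F b b'"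
  unfolding tri_def
proof
  fix lam assume "\<And>lam. \<exists>c. unit c \<and> F (b lam) = scale c (b' lam)"
  then obtain c where "unit c" "F (b lam) = scale c (b' lam)" by blast
  then show "triv b' lam (F (b lam))" by (intro trivI[OF _ rspan.zero]) auto
qed

text \<open>Solve \<open>F (b lam) = c (b' lam) + y\<close> for \<open>b' lam\<close> and apply the
  inverse; \<open>y\<close> involves only labels of smaller \<open>qnorm\<close>, where the claim is
  known.\<close>

lemma tri_inv:
  assumes F: "linop F" "bij F" and tri: "tri F b b'"
  shows "tri (inv F) b' b"
  unfolding tri_def
proof
  note lin = linop_inv[OF F]
  fix lam show "triv b lam (inv F (b' lam))"
  proof (induction "qnorm N lam" arbitrary: lam rule: less_induct)
    case less
    obtain c y where c: "unit c" and y: "y \<in> rspan R {b' mu |mu. blt N mu lam}" and e: "F (b lam) = scale c (b' lam) + y"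
      using tri[unfolded tri_def, rule_format, of lam] by (rule trivE)
    obtain d where d: "d \<in> R" "c * d = 1" using c by (auto simp: runit_def)
    have ud: "unit d" using c d by (auto simp: runit_def mult.commute)
    have "inv F (b' mu) \<in> rspan R {b nu |nu. blt N nu lam}" if mu: "blt N mu lam" for mu
    proof -
      have "inv F (b' mu) \<in> rspan R {b nu |nu. ble N nu mu}"
        using less[OF blt_qnorm[OF mu]] by (rule triv_rspan)
      then show ?thesis
        by (rule rspan_mono[rotated]) (use mu in \<open>auto intro: rtranclp_tranclp_tranclp\<close>)
    qed
    then have "inv F y \<in> rspan R {b nu |nu. blt N nu lam}"
      by (intro rspan_linop[OF y lin]) auto
    then have "scale (- d) (inv F y) \<in> rspan R {b nu |nu. blt N nu lam}"
      using d by (intro rspan_scale laurent_uminus)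
    moreover have "inv F (b' lam) = scale d (b lam) + scale (- d) (inv F y)"
    proof -
      have "b' lam = scale d (F (b lam) - y)"
        using d by (simp add: e mult.commute)
      then have "inv F (b' lam) = scale d (inv F (F (b lam)) - inv F y)"
        by (simp add: linop_scale[OF lin] linop_diff[OF lin])
      then show ?thesis
        using bij_is_inj[OF F(2)] by (simp add: tens.scale_right_diff_distrib)
    qed
    ultimately show ?case using ud by (intro trivI)
  qed
qed

text \<open>The vectors \<open>gb \<lambda>\<close> are the \<open>e_\<lambda>\<close> rescaled by monomials in the \<open>u_a\<close> such that all coefficients
  become free of the \<open>u_a\<close>. The exponents solve \<open>f_a (l + n) = f_a l + m\<close> and
  \<open>f_a (l - n') = f_a l - m' + [l \<equiv> a mod n]\<close>, whence \<open>Y_1\<close> and \<open>\<pi>\<close> act with the constants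
  \<open>U powi (-m)\<close> and \<open>U powi m'\<close> for \<open>U = \<Prod>a<n. u a\<close>; these cancel in the word \<open>A_1\<close>.\<close>

definition gexp :: "nat \<Rightarrow> int \<Rightarrow> int" where
  "gexp a l = (int m * (l - int a) - 1) div int n"

definition gauge :: "int \<Rightarrow> complex" where
  "gauge l = (\<Prod>a<n. u a powi gexp a l)"

definition G :: "weight \<Rightarrow> complex" where
  "G l = (\<Prod>i\<in>{1..N}. gauge (l i))"

definition U :: complex where
  "U = (\<Prod>a<n. u a)"

lemma U_nonzero: "U \<noteq> 0"
  using u by (simp add: U_def)

lemma gauge_nonzero: "gauge l \<noteq> 0"
  using u by (simp add: gauge_def)

lemma G_nonzero: "G l \<noteq> 0"
  by (simp add: G_def gauge_nonzero)

lemma prod_powi: "(\<Prod>a\<in>A. f a powi k) = (\<Prod>a\<in>A. f a) powi k" for f :: "'b \<Rightarrow> complex"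
  by (induction A rule: infinite_finite_induct) (auto simp: power_int_mult_distrib)

lemma gexp_add: "gexp a (l + int n * s) = gexp a l + int m * s"
proof -
  have "int m * (l + int n * s - int a) - 1 = (int m * (l - int a) - 1) + int n * (int m * s)"
    by (simp add: algebra_simps)
  then show ?thesis unfolding gexp_def using n by (simp only: div_mult_self2)
qed

lemma gauge_add: "gauge (l + int n * s) = U powi (int m * s) * gauge l"
proof -
  have "gauge (l + int n * s) = (\<Prod>a<n. u a powi (int m * s) * u a powi gexp a l)"
    unfolding gauge_def by (intro prod.cong) (use u in \<open>auto simp: gexp_add power_int_add\<close>)
  then show ?thesis by (simp add: prod.distrib prod_powi gauge_def U_def)
qed

lemma det_int: "int n * int m' = int n' * int m + 1"
  using arg_cong[OF det, of int] by simp

lemma div_Suc: "(x + 1) div int n = x div int n + of_bool (int n dvd x + 1)"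
proof -
  have e: "x + 1 = (x mod int n + 1) + int n * (x div int n)" by simp
  have r: "0 \<le> x mod int n" "x mod int n < int n" using n by auto
  have *: "(x + 1) div int n = x div int n + (x mod int n + 1) div int n"
    using n by (subst e, subst div_mult_self2) auto
  have d: "int n dvd x + 1 \<longleftrightarrow> int n dvd x mod int n + 1"
    by (subst e, rule dvd_add_left_iff) simp
  show ?thesis
  proof (cases "x mod int n + 1 = int n")
    case True
    then show ?thesis using n unfolding * d by simp
  next
    case False
    then have "x mod int n + 1 < int n" using r by simp
    moreover from this have "\<not> int n dvd x mod int n + 1" using r by (auto dest: zdvd_imp_le)
    ultimately show ?thesis using r unfolding * d by (simp add: div_pos_pos_trivial)
  qed
qed

lemma mult_div_le': "int n * (x div int n) \<le> x"
  using mult_div_mod_eq[of "int n" x] pos_mod_sign[of "int n" x] n by linarith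

text \<open>Since \<open>m n' = n m' - 1\<close>, lowering \<open>l\<close> by \<open>n'\<close>
  raises the numerator by 1 up to a multiple of \<open>n\<close>, and the floor jumps only when the
  new numerator is divisible by \<open>n\<close>.\<close>

lemma gexp_sub:
  assumes "a < n"
  shows "gexp a (l - int n') = gexp a l - int m' + of_bool (a = nat (l mod int n))"
proof -
  let ?x = "int m * (l - int a) - 1"
  have "int m * (l - int n' - int a) - 1 = (?x + 1) + int n * (- int m')"
    using det_int by (simp add: algebra_simps)
  then have "gexp a (l - int n') = (?x + 1) div int n - int m'"
    using n unfolding gexp_def by (simp only: div_mult_self2)
  also have "(?x + 1) div int n = gexp a l + of_bool (int n dvd ?x + 1)"
    unfolding gexp_def by (rule div_Suc)
  also have "int n dvd ?x + 1 \<longleftrightarrow> int n dvd l - int a"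
  proof
    assume "int n dvd ?x + 1"
    \<comment> \<open>Multiplication by \<open>n'\<close> removes \<open>m\<close>, because
      \<open>n' m\<close> is \<open>-1\<close> modulo \<open>n\<close>.\<close>
    then have "int n dvd int n' * (int m * (l - int a))" by simp
    also have "int n' * (int m * (l - int a)) = int n * (int m' * (l - int a)) - (l - int a)"
    proof -
      have "int n * (int m' * (l - int a)) = (int n' * int m + 1) * (l - int a)"
        by (simp only: mult.assoc[symmetric] det_int)
      then show ?thesis by (simp add: algebra_simps)
    qed
    finally show "int n dvd l - int a" by (metis dvd_diff_right_iff dvd_triv_left)
  qed simp
  also have "\<dots> \<longleftrightarrow> a = nat (l mod int n)"
    using assms n by (auto simp flip: mod_eq_iff_dvd)
  finally show ?thesis by simp
qed

lemma gauge_sub: "gauge (l - int n') = U powi (- int m') * (u (nat (l mod int n)) * gauge l)"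
proof -
  define A where "A = nat (l mod int n)"
  have A: "A < n" using n by (simp add: A_def nat_less_iff)
  have "gauge (l - int n') = (\<Prod>a<n. u a powi (- int m') * (u a powi of_bool (a = A) * u a powi gexp a l))"
    unfolding gauge_def
  proof (intro prod.cong refl)
    fix a assume a: "a \<in> {..<n}"
    have "gexp a (l - int n') = - int m' + (of_bool (a = A) + gexp a l)"
      using a by (simp add: gexp_sub A_def)
    moreover have "u a \<noteq> 0" using a u by simp
    ultimately show "u a powi gexp a (l - int n') = u a powi (- int m') * (u a powi of_bool (a = A) * u a powi gexp a l)"
      by (simp only: power_int_add simp_thms)
  qed
  also have "\<dots> = U powi (- int m') * ((\<Prod>a<n. u a powi of_bool (a = A)) * gauge l)"
    by (simp add: prod.distrib prod_powi gauge_def U_def)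
  also have "(\<Prod>a<n. u a powi of_bool (a = A)) = (\<Prod>a<n. if a = A then u a else 1)"
    by (intro prod.cong) auto
  also have "\<dots> = u A" using A by simp
  finally show ?thesis by (simp add: A_def)
qed

lemma G_split: "i \<in> {1..N} \<Longrightarrow> G l = gauge (l i) * (\<Prod>k\<in>{1..N} - {i}. gauge (l k))"
  unfolding G_def by (rule prod.remove) auto

lemma G_upd: "i \<in> {1..N} \<Longrightarrow> G (l(i := c)) * gauge (l i) = G l * gauge c"
proof -
  assume i: "i \<in> {1..N}"
  have "(\<Prod>k\<in>{1..N} - {i}. gauge ((l(i := c)) k)) = (\<Prod>k\<in>{1..N} - {i}. gauge (l k))"
    by (intro prod.cong) auto
  then show ?thesis unfolding G_split[OF i] by simp
qed

lemma G_upd2: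
  assumes "1 \<le> i" "i < N" "gauge c * gauge d = gauge (l i) * gauge (l (Suc i))"
  shows "G (l(i := c, Suc i := d)) = G l"
proof -
  have "G (l(i := c, Suc i := d)) * (gauge (l i) * gauge (l (Suc i))) = G l * (gauge c * gauge d)"
    using G_upd[of "Suc i" "l(i := c)" d] G_upd[of i l c] assms(1,2) by (simp add: mult_ac)
  then show ?thesis unfolding assms(3) using gauge_nonzero by simp
qed

lemma G_sw: "1 \<le> i \<Longrightarrow> i < N \<Longrightarrow> G (sw i l) = G l"
  unfolding sw_def by (rule G_upd2) (auto simp: mult.commute)

lemma G_mv: "1 \<le> i \<Longrightarrow> i < N \<Longrightarrow> G (mv n i s l) = G l"
  unfolding mv_def using gauge_add[of "l i" "- s"] gauge_add[of "l (Suc i)" s] U_nonzero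
  by (intro G_upd2) (auto simp: power_int_minus)

section \<open>The \<open>T_i\<close> on the rescaled basis\<close>

definition gb :: "weight \<Rightarrow> tens" where
  "gb l = scale (G l) (bas l)"

lemma mv_eq: "mv n i s l = l(i := l i - int n * s, Suc i := l i + l (Suc i) - (l i - int n * s))"
  by (simp add: mv_def)

text \<open>\<open>G\<close> is constant along \<open>sw\<close> and \<open>mv\<close>, so the
  formulas for \<open>T_i\<close> carry over. The value \<open>c\<close> left at position
  \<open>i\<close> differs from \<open>l i\<close> by multiples of \<open>n\<close>: a descending
  pair starts with the multiple 1, an ascending pair with 0.\<close>

lemma T_gb:
  assumes "1 \<le> i" "i < N"
  shows "\<exists>c. unit c \<and> T i (gb l) - scale c (gb (sw i l)) \<in>
    rspan R {gb (l(i := c, Suc i := l i + l (Suc i) - c)) |c.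
      l (Suc i) < c \<and> c \<le> l i - int n \<or> l i \<le> c \<and> c < l (Suc i)}" (is "\<exists>c. unit c \<and> _ c \<in> rspan R ?S")
proof (cases "l (Suc i) < l i")
  case True
  let ?w = "if int n dvd l i - l (Suc i) then inverse v else 1"
  have "scale (- h) (gb (mv n i s l)) \<in> rspan R ?S" if s: "s \<in> {1..(l i - l (Suc i) - 1) div int n}" for s
  proof (rule rspan_base)
    have "int n * s \<le> int n * ((l i - l (Suc i) - 1) div int n)" using s by (intro mult_left_mono) auto
    also have "\<dots> \<le> l i - l (Suc i) - 1" by (rule mult_div_le')
    finally have "int n * s \<le> l i - l (Suc i) - 1" .
    moreover have "int n * 1 \<le> int n * s" using s by (intro mult_left_mono) auto
    ultimately show "gb (mv n i s l) \<in> ?S"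
      unfolding mv_eq by (intro CollectI exI[of _ "l i - int n * s"] conjI refl) linarith
  qed (rule h_R)
  then have "(\<Sum>s\<in>{1..(l i - l (Suc i) - 1) div int n}. scale (- h) (gb (mv n i s l))) \<in> rspan R ?S"
    by (rule rspan_sum)
  moreover have "T i (gb l) = scale ?w (gb (sw i l))
     + (\<Sum>s\<in>{1..(l i - l (Suc i) - 1) div int n}. scale (- h) (gb (mv n i s l)))"
    unfolding gb_def linop_scale[OF linop_T] Top_bas_gt[where l = l and i = i, OF n True]
    using assms by (simp add: G_sw G_mv tens.scale_right_diff_distrib tens.scale_sum_right sum_negf mult.commute del: minus_diff_eq)
  moreover have "unit ?w" using runit_1 runit_v[OF v] by auto
  ultimately show ?thesis by (intro exI[of _ ?w] conjI) (simp_all only: add_diff_cancel_left')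
next
  case False
  then have le: "l i \<le> l (Suc i)" by simp
  let ?w = "if int n dvd l i - l (Suc i) then v else 1"
  have "scale h (gb (mv n i s l)) \<in> rspan R ?S" if s: "s \<in> {- ((l (Suc i) - l i - 1) div int n)..0}" for s
  proof (rule rspan_base)
    have "int n * (- s) \<le> int n * ((l (Suc i) - l i - 1) div int n)" using s by (intro mult_left_mono) auto
    also have "\<dots> \<le> l (Suc i) - l i - 1" by (rule mult_div_le')
    finally have "int n * (- s) \<le> l (Suc i) - l i - 1" .
    moreover have "0 \<le> int n * (- s)" using s by (intro mult_nonneg_nonneg) auto
    ultimately show "gb (mv n i s l) \<in> ?S"
      unfolding mv_eq by (intro CollectI exI[of _ "l i - int n * s"] conjI refl) linarith
  qed (rule h_R)
  then have "(\<Sum>s\<in>{- ((l (Suc i) - l i - 1) div int n)..0}. scale h (gb (mv n i s l))) \<in> rspan R ?S"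
    by (rule rspan_sum)
  moreover have "T i (gb l) = scale ?w (gb (sw i l))
     + (\<Sum>s\<in>{- ((l (Suc i) - l i - 1) div int n)..0}. scale h (gb (mv n i s l)))"
    unfolding gb_def linop_scale[OF linop_T] Top_bas_le[where l = l and i = i, OF n le]
    using assms by (simp add: G_sw G_mv tens.scale_right_distrib tens.scale_sum_right mult.commute)
  moreover have "unit ?w" using runit_1 runit_v[OF v] by auto
  ultimately show ?thesis by (intro exI[of _ ?w] conjI) (simp_all only: add_diff_cancel_left')
qed

lemma sw_same: "l i = l (Suc i) \<Longrightarrow> sw i l = l"
  by (auto simp: sw_def)

text \<open>Subtracting \<open>h\<close> cancels the term \<open>c = l i\<close> on ascending pairs
  and creates it on descending ones, so the gap of width \<open>n\<close> changes sides.\<close>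

lemma Ti_gb:
  assumes "1 \<le> i" "i < N"
  shows "\<exists>c. unit c \<and> Ti i (gb l) - scale c (gb (sw i l)) \<in>
    rspan R {gb (l(i := c, Suc i := l i + l (Suc i) - c)) |c.
      l (Suc i) < c \<and> c \<le> l i \<or> l i + int n \<le> c \<and> c < l (Suc i)}" (is "\<exists>c. unit c \<and> _ c \<in> rspan R ?S")
proof -
  consider "l (Suc i) < l i" | "l i = l (Suc i)" | "l i < l (Suc i)" by linarith
  then show ?thesis
  proof cases
    case 1
    obtain c where c: "unit c" and r: "T i (gb l) - scale c (gb (sw i l)) \<in>
      rspan R {gb (l(i := c, Suc i := l i + l (Suc i) - c)) |c.
        l (Suc i) < c \<and> c \<le> l i - int n \<or> l i \<le> c \<and> c < l (Suc i)}"
      using T_gb[OF assms, of l] by blast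
    have "T i (gb l) - scale c (gb (sw i l)) \<in> rspan R ?S"
      by (rule rspan_mono[OF _ r], rule Collect_mono, rule impI, elim exE conjE, intro exI conjI, assumption)
        (use 1 n in linarith)
    moreover have "gb l \<in> ?S" using 1 by (intro CollectI exI[of _ "l i"]) simp
    then have "scale (- h) (gb l) \<in> rspan R ?S" by (rule rspan_base[OF _ h_R(2)])
    ultimately have "T i (gb l) - scale c (gb (sw i l)) + scale (- h) (gb l) \<in> rspan R ?S"
      by (rule rspan_add[rotated])
    moreover have "T i (gb l) - scale c (gb (sw i l)) + scale (- h) (gb l) = Ti i (gb l) - scale c (gb (sw i l))"
      by (simp add: Tinv_def algebra_simps del: minus_diff_eq)
    ultimately have "Ti i (gb l) - scale c (gb (sw i l)) \<in> rspan R ?S" by (simp only:)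
    with c show ?thesis by blast
  next
    case 2
    have "(- 1) div int n = - 1" using n by (simp add: div_eq_minus1)
    then have "T i (gb l) = scale v (gb l)"
      using Top_bas_le[where l = l and i = i, OF n, of v] 2
      by (simp add: gb_def linop_scale[OF linop_T] sw_same mult.commute)
    then have "Ti i (gb l) = scale (inverse v) (gb (sw i l))"
      using 2 by (simp add: Tinv_def sw_same flip: tens.scale_left_diff_distrib)
    then show ?thesis using runit_v(2)[OF v] by (intro exI[of _ "inverse v"]) (simp add: rspan.zero)
  next
    case 3
    then have le: "l i \<le> l (Suc i)" by simp
    let ?w = "if int n dvd l i - l (Suc i) then v else 1"
    let ?K = "(l (Suc i) - l i - 1) div int n"
    have K: "?K \<ge> 0" using 3 n by (simp add: pos_imp_zdiv_nonneg_iff)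
    have "scale h (gb (mv n i s l)) \<in> rspan R ?S" if s: "s \<in> {- ?K..- 1}" for s
    proof (rule rspan_base)
      have "int n * (- s) \<le> int n * ?K" using s by (intro mult_left_mono) auto
      also have "\<dots> \<le> l (Suc i) - l i - 1" by (rule mult_div_le')
      finally have "int n * (- s) \<le> l (Suc i) - l i - 1" .
      moreover have "int n * 1 \<le> int n * (- s)" using s by (intro mult_left_mono) auto
      ultimately show "gb (mv n i s l) \<in> ?S"
        unfolding mv_eq by (intro CollectI exI[of _ "l i - int n * s"] conjI refl) linarith
    qed (rule h_R)
    then have "(\<Sum>s\<in>{- ?K..- 1}. scale h (gb (mv n i s l))) \<in> rspan R ?S"
      by (rule rspan_sum)
    moreover have T: "T i (gb l) = scale ?w (gb (sw i l)) + (\<Sum>s\<in>{- ?K..0}. scale h (gb (mv n i s l)))"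
      unfolding gb_def linop_scale[OF linop_T] Top_bas_le[where l = l and i = i, OF n le]
      using assms by (simp add: G_sw G_mv tens.scale_right_distrib tens.scale_sum_right mult.commute)
    moreover have "{- ?K..0} = insert 0 {- ?K..- 1}" using K by auto
    then have "Ti i (gb l) - scale ?w (gb (sw i l)) = (\<Sum>s\<in>{- ?K..- 1}. scale h (gb (mv n i s l)))"
      unfolding Tinv_def T by simp
    ultimately have "Ti i (gb l) - scale ?w (gb (sw i l)) \<in> rspan R ?S" by (simp only:)
    moreover have "unit ?w" using runit_1 runit_v[OF v] by auto
    ultimately show ?thesis by blast
  qed
qed

text \<open>The traveller \<open>\<lambda>_1\<close>, shifted by \<open>x\<close>, after it has passed \<open>\<lambda>_2, \<dots>, \<lambda>_{p+1}\<close>.\<close>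

definition trav :: "nat \<Rightarrow> int \<Rightarrow> weight \<Rightarrow> weight" where
  "trav p x l = (\<lambda>k. if 1 \<le> k \<and> k \<le> p then l (Suc k) else if k = Suc p then l 1 + x else l k)"

text \<open>The power of \<open>U\<close> collects the constants of the letters: \<open>- m\<close>
  for each \<open>Y\<close> and \<open>m'\<close> for each \<open>X\<close>.\<close>

definition fam :: "int \<Rightarrow> (weight \<Rightarrow> weight) \<Rightarrow> weight \<Rightarrow> tens" where
  "fam e \<phi> l = scale (U powi e) (gb (\<phi> l))"

text \<open>The value \<open>c = l 1\<close> is the transposition of the two entries, which is lower
  only if \<open>l j < l 1\<close>; hence the bounds are not symmetric.\<close>

lemma low_trav:
  assumes "1 < j" "j \<le> N" "l 1 < c \<and> c < l j \<or> l j < c \<and> c \<le> l 1"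
  shows "low N (l(1 := l 1 + l j - c, j := c)) l"
  by (rule lowI[of 1 j]) (use assms in \<open>auto simp: abs_if\<close>)

lemma trav_upd:
  "(trav p x l)(Suc p := c, Suc (Suc p) := trav p x l (Suc p) + trav p x l (Suc (Suc p)) - c)
   = trav (Suc p) x (l(1 := l 1 + l (Suc (Suc p)) - c, Suc (Suc p) := c))"
  by (auto simp: trav_def fun_eq_iff)

lemma trav_sw: "sw (Suc p) (trav p x l) = trav (Suc p) x l"
  by (auto simp: trav_def sw_def fun_eq_iff)

text \<open>When the traveller of value \<open>a + x\<close> meets an entry \<open>b\<close>, every term other than the plain swap leaves
  some \<open>c\<close> behind; the condition on \<open>c\<close> is exactly what makes the resulting label lower.\<close>

lemma tri_sweep:
  assumes p: "Suc (Suc p) \<le> N" and F: "linop F"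
    and gb: "\<And>l. \<exists>c. unit c \<and> F (gb l) - scale c (gb (sw (Suc p) l)) \<in>
      rspan R {gb (l(Suc p := c, Suc (Suc p) := l (Suc p) + l (Suc (Suc p)) - c)) |c. J (l (Suc p)) (l (Suc (Suc p))) c}"
    and J: "\<And>a b c. J (a + x) b c \<Longrightarrow> a < c \<and> c < b \<or> b < c \<and> c \<le> a"
  shows "tri F (fam e (trav p x)) (fam e (trav (Suc p) x))"
  unfolding tri_def
proof
  fix l
  let ?l = "trav p x l" and ?j = "Suc (Suc p)"
  obtain c where c: "unit c" and r: "F (gb ?l) - scale c (gb (sw (Suc p) ?l)) \<in>
      rspan R {gb (?l(Suc p := c, ?j := ?l (Suc p) + ?l ?j - c)) |c. J (?l (Suc p)) (?l ?j) c}"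
    using gb[of ?l] by blast
  have "scale (U powi e) (F (gb ?l) - scale c (gb (sw (Suc p) ?l))) \<in> rspan R {fam e (trav (Suc p) x) mu |mu. blt N mu l}"
  proof (rule rspan_linop[OF r])
    show "linop (scale (U powi e))" using linop_scaleI[OF linop_id, of "U powi e"] by (simp add: id_def)
    fix s assume "s \<in> {gb (?l(Suc p := c, ?j := ?l (Suc p) + ?l ?j - c)) |c. J (?l (Suc p)) (?l ?j) c}"
    then obtain d where s: "s = gb (trav (Suc p) x (l(1 := l 1 + l ?j - d, ?j := d)))" and d: "J (?l (Suc p)) (?l ?j) d"
      unfolding trav_upd by blast
    have "l 1 < d \<and> d < l ?j \<or> l ?j < d \<and> d \<le> l 1"
      using d by (intro J) (simp add: trav_def)
    then have "low N (l(1 := l 1 + l ?j - d, ?j := d)) l"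
      using p by (intro low_trav) auto
    then have "fam e (trav (Suc p) x) (l(1 := l 1 + l ?j - d, ?j := d)) \<in> {fam e (trav (Suc p) x) mu |mu. blt N mu l}"
      by blast
    from rspan_base[OF this laurent_ring.one] show "scale (U powi e) s \<in> rspan R {fam e (trav (Suc p) x) mu |mu. blt N mu l}"
      unfolding s fam_def by simp
  qed
  then show "triv (fam e (trav (Suc p) x)) l (F (fam e (trav p x) l))"
    unfolding triv_def using c
    by (intro exI[of _ c]) (simp add: fam_def linop_scale[OF F] trav_sw tens.scale_right_diff_distrib mult.commute)
qed

text \<open>With offset 1 the bound \<open>a + 1 \<le> c\<close> becomes \<open>a < c\<close>, and
  \<open>c \<le> a + 1 - n\<close> gives \<open>c \<le> a\<close> because
  \<open>n \<ge> 1\<close>.\<close>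

lemma tri_T_trav: "Suc (Suc p) \<le> N \<Longrightarrow> tri (T (Suc p)) (fam e (trav p 1)) (fam e (trav (Suc p) 1))"
  by (rule tri_sweep[where J = "\<lambda>a b c. b < c \<and> c \<le> a - int n \<or> a \<le> c \<and> c < b", OF _ linop_T T_gb]) (use n in auto)

text \<open>\<open>x \<le> 0\<close> turns \<open>c \<le> a + x\<close> into
  \<open>c \<le> a\<close>, and \<open>- n < x\<close> turns \<open>a + x + n \<le> c\<close> into
  \<open>a < c\<close>: the window for the offset is exactly what the side terms of the inverse
  require.\<close>

lemma tri_Ti_trav:
  "Suc (Suc p) \<le> N \<Longrightarrow> - int n < x \<Longrightarrow> x \<le> 0 \<Longrightarrow> tri (Ti (Suc p)) (fam e (trav p x)) (fam e (trav (Suc p) x))"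
  by (rule tri_sweep[where J = "\<lambda>a b c. b < c \<and> c \<le> a \<or> a + int n \<le> c \<and> c < b", OF _ linop_Ti Ti_gb]) auto

lemma tri_T_sweep: "Suc p \<le> N \<Longrightarrow> tri (comps (map T (rev [1..<Suc p]))) (fam e (trav 0 1)) (fam e (trav p 1))"
proof (induction p)
  case (Suc p)
  have e: "comps (map T (rev [1..<Suc (Suc p)])) = T (Suc p) \<circ> comps (map T (rev [1..<Suc p]))" by simp
  show ?case unfolding e
    by (rule tri_comp[OF linop_T Suc.IH tri_T_trav]) (use Suc.prems in auto)
next
  case 0
  have e: "comps (map T (rev [1..<Suc 0])) = id" by simp
  show ?case unfolding e by (rule tri_id)
qed

lemma tri_S: "Suc p \<le> N \<Longrightarrow> - int n < x \<Longrightarrow> x \<le> 0 \<Longrightarrow> tri (S (Suc p)) (fam e (trav 0 x)) (fam e (trav p x))"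
proof (induction p)
  case (Suc p)
  have e: "S (Suc (Suc p)) = Ti (Suc p) \<circ> S (Suc p)" by (simp add: fun_eq_iff S_Suc)
  show ?case unfolding e
    by (rule tri_comp[OF linop_Ti Suc.IH tri_Ti_trav]) (use Suc.prems in auto)
next
  case 0
  have "S (Suc 0) = id" by (simp add: fun_eq_iff)
  then show ?case by (simp only: tri_id)
qed

lemma P_gb: "P (gb l) = scale (U powi int m' * q powi (l N div int n)) (gb (rotp n' N l))"
proof -
  obtain M where M: "N = Suc M" using N by (cases N) auto
  have "G (rotp n' N l) = gauge (l N - int n') * (\<Prod>k\<in>{1..M}. gauge (l k))"
  proof -
    have "G (rotp n' N l) = gauge (l N - int n') * (\<Prod>k\<in>{Suc 1..Suc M}. gauge (l (k - 1)))"
      unfolding G_def unfolding M by (subst prod.atLeast_Suc_atMost) (auto simp: rotp_def intro!: prod.cong)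
    also have "(\<Prod>k\<in>{Suc 1..Suc M}. gauge (l (k - 1))) = (\<Prod>k\<in>{1..M}. gauge (l k))"
      by (subst prod.shift_bounds_cl_Suc_ivl) simp
    finally show ?thesis .
  qed
  also have "\<dots> = U powi (- int m') * u (nat (l N mod int n)) * (gauge (l N) * (\<Prod>k\<in>{1..M}. gauge (l k)))"
    by (simp add: gauge_sub mult_ac)
  also have "gauge (l N) * (\<Prod>k\<in>{1..M}. gauge (l k)) = G l"
    unfolding G_def unfolding M by simp
  finally have "G l * pcoef n q u (l N) = U powi int m' * q powi (l N div int n) * G (rotp n' N l)"
    using U_nonzero by (simp add: pcoef_def power_int_minus)
  then show ?thesis
    by (simp add: gb_def linop_scale[OF linop_piop] piop_bas[OF N] mult_ac)
qed

lemma tri_P: "tri P (fam e (trav (N - 1) x)) (fam (e + int m') (trav 0 (x - int n')))"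
proof (rule tri_scale)
  fix l
  have "rotp n' N (trav (N - 1) x l) = trav 0 (x - int n') l"
    using N by (auto simp: fun_eq_iff rotp_def trav_def)
  then show "\<exists>c. unit c \<and> P (fam e (trav (N - 1) x) l) = scale c (fam (e + int m') (trav 0 (x - int n')) l)"
    using U_nonzero runit_q_powi[OF q]
    by (intro exI[of _ "q powi (trav (N - 1) x l N div int n)"])
      (simp add: fam_def linop_scale[OF linop_piop] P_gb power_int_add mult_ac)
qed

lemma tri_X: "- int n < x \<Longrightarrow> x \<le> 0 \<Longrightarrow> tri X (fam e (trav 0 x)) (fam (e + int m') (trav 0 (x - int n')))"
  unfolding X_def using N tri_comp[OF linop_piop tri_S[of "N - 1" x e] tri_P] by simp

lemma tri_Y: "tri Y (fam e (trav 0 x)) (fam (e - int m) (trav 0 (x + int n)))"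
proof (rule tri_scale)
  fix l
  let ?l = "trav 0 x l"
  have "G (?l(1 := ?l 1 + int n * 1)) * gauge (?l 1) = G ?l * (U powi (int m * 1) * gauge (?l 1))"
    unfolding gauge_add[symmetric] using N by (intro G_upd) simp
  then have "G (?l(1 := ?l 1 + int n)) = G ?l * U powi int m"
    using gauge_nonzero by simp
  moreover have "trav 0 (x + int n) l = ?l(1 := ?l 1 + int n)"
    by (auto simp: trav_def fun_eq_iff)
  ultimately have "Y (fam e (trav 0 x) l) = scale 1 (fam (e - int m) (trav 0 (x + int n)) l)"
    using U_nonzero by (simp add: fam_def gb_def power_int_diff)
  with runit_1 show "\<exists>c. unit c \<and> Y (fam e (trav 0 x) l) = scale c (fam (e - int m) (trav 0 (x + int n)) l)"
    by blast
qed

section \<open>The offset along the Christoffel word\<close>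

lemma Run_state: "Run k k' x y s a b f s' \<Longrightarrow> int s + int k * int b - int k' * int a = int s'"
  by (induction rule: Run.induct) (auto simp: algebra_simps of_nat_diff)

text \<open>\<open>f\<close> is a suffix of the word, hence the part that acts first; its
  \<open>a\<close> letters \<open>X\<close> and \<open>b\<close> letters \<open>Y\<close> have moved
  the offset to \<open>n b - n' a\<close>. Only a letter \<open>X\<close> puts a condition on this
  offset.\<close>

lemma tri_Run:
  assumes "Run m m' X Y s a b f s'" "s' = 0" "s < m + m'" "a \<le> m"
  shows "tri f (fam 0 (trav 0 0)) (fam (int m' * int a - int m * int b) (trav 0 (int n * int b - int n' * int a)))"
  using assms
proof (induction rule: Run.induct)
  case (Nil s)
  show ?case by (simp only: of_nat_0 mult_zero_right diff_self tri_id)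
next
  case (Y s a b f s')
  have e: "int m' * int a - int m * int b - int m = int m' * int a - int m * int (Suc b)"
    "int n * int b - int n' * int a + int n = int n * int (Suc b) - int n' * int a"
    by (simp_all add: algebra_simps)
  have "tri f (fam 0 (trav 0 0)) (fam (int m' * int a - int m * int b) (trav 0 (int n * int b - int n' * int a)))"
    using Y by auto
  from tri_comp[OF linop_Ymul this tri_Y] show ?case unfolding e .
next
  case (X s a b f s')
  let ?x = "int n * int b - int n' * int a"
  have e: "int m' * int a - int m * int b + int m' = int m' * int (Suc a) - int m * int b"
    "?x - int n' = int n * int b - int n' * int (Suc a)"
    by (simp_all add: algebra_simps)
  \<comment> \<open>With the determinant the state yields \<open>m x = a - n (s - m')\<close>. Since
    \<open>0 \<le> a < m\<close> and \<open>0 \<le> s - m' < m\<close> at a letter \<open>X\<close>,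
    this forces \<open>- n < x \<le> 0\<close>.\<close>
  have st: "int m * int b = int m' * int a - (int s - int m')"
    using Run_state[OF X.hyps(2)] X.hyps(1) X.prems(1) by (simp add: of_nat_diff)
  have "int m * ?x = int n * (int m * int b) - int n' * int m * int a" by (simp add: algebra_simps)
  also have "\<dots> = (int n * int m') * int a - int n * (int s - int m') - int n' * int m * int a"
    unfolding st by (simp add: algebra_simps)
  also have "\<dots> = int a - int n * (int s - int m')"
    unfolding det_int by (simp add: algebra_simps)
  finally have mx: "int m * ?x = int a - int n * (int s - int m')" .
  have a: "int a < int m" using X.prems(3) by simp
  have "0 \<le> int n * (int s - int m')" using X.hyps(1) by simp
  with mx a have "int m * ?x < int m * 1" by simp
  then have x0: "?x \<le> 0" using a by (simp only: mult_less_cancel_left_pos)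
  have "int n * (int s - int m') < int n * int m"
    using X.prems(2) n by (intro mult_strict_left_mono) auto
  with mx have "int m * (- int n) < int m * ?x" by (simp add: mult.commute)
  then have xn: "- int n < ?x" using a by (simp only: mult_less_cancel_left_pos)
  have "tri f (fam 0 (trav 0 0)) (fam (int m' * int a - int m * int b) (trav 0 ?x))"
    using X by auto
  from tri_comp[OF Aut_linop[OF Aut_X] this tri_X[OF xn x0]] show ?case unfolding e .
qed

lemma tri_Aw: "tri Aw gb (fam 0 (trav 0 1))"
proof -
  have "fam 0 (trav 0 0) = gb" by (auto simp: fam_def trav_def fun_eq_iff intro!: arg_cong[of _ _ gb])
  moreover have "int m' * int m - int m * int m' = 0" "int n * int m' - int n' * int m = 1"
    using det_int by simp_all
  ultimately show ?thesis using tri_Run[OF Run_Aw] m'_pos by simp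
qed

definition rho :: "tens \<Rightarrow> tens" where
  "rho = comps (map T (rev [1..<N])) \<circ> Aw"

lemma tri_rho: "tri rho gb (gb \<circ> rot N)"
proof -
  have "fam 0 (trav (N - 1) 1) = gb \<circ> rot N"
    using N by (auto simp: fam_def trav_def rot_def fun_eq_iff intro!: arg_cong[of _ _ gb])
  moreover have "linop (comps (map T (rev [1..<N])))"
    by (intro linop_comps) (auto intro: linop_T)
  ultimately show ?thesis
    unfolding rho_def using tri_comp[OF _ tri_Aw tri_T_sweep[of "N - 1" 0]] N by simp
qed

lemma Aut_rho: "Aut N rho"
  unfolding rho_def by (auto intro!: Aut_comp Aut_comps Aut_T Aut_Aw)

end

section \<open>The inverse rotation, and carrying one entry along\<close>

definition irot :: "nat \<Rightarrow> weight \<Rightarrow> weight" where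
  "irot N l = (\<lambda>k. if k = 1 then l N - 1 else if 2 \<le> k \<and> k \<le> N then l (k - 1) else l k)"

lemma rot_irot: "N \<ge> 1 \<Longrightarrow> rot N (irot N l) = l"
  by (auto simp: rot_def irot_def fun_eq_iff)

lemma low_irot:
  assumes "low N mu lam"
  shows "low N (irot N mu) (irot N lam)"
proof -
  from assms obtain p q where pq: "1 \<le> p" "p < q" "q \<le> N" "\<And>k. k \<noteq> p \<Longrightarrow> k \<noteq> q \<Longrightarrow> mu k = lam k"
    "mu p + mu q = lam p + lam q" "\<bar>2 * (mu p - mu q) + 1\<bar> < \<bar>2 * (lam p - lam q) + 1\<bar>"
    by (rule lowE) blast
  have r: "irot N l (Suc p) = l p" "irot N l 1 = l N - 1" for l using pq(1-3) by (auto simp: irot_def)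
  show ?thesis
  proof (cases "q = N")
    case True
    show ?thesis
    proof (rule lowI[of 1 "Suc p"])
      fix k assume k: "k \<noteq> 1" "k \<noteq> Suc p"
      then have "2 \<le> k \<Longrightarrow> k \<le> N \<Longrightarrow> k - 1 \<noteq> p \<and> k - 1 \<noteq> N" "\<not> (2 \<le> k \<and> k \<le> N) \<Longrightarrow> k \<noteq> p \<and> k \<noteq> N"
        using pq(1-3) True by auto
      then show "irot N mu k = irot N lam k"
        using k pq(4)[of "k - 1"] pq(4)[of k] True unfolding irot_def by auto
    next
      show "irot N mu 1 + irot N mu (Suc p) = irot N lam 1 + irot N lam (Suc p)"
        using pq(5) True unfolding r by simp
      show "\<bar>2 * (irot N mu 1 - irot N mu (Suc p)) + 1\<bar> < \<bar>2 * (irot N lam 1 - irot N lam (Suc p)) + 1\<bar>"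
        using pq(6) unfolding True r abs_if by (auto split: if_splits)
    qed (use pq(1-3) in auto)
  next
    case False
    have r': "irot N l (Suc q) = l q" for l using pq(1-3) False by (auto simp: irot_def)
    show ?thesis
    proof (rule lowI[of "Suc p" "Suc q"])
      fix k assume k: "k \<noteq> Suc p" "k \<noteq> Suc q"
      then have "2 \<le> k \<Longrightarrow> k \<le> N \<Longrightarrow> k - 1 \<noteq> p \<and> k - 1 \<noteq> q" "k \<noteq> 1 \<Longrightarrow> \<not> (2 \<le> k \<and> k \<le> N) \<Longrightarrow> k \<noteq> p \<and> k \<noteq> q"
          "N \<noteq> p" "N \<noteq> q"
        using pq(1-3) False by auto
      then show "irot N mu k = irot N lam k"
        using pq(4)[of "k - 1"] pq(4)[of k] pq(4)[of N] unfolding irot_def by auto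
    qed (use pq False r r' in auto)
  qed
qed

lemma blt_irot: "blt N mu lam \<Longrightarrow> blt N (irot N mu) (irot N lam)"
  by (induction rule: tranclp_induct) (auto intro: low_irot tranclp.trancl_into_trancl)

definition movl :: "nat \<Rightarrow> nat \<Rightarrow> weight \<Rightarrow> weight" where
  "movl p i l = (\<lambda>k. if k = p then l i else if p < k \<and> k \<le> i then l (k - 1) else l k)"

definition movr :: "nat \<Rightarrow> nat \<Rightarrow> weight \<Rightarrow> weight" where
  "movr p i l = (\<lambda>k. if k = i then l p else if p \<le> k \<and> k < i then l (Suc k) else l k)"

lemma movl_step: "p < i \<Longrightarrow> sw p (movl (Suc p) i l) = movl p i l"
  by (auto simp: movl_def sw_def fun_eq_iff)

lemma movr_step: "p \<le> i \<Longrightarrow> sw i (movr p i l) = movr p (Suc i) l"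
  by (auto simp: movr_def sw_def fun_eq_iff)

context daha
begin

lemma low_between:
  assumes "1 \<le> i" "i < N" "l i < l (Suc i)" "l i \<le> c" "c < l (Suc i)"
  shows "low N (l(i := c, Suc i := l i + l (Suc i) - c)) (sw i l)"
  by (rule lowI[of i "Suc i"]) (use assms in \<open>auto simp: abs_if\<close>)

lemma low_between_gt:
  assumes "1 \<le> i" "i < N" "l (Suc i) < c" "c < l i"
  shows "low N (l(i := c, Suc i := l i + l (Suc i) - c)) l"
  by (rule lowI[of i "Suc i"]) (use assms in \<open>auto simp: abs_if\<close>)

text \<open>The range of \<open>c\<close> covers the side terms of \<open>T_i\<close> and of its
  inverse alike, for either order of the pair.\<close>

lemma between_ble_mx:
  assumes i: "1 \<le> i" "i < N" and c: "l (Suc i) < c \<and> c \<le> l i \<or> l i \<le> c \<and> c < l (Suc i)"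
  shows "ble N (l(i := c, Suc i := l i + l (Suc i) - c)) (mx i l)"
proof (cases "l i < l (Suc i)")
  case True
  then show ?thesis using low_between[OF i True, of c] c by (auto simp: mx_def)
next
  case False
  show ?thesis
  proof (cases "c = l i")
    case True
    then show ?thesis using False by (simp add: mx_def)
  next
    case c': False
    then show ?thesis using low_between_gt[OF i, of l c] c False by (auto simp: mx_def)
  qed
qed

lemma sw_ble_mx: "1 \<le> i \<Longrightarrow> i < N \<Longrightarrow> ble N (sw i l) (mx i l)"
proof -
  assume i: "1 \<le> i" "i < N"
  consider "l i < l (Suc i)" | "l i = l (Suc i)" | "l (Suc i) < l i" by linarith
  then show ?thesis
  proof cases
    case 3
    have "low N (sw i l) (sw i (sw i l))" using i 3 by (intro low_sw_self) auto
    then show ?thesis using 3 by (auto simp: mx_def)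
  qed (simp_all add: mx_def sw_same)
qed

text \<open>On the leading term an ascending pair moves up and all side terms stay strictly below.
  Everything produced from a lower \<open>mu\<close> lies below \<open>mx i mu\<close>, which the
  lifting property \<open>blt_mx\<close> puts strictly below \<open>sw i l\<close>.\<close>

lemma triv_swap:
  assumes i: "1 \<le> i" "i < N" and F: "linop F"
    and gb: "\<And>l. \<exists>c. unit c \<and> F (gb l) - scale c (gb (sw i l)) \<in>
      rspan R {gb (l(i := c, Suc i := l i + l (Suc i) - c)) |c. J (l i) (l (Suc i)) c}"
    and J: "\<And>a b c. J a b c \<Longrightarrow> b < c \<and> c \<le> a \<or> a \<le> c \<and> c < b"
    and x: "triv gb l x" and le: "l i \<le> l (Suc i)"
  shows "triv gb (sw i l) (F x)"
proof (rule triv_linop[OF F x])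
  obtain c where c: "unit c" and r: "F (gb l) - scale c (gb (sw i l)) \<in>
      rspan R {gb (l(i := c, Suc i := l i + l (Suc i) - c)) |c. J (l i) (l (Suc i)) c}"
    using gb by blast
  have "{gb (l(i := c, Suc i := l i + l (Suc i) - c)) |c. J (l i) (l (Suc i)) c} \<subseteq> {gb mu |mu. blt N mu (sw i l)}"
  proof clarify
    fix d assume "J (l i) (l (Suc i)) d"
    from J[OF this] le have "l i < l (Suc i)" "l i \<le> d" "d < l (Suc i)" by auto
    from low_between[OF i this]
    show "\<exists>mu. gb (l(i := d, Suc i := l i + l (Suc i) - d)) = gb mu \<and> blt N mu (sw i l)"
      by blast
  qed
  from rspan_mono[OF this r] c show "triv gb (sw i l) (F (gb l))"
    unfolding triv_def by blast
next
  fix mu assume mu: "blt N mu l"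
  have b: "blt N nu (sw i l)" if "ble N nu (mx i mu)" for nu
    using that blt_mx[OF mu i(1) _ le] i(2) by (auto intro: rtranclp_tranclp_tranclp)
  obtain c where c: "unit c" and r: "F (gb mu) - scale c (gb (sw i mu)) \<in>
      rspan R {gb (mu(i := c, Suc i := mu i + mu (Suc i) - c)) |c. J (mu i) (mu (Suc i)) c}"
    using gb by blast
  have "{gb (mu(i := c, Suc i := mu i + mu (Suc i) - c)) |c. J (mu i) (mu (Suc i)) c} \<subseteq> {gb nu |nu. blt N nu (sw i l)}"
  proof clarify
    fix d assume "J (mu i) (mu (Suc i)) d"
    from b[OF between_ble_mx[OF i J[OF this]]]
    show "\<exists>nu. gb (mu(i := d, Suc i := mu i + mu (Suc i) - d)) = gb nu \<and> blt N nu (sw i l)"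
      by blast
  qed
  from rspan_mono[OF this r]
  have "F (gb mu) - scale c (gb (sw i mu)) \<in> rspan R {gb nu |nu. blt N nu (sw i l)}" .
  moreover have "scale c (gb (sw i mu)) \<in> rspan R {gb nu |nu. blt N nu (sw i l)}"
    using b[OF sw_ble_mx[OF i]] unit_R[OF c] by (intro rspan_base) blast+
  ultimately have "F (gb mu) - scale c (gb (sw i mu)) + scale c (gb (sw i mu)) \<in> rspan R {gb nu |nu. blt N nu (sw i l)}"
    by (rule rspan_add[rotated])
  then show "F (gb mu) \<in> rspan R {gb nu |nu. blt N nu (sw i l)}" by (simp only: diff_add_cancel)
qed

definition swaps :: "(nat \<Rightarrow> tens \<Rightarrow> tens) \<Rightarrow> bool" where
  "swaps F \<longleftrightarrow> (\<forall>i l x. 1 \<le> i \<longrightarrow> i < N \<longrightarrow> l i \<le> l (Suc i) \<longrightarrow> triv gb l x \<longrightarrow> triv gb (sw i l) (F i x))"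

lemma swaps_T: "swaps T"
  unfolding swaps_def
proof (intro allI impI)
  fix i l x assume "1 \<le> i" "i < N" "l i \<le> l (Suc i)" "triv gb l x"
  then show "triv gb (sw i l) (T i x)"
    by (intro triv_swap[where J = "\<lambda>a b c. b < c \<and> c \<le> a - int n \<or> a \<le> c \<and> c < b", OF _ _ linop_T T_gb]) auto
qed

lemma swaps_Ti: "swaps Ti"
  unfolding swaps_def
proof (intro allI impI)
  fix i l x assume "1 \<le> i" "i < N" "l i \<le> l (Suc i)" "triv gb l x"
  then show "triv gb (sw i l) (Ti i x)"
    by (intro triv_swap[where J = "\<lambda>a b c. b < c \<and> c \<le> a \<or> a + int n \<le> c \<and> c < b", OF _ _ linop_Ti Ti_gb]) auto
qed

lemma triv_movl:
  assumes "swaps F" "1 \<le> p" "p \<le> i" "i \<le> N" "triv gb l x"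
    "\<And>j. p \<le> j \<Longrightarrow> j < i \<Longrightarrow> l j \<le> l i"
  shows "triv gb (movl p i l) (comps (map F [p..<i]) x)"
  using assms(3,2,6)
proof (induction p rule: inc_induct)
  case base
  have "movl i i l = l" by (auto simp: movl_def)
  then show ?case using assms(5) by simp
next
  case (step p)
  have IH: "triv gb (movl (Suc p) i l) (comps (map F [Suc p..<i]) x)"
    using step by auto
  have "movl (Suc p) i l p \<le> movl (Suc p) i l (Suc p)"
    using step by (auto simp: movl_def)
  with IH have "triv gb (sw p (movl (Suc p) i l)) (F p (comps (map F [Suc p..<i]) x))"
    using assms(1,4) step by (auto simp: swaps_def)
  then show ?case using step.hyps by (simp add: movl_step upt_conv_Cons)
qed

lemma triv_movr:
  assumes "swaps F" "1 \<le> p" "p \<le> i" "i \<le> N" "triv gb l x"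
    "\<And>j. p < j \<Longrightarrow> j \<le> i \<Longrightarrow> l p \<le> l j"
  shows "triv gb (movr p i l) (comps (map F (rev [p..<i])) x)"
  using assms(3,4,6)
proof (induction i rule: dec_induct)
  case base
  have "movr p p l = l" by (auto simp: movr_def)
  then show ?case using assms(5) by simp
next
  case (step i)
  have IH: "triv gb (movr p i l) (comps (map F (rev [p..<i])) x)"
    using step by auto
  have "movr p i l i \<le> movr p i l (Suc i)"
    using step by (auto simp: movr_def)
  with IH have "triv gb (sw i (movr p i l)) (F i (comps (map F (rev [p..<i])) x))"
    using assms(1,2) step by (auto simp: swaps_def)
  then show ?case using step.hyps by (simp add: movr_step)
qed

lemma triv_rho:
  assumes "triv gb l x"
  shows "triv gb (rot N l) (rho x)"
proof -
  have "triv (gb \<circ> rot N) l (rho x)"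
    by (rule tri_triv[OF Aut_linop[OF Aut_rho] tri_rho assms])
  then obtain c y where c: "unit c" and y: "y \<in> rspan R {(gb \<circ> rot N) mu |mu. blt N mu l}"
    and e: "rho x = scale c ((gb \<circ> rot N) l) + y" by (rule trivE)
  have "{(gb \<circ> rot N) mu |mu. blt N mu l} \<subseteq> {gb mu |mu. blt N mu (rot N l)}"
    using blt_rot by auto
  from trivI[OF c rspan_mono[OF this y]] e show ?thesis by simp
qed

lemma triv_inv_rho:
  assumes "triv gb l x"
  shows "triv gb (irot N l) (inv rho x)"
proof -
  obtain c y where c: "unit c" and y: "y \<in> rspan R {gb mu |mu. blt N mu l}"
    and e: "x = scale c (gb l) + y" using assms by (rule trivE)
  have "{gb mu |mu. blt N mu l} \<subseteq> {(gb \<circ> rot N) mu |mu. blt N mu (irot N l)}"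
    using blt_irot rot_irot[OF N] by (auto, metis)
  then have "triv (gb \<circ> rot N) (irot N l) x"
    by (intro trivI[OF c rspan_mono[OF _ y]]) (simp_all add: e rot_irot[OF N])
  then show ?thesis
    by (rule tri_triv[OF Aut_linop[OF Aut_inv[OF Aut_rho]] tri_inv[OF Aut_linop[OF Aut_rho] Aut_bij[OF Aut_rho] tri_rho]])
qed

lemma T_Ti_cancel: "comps (map T (rev xs)) (comps (map Ti xs) z) = z"
  "comps (map Ti xs) (comps (map T (rev xs)) z) = z"
  "comps (map T xs) (comps (map Ti (rev xs)) z) = z"
  "comps (map Ti (rev xs)) (comps (map T xs) z) = z"
  using comps_cancel[of "rev xs" T Ti z] comps_cancel[of xs Ti T z] comps_cancel[of xs T Ti z] comps_cancel[of "rev xs" Ti T z]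
  by simp_all

text \<open>The factors \<open>T_i, ..., T_{N-1}\<close> that complete the sweep inside
  \<open>rho\<close> are undone on the left.\<close>

lemma Jm_rho:
  assumes "1 \<le> i" "i \<le> N"
  shows "Jm i z = comps (map Ti [i..<N]) (rho (comps (map T [1..<i]) z))"
proof -
  let ?y = "Aw (comps (map T [1..<i]) z)"
  have "[1..<N] = [1..<i] @ [i..<N]" using assms upt_add_eq_append[of 1 i "N - i"] by simp
  then have "comps (map Ti [i..<N]) (comps (map T (rev [1..<N])) ?y)
      = comps (map T (rev [1..<i])) ?y"
    by (simp add: T_Ti_cancel)
  then show ?thesis by (simp add: Jm_def rho_def)
qed

lemma inv_Jm:
  assumes "1 \<le> i" "i \<le> N"
  shows "inv (Jm i) z = comps (map Ti (rev [1..<i])) (inv rho (comps (map T (rev [i..<N])) z))"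
proof -
  have "Jm i (comps (map Ti (rev [1..<i])) (inv rho (comps (map T (rev [i..<N])) z))) = z"
    by (simp only: Jm_rho[OF assms] T_Ti_cancel Aut_inv_f[OF Aut_rho])
  then show ?thesis using Aut_inv_f(2)[OF Aut_Jm[OF assms]] by metis
qed

text \<open>The entry \<open>l i\<close> is carried to the front, rotated to the end while gaining
  1, and carried back to position \<open>i\<close>. The two hypotheses say that every exchange on
  the way meets a weakly ascending pair.\<close>

lemma triv_Jm:
  assumes i: "1 \<le> i" "i \<le> N" and x: "triv gb l x"
    and le: "\<And>j. 1 \<le> j \<Longrightarrow> j < i \<Longrightarrow> l j \<le> l i" and gt: "\<And>j. i < j \<Longrightarrow> j \<le> N \<Longrightarrow> l j \<le> l i + 1"
  shows "triv gb (l(i := l i + 1)) (Jm i x)"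
proof -
  let ?l1 = "movl 1 i l" let ?l2 = "rot N ?l1"
  have l2: "?l2 k = (if k < i then l k else if k = N then l i + 1 else if k < N then l (Suc k) else l k)" for k
    using i by (auto simp: rot_def movl_def)
  have 2: "triv gb ?l2 (rho (comps (map T [1..<i]) x))"
    using i x le by (intro triv_rho triv_movl[OF swaps_T]) auto
  have "?l2 j \<le> ?l2 N" if "i \<le> j" "j < N" for j
    unfolding l2 using that gt[of "Suc j"] i by simp
  then have "triv gb (movl i N ?l2) (Jm i x)"
    unfolding Jm_rho[OF i] using i by (intro triv_movl[OF swaps_Ti _ _ _ 2]) auto
  moreover have "movl i N ?l2 = l(i := l i + 1)"
    unfolding movl_def[of i N] l2 using i by (auto simp: fun_eq_iff)
  ultimately show ?thesis by simp
qed

text \<open>The reverse journey: to the end, rotated to the front while losing 1, and back. The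
  operators are again \<open>T\<close> on the first leg and inverses on the second, now in the
  opposite direction.\<close>

lemma triv_inv_Jm:
  assumes i: "1 \<le> i" "i \<le> N" and x: "triv gb l x"
    and le: "\<And>j. 1 \<le> j \<Longrightarrow> j < i \<Longrightarrow> l i - 1 \<le> l j" and gt: "\<And>j. i < j \<Longrightarrow> j \<le> N \<Longrightarrow> l i \<le> l j"
  shows "triv gb (l(i := l i - 1)) (inv (Jm i) x)"
proof -
  let ?l1 = "movr i N l" let ?l2 = "irot N ?l1"
  have l2: "?l2 k = (if k = 1 then l i - 1 else if 1 < k \<and> k \<le> i then l (k - 1) else l k)" for k
    using i by (auto simp: irot_def movr_def)
  have 2: "triv gb ?l2 (inv rho (comps (map T (rev [i..<N])) x))"
    using i x gt by (intro triv_inv_rho triv_movr[OF swaps_T]) auto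
  have "?l2 1 \<le> ?l2 j" if "1 < j" "j \<le> i" for j
    unfolding l2 using that le[of "j - 1"] by simp
  then have "triv gb (movr 1 i ?l2) (inv (Jm i) x)"
    unfolding inv_Jm[OF i] using i by (intro triv_movr[OF swaps_Ti _ _ _ 2]) auto
  moreover have "movr 1 i ?l2 = l(i := l i - 1)"
    unfolding movr_def[of 1 i] l2 using i by (auto simp: fun_eq_iff)
  ultimately show ?thesis by simp
qed

text \<open>Induction on the sum of the absolute values of the entries: an extremal entry of the
  right sign is moved one step towards 0.\<close>

lemma triv_Avec:
  assumes "lam \<in> wts N"
  shows "triv gb lam (scale (G (\<lambda>_. 0)) (Av lam))"
  using assms
proof (induction "\<Sum>i\<in>{1..N}. nat \<bar>lam i\<bar>" arbitrary: lam rule: less_induct)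
  case less
  let ?x = "\<lambda>l. scale (G (\<lambda>_. 0)) (Av l)"
  have ne: "lam ` {1..N} \<noteq> {}" using N by auto
  have decrease: "(\<Sum>j\<in>{1..N}. nat \<bar>(lam(i := c)) j\<bar>) < (\<Sum>j\<in>{1..N}. nat \<bar>lam j\<bar>)"
    if "i \<in> {1..N}" "\<bar>c\<bar> < \<bar>lam i\<bar>" for i c
    by (rule sum_strict_mono_ex1) (use that in auto)
  define b where "b = Max (lam ` {1..N})"
  define d where "d = Min (lam ` {1..N})"
  have b: "lam j \<le> b" and d: "d \<le> lam j" if "j \<in> {1..N}" for j
    using that by (auto simp: b_def d_def)
  consider "b \<ge> 1" | "d \<le> - 1" | "b \<le> 0" "d \<ge> 0" by linarith
  then show ?case
  proof cases
    case 1
    define I where "I = {i \<in> {1..N}. lam i = b}"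
    define i where "i = Min I"
    have "b \<in> lam ` {1..N}" unfolding b_def using ne by (intro Max_in) auto
    then have I: "finite I" "I \<noteq> {}" by (auto simp: I_def)
    then have "i \<in> I" unfolding i_def by (rule Min_in)
    then have i: "i \<in> {1..N}" "lam i = b" by (auto simp: I_def)
    \<comment> \<open>Strictness is gained by taking the first maximal entry: once it is lowered to
      \<open>b - 1\<close>, earlier entries must not exceed it, while later ones may equal
      \<open>b\<close>.\<close>
    have lt: "lam j < b" if "j \<in> {1..N}" "j < i" for j
    proof -
      have "j \<notin> I" using that(2) Min_le[OF I(1), of j] by (fastforce simp: i_def)
      then show ?thesis using b[OF that(1)] that(1) by (auto simp: I_def)
    qed
    let ?k = "lam(i := lam i - 1)"
    have "?k \<in> wts N" using less.prems i by (auto simp: wts_def)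
    moreover have "(\<Sum>j\<in>{1..N}. nat \<bar>?k j\<bar>) < (\<Sum>j\<in>{1..N}. nat \<bar>lam j\<bar>)"
      using i 1 by (intro decrease) auto
    ultimately have "triv gb ?k (?x ?k)" using less.hyps by blast
    then have "triv gb (?k(i := ?k i + 1)) (Jm i (?x ?k))"
    proof (rule triv_Jm[rotated 2])
      show "?k j \<le> ?k i" if "1 \<le> j" "j < i" for j using that lt[of j] i by auto
      show "?k j \<le> ?k i + 1" if "i < j" "j \<le> N" for j using that b[of j] i by auto
    qed (use i in auto)
    moreover have "?k(i := ?k i + 1) = lam" by auto
    moreover have "Jm i (?x ?k) = ?x (?k(i := ?k i + 1))"
      using Avec_Suc[OF i(1), of ?k] Aut_linop[OF Aut_Jm, of i] i(1) by (simp only: linop_scale atLeastAtMost_iff)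
    ultimately show ?thesis by (simp only:)
  next
    case 2
    define I where "I = {i \<in> {1..N}. lam i = d}"
    define i where "i = Max I"
    have "d \<in> lam ` {1..N}" unfolding d_def using ne by (intro Min_in) auto
    then have I: "finite I" "I \<noteq> {}" by (auto simp: I_def)
    then have "i \<in> I" unfolding i_def by (rule Max_in)
    then have i: "i \<in> {1..N}" "lam i = d" by (auto simp: I_def)
    \<comment> \<open>Mirror image: later entries must be at least \<open>d + 1\<close>, while
      earlier ones may equal \<open>d\<close>.\<close>
    have gt: "d < lam j" if "j \<in> {1..N}" "i < j" for j
    proof -
      have "j \<notin> I" using that(2) Max_ge[OF I(1), of j] by (fastforce simp: i_def)
      then show ?thesis using d[OF that(1)] that(1) by (auto simp: I_def)
    qed
    let ?k = "lam(i := lam i + 1)"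
    have "?k \<in> wts N" using less.prems i by (auto simp: wts_def)
    moreover have "(\<Sum>j\<in>{1..N}. nat \<bar>?k j\<bar>) < (\<Sum>j\<in>{1..N}. nat \<bar>lam j\<bar>)"
      using i 2 by (intro decrease) auto
    ultimately have "triv gb ?k (?x ?k)" using less.hyps by blast
    then have "triv gb (?k(i := ?k i - 1)) (inv (Jm i) (?x ?k))"
    proof (rule triv_inv_Jm[rotated 2])
      show "?k i - 1 \<le> ?k j" if "1 \<le> j" "j < i" for j using that d[of j] i by auto
      show "?k i \<le> ?k j" if "i < j" "j \<le> N" for j using that gt[of j] i by auto
    qed (use i in auto)
    moreover have "?k(i := ?k i - 1) = lam" by auto
    moreover have "?x ?k = Jm i (?x lam)"
      using Avec_Suc[OF i(1), of lam] Aut_linop[OF Aut_Jm, of i] i(1) by (simp only: linop_scale atLeastAtMost_iff)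
    then have "inv (Jm i) (?x ?k) = ?x lam"
      using Aut_inv_f(2)[OF Aut_Jm, of i] i(1) by (simp only: atLeastAtMost_iff)
    ultimately show ?thesis by (simp only:)
  next
    case 3
    have "lam j = 0" for j
      using 3 b[of j] d[of j] less.prems by (cases "j \<in> {1..N}") (auto simp: wts_def)
    then have "lam = (\<lambda>_. 0)" by auto
    then show ?thesis using triv_self[of gb "\<lambda>_. 0"] by (simp add: Avec_0 gb_def)
  qed
qed

end

section \<open>Expansion of \<open>A_\<lambda>\<close>\<close>

lemma powi_sum:
  fixes x :: complex
  assumes "x \<noteq> 0"
  shows "x powi (\<Sum>i\<in>A. f i) = (\<Prod>i\<in>A. x powi f i)"
  using assms by (induction A rule: infinite_finite_induct) (auto simp: power_int_add)

context daha
begin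

lemma lookup_gb: "Poly_Mapping.lookup (gb l) k = (if k = l then G l else 0)"
  by (simp add: gb_def bas_def lookup_single when_def)

lemma rspan_lookup:
  assumes "y \<in> rspan R {gb mu |mu. blt N mu lam}"
  shows "\<exists>r\<in>R. Poly_Mapping.lookup y k = G k * r" "Poly_Mapping.lookup y k \<noteq> 0 \<Longrightarrow> blt N k lam"
proof -
  have "(\<exists>r\<in>R. Poly_Mapping.lookup y k = G k * r) \<and> (Poly_Mapping.lookup y k \<noteq> 0 \<longrightarrow> blt N k lam)"
    using assms
  proof induction
    case zero
    then show ?case using laurent_zero[of q v] by (auto intro!: bexI[of _ 0])
  next
    case (step x s c)
    from step.IH obtain r where r: "r \<in> R" "Poly_Mapping.lookup x k = G k * r" by blast
    from step.hyps obtain mu where mu: "s = gb mu" "blt N mu lam" by blast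
    show ?case
    proof (cases "k = mu")
      case True
      have "Poly_Mapping.lookup (x + scale c s) k = G k * (r + c)"
        using r mu(1) True by (simp add: lookup_add lookup_gb algebra_simps)
      then show ?thesis using mu(2) True laurent_add[OF r(1) step.hyps(3)] by blast
    next
      case False
      then have "Poly_Mapping.lookup (x + scale c s) k = Poly_Mapping.lookup x k"
        using mu(1) by (simp add: lookup_add lookup_gb)
      then show ?thesis using step.IH by simp
    qed
  qed
  then show "\<exists>r\<in>R. Poly_Mapping.lookup y k = G k * r" "Poly_Mapping.lookup y k \<noteq> 0 \<Longrightarrow> blt N k lam"
    by blast+
qed

text \<open>The coefficient of \<open>A_\<lambda>\<close> with its monomial in the
  \<open>u_a\<close> stripped off, that is, the coefficient with respect to the basis rescaled by
  \<open>G mu / G 0\<close>.\<close>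

definition alpha :: "weight \<Rightarrow> weight \<Rightarrow> complex" where
  "alpha lam mu = G (\<lambda>_. 0) * Poly_Mapping.lookup (Av lam) mu / G mu"

lemma alpha_Avec:
  assumes "lam \<in> wts N"
  shows "alpha lam mu \<in> R" "unit (alpha lam lam)" "alpha lam mu \<noteq> 0 \<Longrightarrow> mu = lam \<or> blt N mu lam"
proof -
  obtain c y where c: "unit c" and y: "y \<in> rspan R {gb mu |mu. blt N mu lam}"
    and e: "scale (G (\<lambda>_. 0)) (Av lam) = scale c (gb lam) + y"
    using triv_Avec[OF assms] by (rule trivE)
  have l: "G (\<lambda>_. 0) * Poly_Mapping.lookup (Av lam) k = c * (if k = lam then G lam else 0) + Poly_Mapping.lookup y k" for k
    using arg_cong[OF e, of "\<lambda>z. Poly_Mapping.lookup z k"] by (simp add: lookup_add lookup_gb)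
  have y0: "Poly_Mapping.lookup y lam = 0" using rspan_lookup(2)[OF y, of lam] blt_irrefl by blast
  have al: "alpha lam lam = c" by (simp add: alpha_def l y0 G_nonzero)
  then show "unit (alpha lam lam)" using c by simp
  show "alpha lam mu \<noteq> 0 \<Longrightarrow> mu = lam \<or> blt N mu lam"
    using rspan_lookup(2)[OF y, of mu] by (cases "mu = lam") (auto simp: alpha_def l)
  obtain r where "r \<in> R" "Poly_Mapping.lookup y mu = G mu * r" using rspan_lookup(1)[OF y] by blast
  then show "alpha lam mu \<in> R"
    using al unit_R[OF c] by (cases "mu = lam") (auto simp: alpha_def[of lam mu] l G_nonzero)
qed

lemma lookup_Avec: "Poly_Mapping.lookup (Av lam) mu = G mu / G (\<lambda>_. 0) * alpha lam mu"
  by (simp add: alpha_def G_nonzero)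

lemma unit_nonzero: "unit c \<Longrightarrow> c \<noteq> 0"
  by (auto simp: runit_def)

lemma lookup_Avec_self: "lam \<in> wts N \<Longrightarrow> Poly_Mapping.lookup (Av lam) lam \<noteq> 0"
  using unit_nonzero[OF alpha_Avec(2)] by (simp add: lookup_Avec G_nonzero)

lemma lookup_Avec_blt:
  "lam \<in> wts N \<Longrightarrow> Poly_Mapping.lookup (Av lam) mu \<noteq> 0 \<Longrightarrow> mu = lam \<or> blt N mu lam"
  using alpha_Avec(3)[of lam mu] by (simp add: lookup_Avec)

lemma lookup_Avec_eq_0:
  assumes "lam \<in> wts N" "mu \<noteq> lam" "qnorm N lam \<le> qnorm N mu"
  shows "Poly_Mapping.lookup (Av lam) mu = 0"
  using lookup_Avec_blt[OF assms(1), of mu] assms(2,3) by (metis blt_qnorm not_less)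

lemma inj_Avec: "inj_on Av (wts N)"
proof (rule inj_onI, rule ccontr)
  fix x y assume xy: "x \<in> wts N" "y \<in> wts N" "Av x = Av y" "x \<noteq> y"
  then show False
    using lookup_Avec_self[of x] lookup_Avec_self[of y] lookup_Avec_eq_0[of x y] lookup_Avec_eq_0[of y x]
    by (metis nat_le_linear)
qed

lemma independent_Avec: "\<not> tens.dependent (Av ` wts N)"
proof
  assume "tens.dependent (Av ` wts N)"
  then obtain t c where t: "finite t" "t \<subseteq> Av ` wts N" "(\<Sum>x\<in>t. scale (c x) x) = 0" "\<exists>x\<in>t. c x \<noteq> 0"
    unfolding tens.dependent_explicit by blast
  define S where "S = {l \<in> wts N. Av l \<in> t \<and> c (Av l) \<noteq> 0}"
  have "finite (Av ` S)" by (rule finite_subset[OF _ t(1)]) (auto simp: S_def)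
  then have fin: "finite S"
    by (rule finite_imageD) (rule inj_on_subset[OF inj_Avec], auto simp: S_def)
  have ne: "S \<noteq> {}" using t(2,4) by (auto simp: S_def)
  \<comment> \<open>A label of maximal \<open>qnorm\<close> among the vectors with nonzero
    coefficient; \<open>e_l\<close> occurs in no other of them.\<close>
  define l where "l = arg_min_on (\<lambda>l. - int (qnorm N l)) S"
  have l: "l \<in> S" and ge: "\<And>k. k \<in> S \<Longrightarrow> qnorm N k \<le> qnorm N l"
    unfolding l_def using arg_min_if_finite(1)[OF fin ne, of "\<lambda>l. - int (qnorm N l)"]
      arg_min_least[OF fin ne, of _ "\<lambda>l. - int (qnorm N l)"] by auto
  have total: "(\<Sum>x\<in>t. c x * Poly_Mapping.lookup x l) = 0"
    using arg_cong[OF t(3), of "\<lambda>z. Poly_Mapping.lookup z l"] by (simp add: lookup_sum)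
  have z: "c x * Poly_Mapping.lookup x l = 0" if x: "x \<in> t - {Av l}" for x
  proof -
    obtain k where k: "k \<in> wts N" "x = Av k" using subsetD[OF t(2), of x] x by blast
    show ?thesis
    proof (cases "c x = 0")
      case False
      then have "k \<in> S" using k x by (simp add: S_def)
      then show ?thesis using k x lookup_Avec_eq_0[of k l] ge by auto
    qed simp
  qed
  have rest: "(\<Sum>x\<in>t - {Av l}. c x * Poly_Mapping.lookup x l) = 0"
    by (rule sum.neutral) (use z in blast)
  have "c (Av l) * Poly_Mapping.lookup (Av l) l = 0"
    using sum.remove[of t "Av l" "\<lambda>x. c x * Poly_Mapping.lookup x l"] t(1) l total rest by (simp add: S_def)
  then show False using l lookup_Avec_self[of l] by (simp add: S_def)
qed

lemma span_Avec: "tens.span (Av ` wts N) = tpow N"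
proof
  show "tens.span (Av ` wts N) \<subseteq> tpow N"
    by (rule tens.span_minimal) (auto simp: Avec_tpow tpow_subspace)
  have bas: "bas l \<in> tens.span (Av ` wts N)" if "l \<in> wts N" for l
    using that
  proof (induction "qnorm N l" arbitrary: l rule: less_induct)
    case less
    let ?K = "Poly_Mapping.keys (Av l)" and ?c = "Poly_Mapping.lookup (Av l)"
    have c: "?c l \<noteq> 0" by (rule lookup_Avec_self[OF less.prems])
    have sum: "Av l = scale (?c l) (bas l) + (\<Sum>k\<in>?K - {l}. scale (?c k) (bas k))"
    proof -
      have "Av l = (\<Sum>k\<in>?K. scale (?c k) (bas k))" using lin_bas_id[of "Av l"] by (simp add: lin_def)
      also have "\<dots> = scale (?c l) (bas l) + (\<Sum>k\<in>?K - {l}. scale (?c k) (bas k))"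
        by (rule sum.remove) (use c in \<open>auto simp: in_keys_iff\<close>)
      finally show ?thesis .
    qed
    have "(\<Sum>k\<in>?K - {l}. scale (?c k) (bas k)) \<in> tens.span (Av ` wts N)"
    proof (intro tens.span_sum tens.span_scale)
      fix k assume "k \<in> ?K - {l}"
      then have k: "blt N k l" using lookup_Avec_blt[OF less.prems, of k] by (auto simp: in_keys_iff)
      then have "k \<in> wts N" using ble_wts[OF tranclp_into_rtranclp] less.prems by blast
      with less.hyps blt_qnorm[OF k] show "bas k \<in> tens.span (Av ` wts N)" by blast
    qed
    moreover have "Av l \<in> tens.span (Av ` wts N)" using less.prems by (intro tens.span_base) simp
    ultimately have "scale (inverse (?c l)) (Av l - (\<Sum>k\<in>?K - {l}. scale (?c k) (bas k))) \<in> tens.span (Av ` wts N)"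
      by (intro tens.span_scale tens.span_diff)
    also have "Av l - (\<Sum>k\<in>?K - {l}. scale (?c k) (bas k)) = scale (?c l) (bas l)"
      unfolding diff_eq_eq by (rule sum)
    also have "scale (inverse (?c l)) (scale (?c l) (bas l)) = bas l" using c by simp
    finally show ?case .
  qed
  show "tpow N \<subseteq> tens.span (Av ` wts N)"
  proof
    fix x assume x: "x \<in> tpow N"
    have "lin bas x \<in> tens.span (Av ` wts N)"
      unfolding lin_def using x by (intro tens.span_sum tens.span_scale bas) (auto simp: tpow_def)
    then show "x \<in> tens.span (Av ` wts N)" by (simp add: lin_bas_id)
  qed
qed

text \<open>The exponent of \<open>u a\<close> in \<open>G mu / G 0\<close>. It depends on
  \<open>mu\<close> alone, so one family of exponents serves all \<open>A_\<lambda>\<close>.\<close>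

definition kexp :: "weight \<Rightarrow> nat \<Rightarrow> int" where
  "kexp mu a = (\<Sum>i\<in>{1..N}. gexp a (mu i)) - (\<Sum>i\<in>{1..N}. gexp a 0)"

lemma umono_kexp: "umono n u (kexp mu) = G mu / G (\<lambda>_. 0)"
proof -
  have e: "(\<Prod>a<n. u a powi (\<Sum>i\<in>{1..N}. gexp a (l i))) = G l" for l
  proof -
    have "(\<Prod>a<n. u a powi (\<Sum>i\<in>{1..N}. gexp a (l i))) = (\<Prod>a<n. \<Prod>i\<in>{1..N}. u a powi gexp a (l i))"
      by (rule prod.cong) (use u in \<open>auto simp: powi_sum\<close>)
    also have "\<dots> = G l" unfolding G_def gauge_def by (rule prod.swap)
    finally show ?thesis .
  qed
  have "umono n u (kexp mu) = (\<Prod>a<n. u a powi (\<Sum>i\<in>{1..N}. gexp a (mu i)) / u a powi (\<Sum>i\<in>{1..N}. gexp a 0))"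
    unfolding umono_def kexp_def by (intro prod.cong refl power_int_diff) (use u in auto)
  then show ?thesis using e[of mu] e[of "\<lambda>_. 0"] by (simp only: prod_dividef)
qed

text \<open>The support given by \<open>blt\<close> is contained in the range of
  \<open>prec\<close>; the additional weights in that range have coefficient 0.\<close>

lemma Avec_expansion:
  assumes lam: "lam \<in> wts N"
  shows "Av lam = scale (umono n u (kexp lam) * alpha lam lam) (bas lam)
    + (\<Sum>mu\<in>{mu\<in>wts N. prec N mu lam}. scale (umono n u (kexp mu) * alpha lam mu) (bas mu))"
proof (rule poly_mapping_eqI)
  fix k
  let ?S = "{mu\<in>wts N. prec N mu lam}"
  have fin: "finite ?S" by (rule finite_prec[OF N])
  have "Poly_Mapping.lookup (\<Sum>mu\<in>?S. scale (umono n u (kexp mu) * alpha lam mu) (bas mu)) k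
      = (\<Sum>mu\<in>?S. if mu = k then Poly_Mapping.lookup (Av lam) k else 0)"
    unfolding lookup_sum by (intro sum.cong refl) (simp add: bas_def lookup_single when_def umono_kexp lookup_Avec)
  also have "\<dots> = (if k \<in> ?S then Poly_Mapping.lookup (Av lam) k else 0)"
    using fin by simp
  also have "\<dots> = (if k = lam then 0 else Poly_Mapping.lookup (Av lam) k)"
  proof -
    have "k \<in> ?S" if "Poly_Mapping.lookup (Av lam) k \<noteq> 0" "k \<noteq> lam"
    proof -
      have "blt N k lam" using lookup_Avec_blt[OF lam that(1)] that(2) by simp
      then show ?thesis using blt_prec lam ble_wts[OF tranclp_into_rtranclp] by blast
    qed
    then show ?thesis using prec_irrefl[of N lam] by auto
  qed
  finally show "Poly_Mapping.lookup (Av lam) k = Poly_Mapping.lookup (scale (umono n u (kexp lam) * alpha lam lam) (bas lam)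
      + (\<Sum>mu\<in>?S. scale (umono n u (kexp mu) * alpha lam mu) (bas mu))) k"
    by (simp add: lookup_add bas_def lookup_single when_def umono_kexp lookup_Avec)
qed

end

theorem theorem3p3:
  fixes n n' N :: nat and q v :: complex and u :: "nat \<Rightarrow> complex" and m m' :: int
  assumes "n \<ge> 1" and "n' \<ge> 1" and "coprime n n'" and "N \<ge> 1"
    and "q \<noteq> 0" and "v \<noteq> 0" and "\<forall>a<n. u a \<noteq> 0"
    and "int n * m' - int n' * m = 1" and "0 \<le> m" and "m < int n"
  shows "let A = Avec n n' N q v u m m' in
           (inj_on A (wts N) \<and> \<not> module.dependent scale (A ` wts N)
             \<and> module.span scale (A ` wts N) = tpow N) \<and>
           (\<exists>(\<alpha> :: weight \<Rightarrow> weight \<Rightarrow> complex) (k :: weight \<Rightarrow> weight \<Rightarrow> nat \<Rightarrow> int).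
             \<forall>lam\<in>wts N.
               finite {mu\<in>wts N. prec N mu lam} \<and>
               A lam = scale (umono n u (k lam lam) * \<alpha> lam lam) (bas lam)
                 + (\<Sum>mu\<in>{mu\<in>wts N. prec N mu lam}.
                      scale (umono n u (k lam mu) * \<alpha> lam mu) (bas mu)) \<and>
               (\<forall>mu\<in>wts N. \<alpha> lam mu \<in> laurent_ring q v) \<and>
               (\<exists>\<beta>\<in>laurent_ring q v. \<alpha> lam lam * \<beta> = 1))"
proof -
  define k k' where "k = nat m" and "k' = nat m'"
  have m: "m = int k" using \<open>0 \<le> m\<close> by (simp add: k_def)
  \<comment> \<open>The determinant makes \<open>m'\<close> positive, so both parameters are natural
    numbers, as \<open>daha\<close> expects.\<close>
  have "0 \<le> int n' * m" using m by simp
  then have "0 < int n * m'" using assms(8) by linarith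
  then have m': "m' = int k'" using \<open>n \<ge> 1\<close> by (simp add: k'_def zero_less_mult_iff)
  interpret daha n n' N k k' q v u
  proof
    have "int (n * k') = int (n' * k + 1)" using assms(8) by (simp add: m m')
    then show "n * k' = n' * k + 1" by (simp only: of_nat_eq_iff)
  qed (use assms in auto)
  have "finite {mu\<in>wts N. prec N mu lam}" for lam by (rule finite_prec) fact
  then show ?thesis
    unfolding Let_def m m'
    using inj_Avec independent_Avec span_Avec Avec_expansion alpha_Avec
    by (intro conjI exI[of _ alpha] exI[of _ "\<lambda>_. kexp"] ballI) (auto simp: runit_def)
qed

end
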